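(* Let $\mu$ be a measure on $\mathbb R^2$ which generates an ergodic CP-chain $Q$ such that $$E(\pi)=\min\{1,\dim\mu\}$$ for all except countably many orthogonal projections $\pi\in\Pi_{2,1}$. Then $$\dim D(\operatorname{spt}\mu)\ge\min\{1,\dim\mu\}.$$
   Context: $\dim$ of a set is Hausdorff dimension; for a measure $\dim\mu=\inf\{\dim E:\mu(E)>0\}$. $D(K)=\{|x-y|:x,y\in K\}$. Measures are Borel probability measures; $\mathcal P(X)$ is the space of measures on $X$ with the weak topology; $\pi\nu=\nu\circ\pi^{-1}$. $\Pi_{2,1}$ is the set of orthogonal projections $\mathbb R^2\to\mathbb R$, $z\mapsto\langle z,e\rangle$, $|e|=1$ ($e$ and $-e$ identified). **Boxes.** A box $B\subset\mathbb R^d$ is a product of bounded non-degenerate intervals (open, closed or half-open). Let $T_B(x)=|B|^{-1/d}(x-\min\overline B)$, where $|B|$ is the volume and $\min\overline B$ is the lexicographically minimal point of $\overline B$; $B^*=T_B(B)$. If $\mu(B)>0$, $\mu^B=\mu(B)^{-1}T_B(\mu|_B)\in\mathcal P(B^* )$. **Partition operators.** Let $\mathcal E$ be a collection of boxes (closed under homotheties, i.e. positive scalings and translations). A partition operator $\Delta$ on $\mathcal E$ assigns to each $B\in\mathcal E$ a partition $\Delta B\subset\mathcal E$ of $B$ such that $S(\Delta B)=\Delta(SB)$ for homotheties $S$. Put $\Delta^0(B)=\{B\}$, $\Delta^{k+1}(B)=\bigcup_{A\in\Delta^k(B)}\Delta(A)$. $\Delta$ is $\delta$-regular ($0<\delta<1$)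 if for each $B\in\mathcal E$ there is $c>1$ such that for all $k$ every $A\in\Delta^k(B)$ contains a ball of radius $\delta^k/c$ and is contained in a ball of radius $c\delta^k$. **CP-chains.** A ($\delta$-regular) CP-chain with respect to a $\delta$-regular $\Delta$ is a stationary Markov process on $\Omega=\{(B,\nu):B\in\mathcal E,\nu\in\mathcal P(B^* )\}$ with transition kernel $F(B,\nu)=\sum_{A\in\Delta(B^* )}\nu(A)\delta_{(A,\nu^A)}$. Its law $Q$ is a shift-invariant measure on $\Omega^{\mathbb N}$; the chain is ergodic if this shift-invariant measure is ergodic. The measure component $\tilde Q$ is the marginal of the stationary distribution on the $\nu$-coordinate. **Generating.** For $B\in\mathcal E$, a measure $\mu\in\mathcal P(B^* )$ generates $Q$ if, writing $\Delta^k(x)$ for the element of $\Delta^k(B^* )$ containing $x$, for $\mu$-a.e. $x$ one has $\frac1N\sum_{k=0}^{N-1}\delta_{\mu^{\Delta^k(x)}}\to\tilde Q$ weakly as $N\to\infty$, and for every $q\in\mathbb N$ there is a distribution $\tilde Q_q$ (possibly different from $\tilde Q$) such that for $\mu$-a.e. $x$, $\frac1N\sum_{k=0}^{N-1}\delta_{\mu^{\Delta^{qk}(x)}}\to\tilde Q_q$ weakly. **The function $E$.** For $r>0$ let $H_r(\nu)=-\int\log\nu(B(x,r))\,d\nu(x)$. For an ergodic $\delta$-regular CP-chain $Q$ and $\pi\in\Pi_{2,1}$ put $E_q(\pi)=\int\frac{1}{q\log(1/\delta)}H_{\delta^q}(\pi\nu)\,d\tilde Q(\nu)$ and $E(\pi)=\lim_{q\to\infty}E_q(\pi)$;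 this limit exists by a theorem of Hochman and Shmerkin. *)

theory Defs
  imports "HOL-Probability.Probability"
begin

section \<open>Spaces of measures\<close>

definition borel_of :: "'a topology \<Rightarrow> 'a measure" where
  "borel_of X = sigma (topspace X) {U. openin X U}"

lemma borel_of_euclidean: "borel_of (euclidean :: 'a::topological_space topology) = borel"
  by (simp add: borel_of_def borel_def)

definition prob_measures :: "'a topology \<Rightarrow> 'a measure set" where
  "prob_measures X = {\<mu>. sets \<mu> = sets (borel_of X) \<and> prob_space \<mu>}"

text \<open>The coarsest topology on the Borel probability measures of \<^term>\<open>X\<close> that makes integration
  against every bounded continuous function continuous. It is applied both to \<open>euclidean\<close> and,
  for distributions (measures on spaces of measures), to \<open>weak_topology euclidean\<close>.\<close>

definition weak_topology :: "'a topology \<Rightarrow> 'a measure topology" where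
  "weak_topology X = topology_generated_by
     {{\<mu> \<in> prob_measures X. (\<integral>x. f x \<partial>\<mu>) \<in> U} | f U.
        continuous_map X euclideanreal f \<and> bounded (f ` topspace X) \<and> open U}"

lemma topspace_weak_topology: "topspace (weak_topology X) = prob_measures X"
proof -
  have *: "prob_measures X = {\<mu> \<in> prob_measures X. (\<integral>x. (\<lambda>_. 0::real) x \<partial>\<mu>) \<in> UNIV}
      \<and> continuous_map X euclideanreal (\<lambda>_. 0) \<and> bounded ((\<lambda>_. 0::real) ` topspace X)
      \<and> open (UNIV :: real set)"
    by (auto simp: bounded_def)
  show ?thesis
    unfolding weak_topology_def topology_generated_by_topspace
    using * by (intro equalityI subsetI; blast)
qed

text \<open>For a Borel set \<open>S\<close>, the measures on \<open>S\<close>, regarded as measures on the ambient space that are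
  carried by \<open>S\<close>; the weak topology of \<open>S\<close> is then the subspace topology.\<close>

definition prob_on :: "'a::topological_space set \<Rightarrow> 'a measure set" where
  "prob_on S = {\<nu> \<in> prob_measures euclidean. emeasure \<nu> S = 1}"

definition empirical :: "'a topology \<Rightarrow> (nat \<Rightarrow> 'a) \<Rightarrow> nat \<Rightarrow> 'a measure" where
  "empirical X y N = distr (uniform_count_measure {..<N}) (borel_of X) y"


section \<open>Dimension, support and distance sets\<close>

text \<open>The sets of a cover must be required to be bounded, because \<^const>\<open>diameter\<close> is
  meaningless on unbounded sets.\<close>

definition hausdorff_premeasure :: "real \<Rightarrow> real \<Rightarrow> 'a::metric_space set \<Rightarrow> ennreal" where
  "hausdorff_premeasure s \<epsilon> A =
     (INF U \<in> {U :: nat \<Rightarrow> 'a set. A \<subseteq> (\<Union>i. U i) \<and> (\<forall>i. bounded (U i) \<and> diameter (U i) \<le> \<epsilon>)}.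
        \<Sum>i. ennreal (diameter (U i) powr s))"

definition hausdorff_measure :: "real \<Rightarrow> 'a::metric_space set \<Rightarrow> ennreal" where
  "hausdorff_measure s A = (SUP \<epsilon> \<in> {0<..}. hausdorff_premeasure s \<epsilon> A)"

text \<open>Only \<open>s > 0\<close> is considered, which does not change the infimum and avoids the value of
  \<open>0 powr 0\<close>. The dimension is real-valued; it is used only in Euclidean spaces, where the set
  below is nonempty.\<close>

definition hausdorff_dim :: "'a::metric_space set \<Rightarrow> real" where
  "hausdorff_dim A = Inf {s. s > 0 \<and> hausdorff_measure s A = 0}"

definition measure_dim :: "'a::metric_space measure \<Rightarrow> real" where
  "measure_dim \<mu> = Inf {hausdorff_dim A | A. A \<in> sets \<mu> \<and> emeasure \<mu> A > 0}"

definition spt :: "'a::topological_space measure \<Rightarrow> 'a set" where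
  "spt \<mu> = {x. \<forall>U. open U \<and> x \<in> U \<longrightarrow> emeasure \<mu> U > 0}"

definition distance_set :: "'a::metric_space set \<Rightarrow> real set" where
  "distance_set K = {dist x y | x y. x \<in> K \<and> y \<in> K}"


section \<open>Boxes\<close>

definition is_box :: "(real^2) set \<Rightarrow> bool" where
  "is_box B \<longleftrightarrow> (\<exists>I :: 2 \<Rightarrow> real set.
     (\<forall>i. is_interval (I i) \<and> bounded (I i) \<and> interior (I i) \<noteq> {}) \<and> B = {x. \<forall>i. x $ i \<in> I i})"

definition lexmin :: "(real^2) set \<Rightarrow> real^2" where
  "lexmin S = (THE p. p \<in> S \<and> (\<forall>x\<in>S. p $ 1 < x $ 1 \<or> p $ 1 = x $ 1 \<and> p $ 2 \<le> x $ 2))"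

definition box_map :: "(real^2) set \<Rightarrow> real^2 \<Rightarrow> real^2" where
  "box_map B x = measure lborel B powr (- 1 / 2) *\<^sub>R (x - lexmin (closure B))"

definition box_norm :: "(real^2) set \<Rightarrow> (real^2) set" where
  "box_norm B = box_map B ` B"

text \<open>The measure \<open>\<mu>\<^sup>B\<close>; it is meaningful only if \<open>\<mu>(B) > 0\<close>.\<close>

definition magnify :: "(real^2) measure \<Rightarrow> (real^2) set \<Rightarrow> (real^2) measure" where
  "magnify \<mu> B = distr (uniform_measure \<mu> B) borel (box_map B)"

definition homothety :: "real \<Rightarrow> real^2 \<Rightarrow> real^2 \<Rightarrow> real^2" where
  "homothety c t x = c *\<^sub>R x + t"

definition box_collection :: "(real^2) set set \<Rightarrow> bool" where
  "box_collection \<E> \<longleftrightarrow>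
     (\<forall>B\<in>\<E>. is_box B) \<and> (\<forall>B\<in>\<E>. \<forall>c>0. \<forall>t. homothety c t ` B \<in> \<E>)"


section \<open>Partition operators\<close>

type_synonym partition_op = "(real^2) set \<Rightarrow> (real^2) set set"

definition partition_operator :: "(real^2) set set \<Rightarrow> partition_op \<Rightarrow> bool" where
  "partition_operator \<E> \<Delta> \<longleftrightarrow>
     (\<forall>B\<in>\<E>. \<Delta> B \<subseteq> \<E> \<and> partition_on B (\<Delta> B)) \<and>
     (\<forall>B\<in>\<E>. \<forall>c>0. \<forall>t. (`) (homothety c t) ` \<Delta> B = \<Delta> (homothety c t ` B))"

primrec iterate_partition :: "partition_op \<Rightarrow> nat \<Rightarrow> (real^2) set \<Rightarrow> (real^2) set set" where
  "iterate_partition \<Delta> 0 B = {B}"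
| "iterate_partition \<Delta> (Suc k) B = (\<Union>A \<in> iterate_partition \<Delta> k B. \<Delta> A)"

definition regular_partition :: "(real^2) set set \<Rightarrow> partition_op \<Rightarrow> real \<Rightarrow> bool" where
  "regular_partition \<E> \<Delta> \<delta> \<longleftrightarrow> 0 < \<delta> \<and> \<delta> < 1 \<and>
     (\<forall>B\<in>\<E>. \<exists>c>1. \<forall>k. \<forall>A \<in> iterate_partition \<Delta> k B.
        (\<exists>x. ball x (\<delta> ^ k / c) \<subseteq> A) \<and> (\<exists>y. A \<subseteq> ball y (c * \<delta> ^ k)))"

definition cell :: "partition_op \<Rightarrow> nat \<Rightarrow> (real^2) set \<Rightarrow> real^2 \<Rightarrow> (real^2) set" where
  "cell \<Delta> k B x = (THE A. A \<in> iterate_partition \<Delta> k B \<and> x \<in> A)"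


section \<open>CP-chains\<close>

text \<open>A box is identified with the endpoints of its two sides together with the information which
  endpoints belong to the sides; this makes the space of boxes a subset of
  \<open>\<real>\<^sup>2 \<times> \<real>\<^sup>2 \<times>\<close> (a finite discrete space), whose Borel sets it inherits.\<close>

definition side :: "(real^2) set \<Rightarrow> 2 \<Rightarrow> real set" where
  "side B i = (\<lambda>x. x $ i) ` B"

definition box_code :: "(real^2) set \<Rightarrow> ((real^2) \<times> (real^2)) \<times> (2 set \<times> 2 set)" where
  "box_code B = ((\<chi> i. Inf (side B i), \<chi> i. Sup (side B i)),
                 ({i. Inf (side B i) \<in> side B i}, {i. Sup (side B i) \<in> side B i}))"

definition box_space :: "(real^2) set measure" where
  "box_space = vimage_algebra {B. is_box B} box_code (borel \<Otimes>\<^sub>M count_space UNIV)"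

type_synonym cp_state = "(real^2) set \<times> (real^2) measure"

definition state_space :: "(real^2) set set \<Rightarrow> cp_state measure" where
  "state_space \<E> = restrict_space (box_space \<Otimes>\<^sub>M borel_of (weak_topology euclidean))
     {(B, \<nu>). B \<in> \<E> \<and> \<nu> \<in> prob_on (box_norm B)}"

text \<open>\<open>F(B, \<nu>) = \<Sum>\<^sub>A \<nu>(A) \<delta>\<^bsub>(A, \<nu>\<^sup>A)\<^esub>\<close>, the sum being over the \<open>A \<in> \<Delta>(B\<^sup>*)\<close> of positive measure,
  written as the image of the weights \<open>\<nu>(A)\<close> under \<open>A \<mapsto> (A, \<nu>\<^sup>A)\<close>.\<close>

definition cp_kernel :: "(real^2) set set \<Rightarrow> partition_op \<Rightarrow> cp_state \<Rightarrow> cp_state measure" where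
  "cp_kernel \<E> \<Delta> = (\<lambda>(B, \<nu>).
     distr (density (count_space {A \<in> \<Delta> (box_norm B). emeasure \<nu> A > 0}) (emeasure \<nu>))
       (state_space \<E>) (\<lambda>A. (A, magnify \<nu> A)))"

definition path_space :: "(real^2) set set \<Rightarrow> (nat \<Rightarrow> cp_state) measure" where
  "path_space \<E> = Pi\<^sub>M UNIV (\<lambda>_. state_space \<E>)"

definition shift :: "(nat \<Rightarrow> 'a) \<Rightarrow> nat \<Rightarrow> 'a" where
  "shift \<omega> n = \<omega> (Suc n)"

text \<open>\<open>Q\<close> is the law of a stationary process, \<^const>\<open>cp_kernel\<close> is a (measurable) Markov kernel,
  and given the states up to time \<open>n\<close> the next state is distributed according to the kernel at the
  state at time \<open>n\<close>.\<close>

definition cp_chain ::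
    "(real^2) set set \<Rightarrow> partition_op \<Rightarrow> real \<Rightarrow> (nat \<Rightarrow> cp_state) measure \<Rightarrow> bool" where
  "cp_chain \<E> \<Delta> \<delta> Q \<longleftrightarrow>
     box_collection \<E> \<and> partition_operator \<E> \<Delta> \<and> regular_partition \<E> \<Delta> \<delta> \<and>
     prob_space Q \<and> sets Q = sets (path_space \<E>) \<and>
     distr Q (path_space \<E>) shift = Q \<and>
     cp_kernel \<E> \<Delta> \<in> state_space \<E> \<rightarrow>\<^sub>M prob_algebra (state_space \<E>) \<and>
     (\<forall>n. \<forall>S \<in> sets (Pi\<^sub>M {..n} (\<lambda>_. state_space \<E>)). \<forall>T \<in> sets (state_space \<E>).
        emeasure Q {\<omega> \<in> space Q. restrict \<omega> {..n} \<in> S \<and> \<omega> (Suc n) \<in> T} =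
        (\<integral>\<^sup>+\<omega>. indicator S (restrict \<omega> {..n}) * emeasure (cp_kernel \<E> \<Delta> (\<omega> n)) T \<partial>Q))"

definition ergodic_shift :: "(nat \<Rightarrow> 'a) measure \<Rightarrow> bool" where
  "ergodic_shift Q \<longleftrightarrow>
     (\<forall>A \<in> sets Q. shift -` A \<inter> space Q = A \<longrightarrow> emeasure Q A = 0 \<or> emeasure Q A = 1)"

definition ergodic_cp_chain ::
    "(real^2) set set \<Rightarrow> partition_op \<Rightarrow> real \<Rightarrow> (nat \<Rightarrow> cp_state) measure \<Rightarrow> bool" where
  "ergodic_cp_chain \<E> \<Delta> \<delta> Q \<longleftrightarrow> cp_chain \<E> \<Delta> \<delta> Q \<and> ergodic_shift Q"

definition measure_component ::
    "(nat \<Rightarrow> cp_state) measure \<Rightarrow> (real^2) measure measure" where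
  "measure_component Q = distr Q (borel_of (weak_topology euclidean)) (\<lambda>\<omega>. snd (\<omega> 0))"

definition generates :: "(real^2) set set \<Rightarrow> partition_op \<Rightarrow> (real^2) set \<Rightarrow> (real^2) measure
    \<Rightarrow> (nat \<Rightarrow> cp_state) measure \<Rightarrow> bool" where
  "generates \<E> \<Delta> B \<mu> Q \<longleftrightarrow>
     B \<in> \<E> \<and> \<mu> \<in> prob_on (box_norm B) \<and>
     (AE x in \<mu>. limitin (weak_topology (weak_topology euclidean))
        (empirical (weak_topology euclidean) (\<lambda>k. magnify \<mu> (cell \<Delta> k (box_norm B) x)))
        (measure_component Q) sequentially) \<and>
     (\<forall>q. \<exists>R \<in> prob_measures (weak_topology euclidean). AE x in \<mu>.
        limitin (weak_topology (weak_topology euclidean))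
        (empirical (weak_topology euclidean) (\<lambda>k. magnify \<mu> (cell \<Delta> (q * k) (box_norm B) x)))
        R sequentially)"


section \<open>Entropy of projections\<close>

text \<open>The functions below are invariant under \<open>x \<mapsto> -x\<close> on the line, so listing both of the
  projections given by \<open>e\<close> and \<open>-e\<close> does not affect countability of sets of projections.\<close>

definition projections21 :: "(real^2 \<Rightarrow> real) set" where
  "projections21 = {\<pi>. \<exists>e. norm e = 1 \<and> \<pi> = (\<lambda>z. z \<bullet> e)}"

definition scale_entropy :: "real \<Rightarrow> 'a::metric_space measure \<Rightarrow> real" where
  "scale_entropy r \<nu> = - (\<integral>x. ln (measure \<nu> (cball x r)) \<partial>\<nu>)"

definition entropy_at :: "real \<Rightarrow> (nat \<Rightarrow> cp_state) measure \<Rightarrow> nat \<Rightarrow> (real^2 \<Rightarrow> real) \<Rightarrow> real" where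
  "entropy_at \<delta> Q q \<pi> =
     (\<integral>\<nu>. 1 / (real q * ln (1 / \<delta>)) * scale_entropy (\<delta> ^ q) (distr \<nu> borel \<pi>)
        \<partial>measure_component Q)"

definition mean_entropy :: "real \<Rightarrow> (nat \<Rightarrow> cp_state) measure \<Rightarrow> (real^2 \<Rightarrow> real) \<Rightarrow> real" where
  "mean_entropy \<delta> Q \<pi> = lim (\<lambda>q. entropy_at \<delta> Q q \<pi>)"

end

theory Submission
  imports Defs "HOL-Real_Asymp.Real_Asymp"
begin

text \<open>
  Put \<open>s = min {1, dim \<mu>}\<close>, fix a point \<open>y\<close> of the support and let \<open>g x = |x - y|\<close>. The distance set
  contains the image of the support under \<open>g\<close>. A direction \<open>e\<close> is exceptional if \<open>E(\<pi>\<^sub>e) \<noteq> s\<close>, where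
  \<open>\<pi>\<^sub>e z = \<langle>z, e\<rangle>\<close>. If some half-line that leaves \<open>y\<close> in an exceptional direction has positive
  measure, then \<open>g\<close> is isometric on it, so the distance set contains an isometric copy of a set of
  positive measure and has dimension at least \<open>dim \<mu>\<close>. Otherwise, as there are only countably many
  exceptional directions, almost every \<open>x\<close> is seen from \<open>y\<close> in a direction \<open>e = (x - y) / |x - y|\<close>
  with \<open>E(\<pi>\<^sub>e) = s\<close>. It is then enough that the image of \<open>\<mu>\<close> under \<open>g\<close> has lower local dimension at
  least \<open>E(\<pi>\<^sub>e)\<close> at \<open>g x\<close> (\<open>AE_distance_local_dimension\<close>); the mass distribution principle
  (\<open>mass_distribution\<close>) turns this into the bound for the Hausdorff dimension.

  The local dimension is estimated by local entropy averages, in the spirit of Hochman and Shmerkin.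
  Fix \<open>q\<close> and follow the mass of a window around \<open>g x\<close> whose radius is a constant times \<open>\<delta>\<^sup>n\<close>. By
  Gibbs' inequality, the logarithmic loss of this mass from level \<open>n\<close> to level \<open>n + q\<close>, averaged
  over the cell \<open>A\<close> of \<open>x\<close> of level \<open>n\<close>, is up to a constant at least the entropy at scale
  \<open>\<delta>\<^sup>n\<^sup>+\<^sup>q\<close> of the image under \<open>g\<close> of \<open>\<mu>\<close> conditioned on \<open>A\<close> (\<open>mass_loss_entropy\<close>). A law of
  large numbers (\<open>averages_to_zero\<close>) replaces the losses along \<open>x\<close> by these conditional means, so
  the local dimension is at least the asymptotic average of the entropies
  (\<open>AE_label_entropy_le_window\<close>). On a small cell \<open>g\<close> agrees up to \<open>\<delta>\<^sup>n\<^sup>+\<^sup>q\<close> with \<open>\<pi>\<^sub>e\<close> plus a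
  constant, so the entropy is that of \<open>\<pi>\<^sub>e\<close> applied to the magnified measure \<open>\<mu>\<^sup>A\<close>, at scale
  \<open>\<delta>\<^sup>q\<close>. Since \<open>\<mu>\<close> generates the chain, these entropies average to the integral that defines
  \<open>q log(1/\<delta>) E\<^sub>q(\<pi>\<^sub>e)\<close>. All errors are bounded independently of \<open>q\<close>, and they disappear after division
  by \<open>q log(1/\<delta>)\<close> as \<open>q \<rightarrow> \<infinity>\<close>.

  Two points need care. The ball entropy \<open>H\<^sub>r\<close> is not weakly continuous; up to a bounded error it
  agrees with the entropy of a partition of unity into hat functions, which is
  (\<open>scale_entropy_hat\<close>, \<open>continuous_map_projected_entropy\<close>). And the limit \<open>E(\<pi>) = lim E\<^sub>q(\<pi>)\<close> must be
  shown to exist: the entropies of the cells of \<open>\<mu>\<close> are superadditive in \<open>q\<close> up to a constant, and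
  this passes to their averages and to the limit (\<open>limit_entropy_superadditive\<close>).
\<close>

section \<open>Entropy of finite distributions\<close>

definition eta :: "real \<Rightarrow> real" where
  "eta t = - (t * ln t)"

lemma eta_0 [simp]: "eta 0 = 0"
  by (simp add: eta_def)

lemma eta_nonneg: "0 \<le> t \<Longrightarrow> t \<le> 1 \<Longrightarrow> 0 \<le> eta t"
  by (cases "t = 0") (auto simp: eta_def mult_nonneg_nonpos)

text \<open>
  Gibbs' inequality for a single term: it is \<open>ln x \<le> x - 1\<close> at \<open>x = t / p\<close>. Bounding \<open>t - p\<close> by \<open>t\<close>
  makes it applicable to weights \<open>t\<close> of any bounded total mass.
\<close>

lemma eta_ge: 
  assumes "0 \<le> p" "0 \<le> t" "p > 0 \<Longrightarrow> t > 0"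
  shows "eta p - t \<le> - (p * ln t)"
proof (cases "p = 0")
  case False
  hence p: "p > 0" "t > 0" using assms by auto
  have "ln (t / p) \<le> t / p - 1" using p by (intro ln_le_minus_one) auto
  hence "p * (ln t - ln p) \<le> p * (t / p - 1)" using p by (simp add: ln_div)
  moreover have "p * (t / p - 1) = t - p" using p by (simp add: field_simps)
  ultimately show ?thesis using p by (simp add: eta_def algebra_simps)
qed (use assms in auto)

lemma continuous_on_eta: "continuous_on {0..} eta"
proof -
  have "((\<lambda>x::real. - (x * ln x)) \<longlongrightarrow> 0) (at_right 0)" by real_asymp
  hence 0: "continuous (at 0 within {0..}) eta"
    unfolding continuous_within eta_def
    by (simp add: at_within_Ici_at_right)
  have "isCont eta x" if "x > 0" for x
    unfolding eta_def using that by (intro continuous_intros) auto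
  with 0 show ?thesis
    unfolding continuous_on_eq_continuous_within
    by (metis atLeast_iff continuous_at_imp_continuous_at_within order_le_less)
qed

text \<open>
  A coupling \<open>w\<close> of two distributions under which each \<open>j\<close> is compatible with at most \<open>M\<close> values of \<open>i\<close>
  shows that the entropy of \<open>i\<close> exceeds that of \<open>j\<close> by at most a constant. The conditional entropy of \<open>i\<close>
  given \<open>j\<close> is at most \<open>ln M\<close>; the cruder constant \<open>M\<close> is what \<open>ln x \<le> x\<close> gives term by term, and it
  is as good for the purpose. All changes of partitions below are instances.
\<close>

lemma sum_eta_le_coupling:
  fixes w :: "'i \<Rightarrow> 'j \<Rightarrow> real"
  assumes fin: "finite I" "finite J"
    and nonneg: "\<And>i j. i \<in> I \<Longrightarrow> j \<in> J \<Longrightarrow> 0 \<le> w i j"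
    and total: "(\<Sum>j\<in>J. \<Sum>i\<in>I. w i j) \<le> 1"
    and few: "\<And>j. j \<in> J \<Longrightarrow> real (card {i\<in>I. 0 < w i j}) \<le> M"
    and "0 \<le> M"
  shows "(\<Sum>i\<in>I. eta (\<Sum>j\<in>J. w i j)) \<le> (\<Sum>j\<in>J. eta (\<Sum>i\<in>I. w i j)) + M"
proof -
  define a where "a j = (\<Sum>i\<in>I. w i j)" for j
  define b where "b i = (\<Sum>j\<in>J. w i j)" for i
  have a0: "0 \<le> a j" if "j \<in> J" for j using nonneg that by (auto simp: a_def intro: sum_nonneg)
  have termwise: "w i j * (- ln (b i)) \<le> w i j * (- ln (a j)) + (if 0 < w i j then a j else 0)"
    if ij: "i \<in> I" "j \<in> J" for i j
  proof (cases "0 < w i j")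
    case True
    have wa: "w i j \<le> a j" unfolding a_def using fin nonneg ij by (intro member_le_sum) auto
    have wb: "w i j \<le> b i" unfolding b_def using fin nonneg ij by (intro member_le_sum) auto
    have "ln (a j / b i) \<le> a j / b i" using True wa wb
      by (smt (verit) divide_pos_pos ln_le_minus_one)
    hence "ln (a j) - ln (b i) \<le> a j / b i"
      using True wa wb by (simp add: ln_div)
    hence "w i j * (ln (a j) - ln (b i)) \<le> w i j * (a j / b i)"
      using True by (intro mult_left_mono) auto
    also have "\<dots> \<le> b i * (a j / b i)"
      using True wa wb by (intro mult_right_mono) auto
    also have "\<dots> = a j" using True wb by auto
    finally show ?thesis using True by (simp add: algebra_simps)
  next
    case False
    hence "w i j = 0" using nonneg[OF ij] by simp
    thus ?thesis by simp
  qed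
  have "(\<Sum>i\<in>I. eta (b i)) = (\<Sum>i\<in>I. \<Sum>j\<in>J. w i j * (- ln (b i)))"
    by (simp add: eta_def b_def sum_distrib_right sum_negf)
  also have "\<dots> \<le> (\<Sum>i\<in>I. \<Sum>j\<in>J. w i j * (- ln (a j)) + (if 0 < w i j then a j else 0))"
    by (intro sum_mono termwise)
  also have "\<dots> = (\<Sum>j\<in>J. \<Sum>i\<in>I. w i j * (- ln (a j)) + (if 0 < w i j then a j else 0))"
    by (rule sum.swap)
  also have "\<dots> = (\<Sum>j\<in>J. eta (a j)) + (\<Sum>j\<in>J. a j * card {i\<in>I. 0 < w i j})"
  proof (subst sum.distrib[symmetric], intro sum.cong refl)
    fix j
    have "(\<Sum>i\<in>I. if 0 < w i j then a j else 0) = a j * card {i\<in>I. 0 < w i j}"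
      using fin by (subst sum.inter_filter[symmetric]) auto
    moreover have "(\<Sum>i\<in>I. w i j * (- ln (a j))) = eta (a j)"
      unfolding sum_distrib_right[symmetric] by (simp add: a_def eta_def)
    ultimately show "(\<Sum>i\<in>I. w i j * (- ln (a j)) + (if 0 < w i j then a j else 0))
        = eta (a j) + a j * card {i\<in>I. 0 < w i j}" by (simp only: sum.distrib)
  qed
  also have "(\<Sum>j\<in>J. a j * card {i\<in>I. 0 < w i j}) \<le> (\<Sum>j\<in>J. a j * M)"
    by (intro sum_mono mult_left_mono few a0)
  also have "\<dots> = (\<Sum>j\<in>J. a j) * M" by (simp add: sum_distrib_right)
  also have "\<dots> \<le> M"
    using mult_right_mono[of "sum a J" 1 M] total \<open>0 \<le> M\<close> by (simp add: a_def)
  finally show ?thesis by (simp add: a_def b_def)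
qed

text \<open>
  The chain rule for a mixture: the points \<open>a\<close> are chosen with weights \<open>w\<close>, carry a coarse label \<open>l a\<close>,
  and emit a fine label \<open>i\<close> with probability \<open>p a i\<close>. If \<open>i\<close> determines the coarse label up to \<open>M\<close>
  possibilities, then the entropy of \<open>i\<close> is, up to a constant, at least that of the coarse label plus the
  mean entropy of the emitted distributions. This is the source of superadditivity.
\<close>

lemma sum_eta_chain:
  fixes p :: "'a \<Rightarrow> 'i \<Rightarrow> real" and l :: "'a \<Rightarrow> 'l"
  assumes fin: "finite S" "finite I"
    and w: "\<And>a. a \<in> S \<Longrightarrow> 0 \<le> w a" "(\<Sum>a\<in>S. w a) = 1"
    and p: "\<And>a i. a \<in> S \<Longrightarrow> i \<in> I \<Longrightarrow> 0 \<le> p a i" "\<And>a. a \<in> S \<Longrightarrow> (\<Sum>i\<in>I. p a i) = 1"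
    and few: "\<And>i. i \<in> I \<Longrightarrow> real (card (l ` {a\<in>S. 0 < w a \<and> 0 < p a i})) \<le> M"
  shows "(\<Sum>a\<in>S. w a * (\<Sum>i\<in>I. eta (p a i))) + (\<Sum>k\<in>l ` S. eta (\<Sum>a\<in>{a\<in>S. l a = k}. w a))
    \<le> (\<Sum>i\<in>I. eta (\<Sum>a\<in>S. w a * p a i)) + M"
proof -
  define b where "b i = (\<Sum>a\<in>S. w a * p a i)" for i
  define m where "m k = (\<Sum>a\<in>{a\<in>S. l a = k}. w a)" for k
  have b0: "0 \<le> b i" if "i \<in> I" for i
    unfolding b_def using w p that by (intro sum_nonneg) auto
  have sb: "(\<Sum>i\<in>I. b i) = 1"
  proof -
    have "(\<Sum>i\<in>I. b i) = (\<Sum>a\<in>S. w a * (\<Sum>i\<in>I. p a i))"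
      unfolding b_def by (subst sum.swap) (simp add: sum_distrib_left)
    thus ?thesis using p w by simp
  qed
  have wm: "w a \<le> m (l a)" if "a \<in> S" for a
    unfolding m_def using fin w that by (intro member_le_sum) auto
  have termwise: "w a * p a i * (- ln (p a i)) + w a * p a i * (- ln (m (l a)))
      \<le> w a * p a i * (- ln (b i)) + (if 0 < w a \<and> 0 < p a i then w a * b i / m (l a) else 0)"
    if ai: "a \<in> S" "i \<in> I" for a i
  proof (cases "0 < w a \<and> 0 < p a i")
    case True
    have bp: "w a * p a i \<le> b i" unfolding b_def
      using fin w p ai by (intro member_le_sum) auto
    have pos: "0 < b i" "0 < m (l a)" "0 < p a i" "0 < w a"
      using True bp wm[OF ai(1)] mult_pos_pos[of "w a" "p a i"] by linarith+
    have "ln (b i / (p a i * m (l a))) \<le> b i / (p a i * m (l a))"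
      using pos by (smt (verit) divide_pos_pos ln_le_minus_one mult_pos_pos)
    hence "w a * p a i * (ln (b i) - ln (p a i) - ln (m (l a)))
        \<le> w a * p a i * (b i / (p a i * m (l a)))"
      using pos by (intro mult_left_mono) (auto simp: ln_div ln_mult)
    also have "\<dots> = w a * b i / m (l a)" using pos by (simp add: field_simps)
    finally show ?thesis using True by (simp add: algebra_simps)
  next
    case False
    hence "w a * p a i = 0" using w(1) p(1) ai by (metis less_eq_real_def mult_zero_left mult_zero_right)
    thus ?thesis unfolding if_not_P[OF False] by (simp only: mult_zero_left)
  qed
  have split_m: "(\<Sum>a\<in>S. w a * (- ln (m (l a)))) = (\<Sum>k\<in>l ` S. eta (m k))"
  proof -
    have "(\<Sum>a\<in>S. w a * (- ln (m (l a)))) = (\<Sum>k\<in>l ` S. \<Sum>a\<in>{a\<in>S. l a = k}. w a * (- ln (m (l a))))"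
      using fin by (intro sum.image_gen)
    also have "\<dots> = (\<Sum>k\<in>l ` S. eta (m k))"
      unfolding eta_def by (intro sum.cong refl) (simp add: m_def sum_distrib_right sum_negf)
    finally show ?thesis .
  qed
  have rest: "(\<Sum>a\<in>S. if 0 < w a \<and> 0 < p a i then w a * b i / m (l a) else 0) \<le> b i * M"
    if i: "i \<in> I" for i
  proof -
    let ?S = "{a\<in>S. 0 < w a \<and> 0 < p a i}"
    have "(\<Sum>a\<in>S. if 0 < w a \<and> 0 < p a i then w a * b i / m (l a) else 0)
       = (\<Sum>a\<in>?S. w a * b i / m (l a))"
      using fin by (simp add: sum.inter_filter)
    also have "\<dots> = (\<Sum>k\<in>l ` ?S. \<Sum>a\<in>{a\<in>?S. l a = k}. w a * b i / m (l a))"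
      using fin by (intro sum.image_gen) auto
    also have "\<dots> \<le> (\<Sum>k\<in>l ` ?S. b i)"
    proof (rule sum_mono)
      fix k assume "k \<in> l ` ?S"
      then obtain a0 where a0: "a0 \<in> S" "0 < w a0" "l a0 = k" by auto
      have mk: "0 < m k" using wm[OF a0(1)] a0 by simp
      have "(\<Sum>a\<in>{a\<in>?S. l a = k}. w a * b i / m (l a)) = (\<Sum>a\<in>{a\<in>?S. l a = k}. w a) * (b i / m k)"
        by (subst sum_distrib_right) (auto intro: sum.cong)
      also have "\<dots> \<le> m k * (b i / m k)"
        unfolding m_def[of k] using fin w b0[OF i] mk
        by (intro mult_right_mono sum_mono2) (auto simp: m_def)
      also have "\<dots> = b i" using mk by simp
      finally show "(\<Sum>a\<in>{a\<in>?S. l a = k}. w a * b i / m (l a)) \<le> b i" .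
    qed
    also have "\<dots> = b i * card (l ` ?S)" by simp
    also have "\<dots> \<le> b i * M" by (intro mult_left_mono few i b0)
    finally show ?thesis .
  qed
  have "(\<Sum>a\<in>S. w a * (\<Sum>i\<in>I. eta (p a i))) + (\<Sum>k\<in>l ` S. eta (m k))
     = (\<Sum>a\<in>S. w a * (\<Sum>i\<in>I. eta (p a i))) + (\<Sum>a\<in>S. (\<Sum>i\<in>I. p a i) * w a * (- ln (m (l a))))"
    using p(2) by (simp add: split_m[symmetric])
  also have "\<dots> = (\<Sum>a\<in>S. \<Sum>i\<in>I. w a * p a i * (- ln (p a i)) + w a * p a i * (- ln (m (l a))))"
    by (simp add: eta_def sum_distrib_left sum_distrib_right sum.distrib sum_negf sum_subtractf mult_ac)
  also have "\<dots> \<le> (\<Sum>a\<in>S. \<Sum>i\<in>I. w a * p a i * (- ln (b i))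
       + (if 0 < w a \<and> 0 < p a i then w a * b i / m (l a) else 0))"
    by (intro sum_mono termwise)
  also have "\<dots> = (\<Sum>i\<in>I. \<Sum>a\<in>S. w a * p a i * (- ln (b i))
       + (if 0 < w a \<and> 0 < p a i then w a * b i / m (l a) else 0))"
    by (rule sum.swap)
  also have "\<dots> = (\<Sum>i\<in>I. eta (b i))
       + (\<Sum>i\<in>I. \<Sum>a\<in>S. if 0 < w a \<and> 0 < p a i then w a * b i / m (l a) else 0)"
  proof -
    have "(\<Sum>a\<in>S. w a * p a i * (- ln (b i))) = eta (b i)" for i
      unfolding sum_distrib_right[symmetric] by (simp add: b_def eta_def)
    thus ?thesis by (simp only: sum.distrib)
  qed
  also have "\<dots> \<le> (\<Sum>i\<in>I. eta (b i)) + (\<Sum>i\<in>I. b i * M)"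
    by (intro add_left_mono sum_mono rest)
  also have "(\<Sum>i\<in>I. b i * M) = M" using sb by (simp add: sum_distrib_right[symmetric])
  finally show ?thesis by (simp add: m_def b_def)
qed

lemma convergent_almost_superadditive:
  fixes u :: "nat \<Rightarrow> real" and K :: real
  assumes super: "\<And>m n. u m + u n - C \<le> u (m + n)" and bound: "\<And>n. u n \<le> K * n + K"
  shows "convergent (\<lambda>n. u n / n)"
proof -
  \<comment> \<open>Subtracting the error once makes the sequence superadditive, and Fekete's argument applies.\<close>
  define v where "v n = u n - C" for n
  have v: "v m + v n \<le> v (m + n)" for m n using super[of m n] by (simp add: v_def)
  have vk: "real k * v m \<le> v (k * m)" if "k > 0" for k m
    using that
  proof (induction k rule: nat_induct_non_zero)
    case (Suc k)
    thus ?case using v[of m "k * m"] by (simp add: algebra_simps)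
  qed simp
  define L where "L = Sup ((\<lambda>n. v n / n) ` {1..})"
  have bdd: "bdd_above ((\<lambda>n. v n / n) ` {1..})"
  proof (rule bdd_aboveI2)
    fix n :: nat assume n: "n \<in> {1..}"
    have "v n \<le> (2 * \<bar>K\<bar> + \<bar>C\<bar>) * n"
    proof -
      have "v n \<le> K * n + K - C" using bound[of n] by (simp add: v_def)
      also have "\<dots> \<le> \<bar>K\<bar> * n + \<bar>K\<bar> * n + \<bar>C\<bar> * n"
        using n mult_left_mono[of 1 "real n" "\<bar>K\<bar>"] mult_left_mono[of 1 "real n" "\<bar>C\<bar>"]
          mult_right_mono[of K "\<bar>K\<bar>" "real n"] by auto
      finally show ?thesis by (simp add: algebra_simps)
    qed
    thus "v n / n \<le> 2 * \<bar>K\<bar> + \<bar>C\<bar>" using n by (simp add: field_simps)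
  qed
  have "(\<lambda>n. v n / n) \<longlonglongrightarrow> L"
  proof (rule LIMSEQ_I)
    fix e :: real assume e: "e > 0"
    obtain m where m: "m \<ge> 1" "v m / m > L - e / 2"
      using less_cSup_iff[OF _ bdd, of "L - e/2"] e unfolding L_def by auto
    define B where "B = Max ((\<lambda>i. \<bar>v i - i * (v m / m)\<bar>) ` {..<2*m})"
    have B: "\<bar>v i - i * (v m / m)\<bar> \<le> B" if "i < 2*m" for i
      unfolding B_def using that by (intro Max_ge) auto
    obtain N where N: "real N > 2 * B / e" using reals_Archimedean2 by blast
    show "\<exists>no. \<forall>n\<ge>no. norm (v n / n - L) < e"
    proof (intro exI allI impI)
      fix n assume n: "n \<ge> max (max N 1) (2*m)"
      define i where "i = m + n mod m"
      define k where "k = n div m - 1"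
      have dm: "n div m \<ge> 2" using n m by (metis div_le_mono max.bounded_iff mult.commute nonzero_mult_div_cancel_left not_one_le_zero)
      have n_eq: "n = k * m + i" "k > 0" "i < 2 * m"
        using dm m div_mult_mod_eq[of n m] mod_less_divisor[of m n] unfolding i_def k_def
        by (auto simp: diff_mult_distrib)
      have "v n \<ge> k * v m + v i" using vk[OF n_eq(2), of m] v[of "k*m" i] n_eq(1) by simp
      moreover have "v i \<ge> i * (v m / m) - B" using B[OF n_eq(3)] by linarith
      moreover have "real n * (v m / m) = k * v m + i * (v m / m)"
        using m by (subst n_eq(1)) (simp add: algebra_simps)
      ultimately have "v n \<ge> real n * (v m / m) - B" by linarith
      hence "(real n * (v m / m) - B) / n \<le> v n / n" by (intro divide_right_mono) auto
      hence "v n / n \<ge> v m / m - B / n" using n by (simp add: diff_divide_distrib)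
      moreover have "B / n < e / 2"
      proof -
        have "2 * B / e < n" using N n by linarith
        thus ?thesis using e n by (simp add: field_simps)
      qed
      moreover have "v n / n \<le> L" unfolding L_def using n by (intro cSup_upper bdd) auto
      ultimately show "norm (v n / n - L) < e" using m(2) by (simp add: abs_if)
    qed
  qed
  moreover have "(\<lambda>n. C / real n) \<longlonglongrightarrow> 0" by real_asymp
  ultimately have "(\<lambda>n. v n / n + C / n) \<longlonglongrightarrow> L + 0" by (rule tendsto_add)
  thus ?thesis by (auto simp: convergent_def v_def diff_divide_distrib)
qed

section \<open>Averages\<close>

text \<open>
  A strong law of large numbers for bounded variables that are orthogonal at distance at least \<open>q\<close>.
  Only \<open>O(q N)\<close> of the covariances up to time \<open>N\<close> can be nonzero, so the second moment of the average is
  \<open>O(1 / N)\<close>; this is summable along squares, and boundedness fills the gaps between consecutive squares.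
\<close>

lemma (in prob_space) averages_to_zero:
  fixes d :: "nat \<Rightarrow> 'a \<Rightarrow> real"
  assumes meas [measurable]: "\<And>n. d n \<in> borel_measurable M"
    and bound: "\<And>n x. \<bar>d n x\<bar> \<le> K"
    and orth: "\<And>m n. n + q \<le> m \<Longrightarrow> expectation (\<lambda>x. d n x * d m x) = 0"
  shows "AE x in M. (\<lambda>N. (\<Sum>n<N. d n x) / N) \<longlonglongrightarrow> 0"
proof -
  have K: "0 \<le> K" using bound[of 0] by (metis abs_ge_zero order_trans)
  define S where "S N x = (\<Sum>n<N. d n x)" for N x
  have [measurable]: "S N \<in> borel_measurable M" for N unfolding S_def by measurable
  have Sb: "\<bar>S N x\<bar> \<le> N * K" for N x
  proof -
    have "\<bar>S N x\<bar> \<le> (\<Sum>n<N. \<bar>d n x\<bar>)" unfolding S_def by (rule sum_abs)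
    also have "\<dots> \<le> (\<Sum>n<N. K)" by (intro sum_mono bound)
    finally show ?thesis by simp
  qed
  have dd: "\<bar>d n x * d m x\<bar> \<le> K * K" for n m x
    unfolding abs_mult by (intro mult_mono bound) (auto simp: K)
  have int_dd [simp]: "integrable M (\<lambda>x. d n x * d m x)" for n m
    by (rule integrable_const_bound[where B="K*K"]) (auto simp: dd)
  have Edd: "expectation (\<lambda>x. d n x * d m x) \<le> (if n < m + q \<and> m < n + q then K * K else 0)" for n m
  proof (cases "n < m + q \<and> m < n + q")
    case True
    have "expectation (\<lambda>x. d n x * d m x) \<le> expectation (\<lambda>x. K * K)"
      using dd by (intro integral_mono) (auto simp: abs_le_iff)
    thus ?thesis using True by (simp add: prob_space)
  next
    case False
    hence "expectation (\<lambda>x. d n x * d m x) = 0" 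
      using orth[of n m] orth[of m n] by (auto simp: mult.commute not_less)
    thus ?thesis using False by simp
  qed
  have var: "expectation (\<lambda>x. (S N x)\<^sup>2) \<le> N * (2 * q * (K * K))" for N
  proof -
    have "expectation (\<lambda>x. (S N x)\<^sup>2) = expectation (\<lambda>x. \<Sum>n<N. \<Sum>m<N. d n x * d m x)"
      unfolding S_def power2_eq_square sum_product ..
    also have "\<dots> = (\<Sum>n<N. \<Sum>m<N. expectation (\<lambda>x. d n x * d m x))"
      by (simp add: Bochner_Integration.integral_sum)
    also have "\<dots> \<le> (\<Sum>n<N. \<Sum>m<N. if n < m + q \<and> m < n + q then K * K else 0)"
      by (intro sum_mono Edd)
    also have "\<dots> \<le> (\<Sum>n<N. 2 * q * (K * K))"
    proof (rule sum_mono)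
      fix n
      have "(\<Sum>m<N. if n < m + q \<and> m < n + q then K * K else 0)
          = (\<Sum>m\<in>{m. m < N \<and> n < m + q \<and> m < n + q}. K * K)"
        by (subst sum.inter_filter[symmetric]) auto
      also have "\<dots> = card {m. m < N \<and> n < m + q \<and> m < n + q} * (K * K)" by simp
      also have "\<dots> \<le> (2 * q) * (K * K)"
      proof (intro mult_right_mono)
        have "card {m. m < N \<and> n < m + q \<and> m < n + q} \<le> card {n + 1 - q..< n + q}"
          by (intro card_mono) auto
        also have "\<dots> \<le> 2 * q" by simp
        finally show "real (card {m. m < N \<and> n < m + q \<and> m < n + q}) \<le> 2 * q" by simp
      qed (use K in auto)
      finally show "(\<Sum>m<N. if n < m + q \<and> m < n + q then K * K else 0) \<le> 2 * q * (K * K)"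
        by simp
    qed
    finally show ?thesis by simp
  qed
  \<comment> \<open>Along the squares the second moments of the averages are summable.\<close>
  define Z where "Z j x = (S ((Suc j)\<^sup>2) x / (Suc j)\<^sup>2)\<^sup>2" for j x
  have [measurable]: "Z j \<in> borel_measurable M" for j unfolding Z_def by measurable
  have int_S2: "integrable M (\<lambda>x. (S N x)\<^sup>2)" for N
  proof (rule integrable_const_bound[where B="(N*K)\<^sup>2"])
    show "AE x in M. norm ((S N x)\<^sup>2) \<le> (N * K)\<^sup>2"
      using power_mono[OF Sb[of N] abs_ge_zero, of _ 2] by auto
  qed simp
  have Zint: "(\<integral>\<^sup>+x. ennreal (Z j x) \<partial>M) \<le> ennreal (2 * q * (K * K) * (1 / (Suc j)\<^sup>2))" for j
  proof -
    have "integrable M (Z j)" unfolding Z_def power_divide by (intro integrable_divide int_S2)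
    hence "(\<integral>\<^sup>+x. ennreal (Z j x) \<partial>M) = ennreal (expectation (Z j))"
      by (rule nn_integral_eq_integral) (simp add: Z_def)
    also have "expectation (Z j) = expectation (\<lambda>x. (S ((Suc j)\<^sup>2) x)\<^sup>2) / ((Suc j)\<^sup>2)\<^sup>2"
      unfolding Z_def power_divide by simp
    also have "\<dots> \<le> ((Suc j)\<^sup>2 * (2 * q * (K * K))) / ((Suc j)\<^sup>2)\<^sup>2"
      by (intro divide_right_mono var) auto
    also have "\<dots> = 2 * q * (K * K) * (1 / (Suc j)\<^sup>2)"
    proof -
      have *: "t * y / t\<^sup>2 = y * (1 / t)" if "t > 0" for t y :: real
        using that by (simp add: power2_eq_square)
      show ?thesis unfolding of_nat_power[of "(Suc j)\<^sup>2" 2] of_nat_mult of_nat_numeral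
        by (rule *) simp
    qed
    finally show ?thesis by (simp add: ennreal_leI)
  qed
  have "summable (\<lambda>j. 2 * q * (K * K) * (1 / (real (Suc j))\<^sup>2))"
    using inverse_squares_sums sums_summable by (intro summable_mult) (auto simp: inverse_eq_divide add_ac)
  hence fin: "(\<Sum>j. ennreal (2 * q * (K * K) * (1 / (Suc j)\<^sup>2))) \<noteq> \<infinity>"
    using K by (subst suminf_ennreal2) auto
  have "(\<integral>\<^sup>+x. (\<Sum>j. ennreal (Z j x)) \<partial>M) = (\<Sum>j. \<integral>\<^sup>+x. ennreal (Z j x) \<partial>M)"
    by (intro nn_integral_suminf) auto
  also have "\<dots> \<le> (\<Sum>j. ennreal (2 * q * (K * K) * (1 / (Suc j)\<^sup>2)))"
    by (intro suminf_le Zint) auto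
  finally have "(\<integral>\<^sup>+x. (\<Sum>j. ennreal (Z j x)) \<partial>M) \<noteq> \<infinity>" using fin
    by (metis infinity_ennreal_def neq_top_trans)
  hence "AE x in M. (\<Sum>j. ennreal (Z j x)) \<noteq> \<infinity>" by (intro nn_integral_PInf_AE) auto
  thus ?thesis
  proof (rule AE_mp, intro AE_I2 impI)
    fix x assume "(\<Sum>j. ennreal (Z j x)) \<noteq> \<infinity>"
    hence "summable (\<lambda>j. Z j x)" by (intro summable_suminf_not_top) (auto simp: Z_def)
    hence "(\<lambda>j. Z j x) \<longlonglongrightarrow> 0" by (rule summable_LIMSEQ_zero)
    hence "(\<lambda>j. sqrt (Z j x)) \<longlonglongrightarrow> sqrt 0" by (intro tendsto_real_sqrt)
    hence Z0: "(\<lambda>j. \<bar>S ((Suc j)\<^sup>2) x / (Suc j)\<^sup>2\<bar>) \<longlonglongrightarrow> 0" by (simp add: Z_def)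
    have fl: "filterlim (\<lambda>N. floor_sqrt N - 1) sequentially sequentially"
      unfolding filterlim_at_top
    proof
      fix C show "eventually (\<lambda>N. C \<le> floor_sqrt N - 1) sequentially"
        using eventually_ge_at_top[of "(Suc C)\<^sup>2"]
      proof eventually_elim
        case (elim N)
        have "Suc C \<le> floor_sqrt N" using elim by (simp add: le_floor_sqrt_iff)
        thus ?case by simp
      qed
    qed
    have lim1: "(\<lambda>N. \<bar>S ((Suc (floor_sqrt N - 1))\<^sup>2) x / (Suc (floor_sqrt N - 1))\<^sup>2\<bar>) \<longlonglongrightarrow> 0"
      using filterlim_compose[OF Z0 fl] by simp
    have lim2: "(\<lambda>N. 2 * K / Suc (floor_sqrt N - 1)) \<longlonglongrightarrow> 0"
    proof -
      have "(\<lambda>j. 2 * K / Suc j) \<longlonglongrightarrow> 0" by real_asymp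
      from filterlim_compose[OF this fl] show ?thesis by simp
    qed
    show "(\<lambda>N. (\<Sum>n<N. d n x) / N) \<longlonglongrightarrow> 0"
    proof (rule Lim_null_comparison)
      show "(\<lambda>N. \<bar>S ((Suc (floor_sqrt N - 1))\<^sup>2) x / (Suc (floor_sqrt N - 1))\<^sup>2\<bar>
             + 2 * K / Suc (floor_sqrt N - 1)) \<longlonglongrightarrow> 0"
        using tendsto_add[OF lim1 lim2] by simp
      show "\<forall>\<^sub>F N in sequentially. norm ((\<Sum>n<N. d n x) / N) \<le>
         \<bar>S ((Suc (floor_sqrt N - 1))\<^sup>2) x / (Suc (floor_sqrt N - 1))\<^sup>2\<bar> + 2 * K / Suc (floor_sqrt N - 1)"
        using eventually_ge_at_top[of 1]
      proof eventually_elim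
        case (elim N)
        define j where "j = floor_sqrt N"
        have j: "j > 0" "j\<^sup>2 \<le> N" "N < (Suc j)\<^sup>2"
          using elim by (auto simp: j_def floor_sqrt_power2_le Suc_floor_sqrt_power2_gt)
        have Sj: "Suc (floor_sqrt N - 1) = j" using j by (simp add: j_def)
        have "S N x = S (j\<^sup>2) x + (\<Sum>n\<in>{j\<^sup>2..<N}. d n x)"
          unfolding S_def using j(2) by (simp add: lessThan_atLeast0 sum.atLeastLessThan_concat)
        also have "\<bar>\<dots>\<bar> \<le> \<bar>S (j\<^sup>2) x\<bar> + (\<Sum>n\<in>{j\<^sup>2..<N}. K)"
          by (intro abs_triangle_ineq[THEN order_trans] add_mono order_refl sum_abs[THEN order_trans] sum_mono bound)
        also have "(\<Sum>n\<in>{j\<^sup>2..<N}. K) = (N - j\<^sup>2) * K" by simp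
        also have "\<dots> \<le> (2 * j) * K"
          using j K by (intro mult_right_mono) (auto simp: power2_eq_square simp flip: of_nat_mult of_nat_add)
        finally have "\<bar>S N x\<bar> \<le> \<bar>S (j\<^sup>2) x\<bar> + 2 * j * K" by simp
        hence "\<bar>S N x\<bar> / N \<le> (\<bar>S (j\<^sup>2) x\<bar> + 2 * j * K) / N" by (intro divide_right_mono) auto
        also have "\<dots> \<le> (\<bar>S (j\<^sup>2) x\<bar> + 2 * j * K) / j\<^sup>2"
          using j K elim by (intro divide_left_mono) (auto simp flip: of_nat_power)
        also have "\<dots> = \<bar>S (j\<^sup>2) x / j\<^sup>2\<bar> + 2 * K / j" using j
          by (simp add: add_divide_distrib power2_eq_square)
        finally show ?case unfolding Sj by (simp add: S_def)
      qed
    qed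
  qed
qed

lemma cesaro_shift:
  fixes f :: "nat \<Rightarrow> real"
  assumes "(\<lambda>N. (\<Sum>k<N. f k) / N) \<longlonglongrightarrow> L"
  shows "(\<lambda>N. (\<Sum>k<N. f (k + q)) / N) \<longlonglongrightarrow> L"
proof -
  have split: "(\<Sum>k<N. f (k + q)) = (\<Sum>k<N + q. f k) - (\<Sum>k<q. f k)" for N
    by (induction N) auto
  have 1: "(\<lambda>N. (\<Sum>k<N + q. f k) / real (N + q)) \<longlonglongrightarrow> L"
    using LIMSEQ_ignore_initial_segment[OF assms, of q] by simp
  have 2: "(\<lambda>N. real (N + q) / real N) \<longlonglongrightarrow> 1" unfolding of_nat_add by real_asymp
  have 3: "(\<lambda>N. (\<Sum>k<q. f k) / real N) \<longlonglongrightarrow> 0" by (rule lim_const_over_n)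
  have "(\<lambda>N. (\<Sum>k<N + q. f k) / real (N + q) * (real (N + q) / real N) - (\<Sum>k<q. f k) / real N) \<longlonglongrightarrow> L * 1 - 0"
    by (intro tendsto_diff tendsto_mult 1 2 3)
  moreover have "\<forall>\<^sub>F N in sequentially. (\<Sum>k<N + q. f k) / real (N + q) * (real (N + q) / real N) - (\<Sum>k<q. f k) / real N
      = (\<Sum>k<N. f (k + q)) / N"
    using eventually_gt_at_top[of 0]
  proof eventually_elim
    case (elim N)
    have "(\<Sum>k<N + q. f k) / real (N + q) * (real (N + q) / real N) = (\<Sum>k<N + q. f k) / real N"
      using elim by simp
    thus ?case by (simp only: split diff_divide_distrib)
  qed
  ultimately show ?thesis by (simp add: filterlim_cong)
qed

section \<open>The weak topology\<close>

lemma space_borel_of [simp]: "space (borel_of X) = topspace X"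
  unfolding borel_of_def by (rule space_measure_of) (auto dest: openin_subset)

lemma sets_borel_of: "openin X U \<Longrightarrow> U \<in> sets (borel_of X)"
  unfolding borel_of_def by (subst sets_measure_of) (auto dest: openin_subset)

lemma continuous_map_imp_borel_measurable:
  fixes f :: "'a \<Rightarrow> real"
  assumes "continuous_map X euclideanreal f"
  shows "f \<in> borel_measurable (borel_of X)"
proof (rule borel_measurableI)
  fix S :: "real set" assume "open S"
  hence "openin X {x \<in> topspace X. f x \<in> S}"
    using assms by (simp add: continuous_map_def)
  moreover have "f -` S \<inter> space (borel_of X) = {x \<in> topspace X. f x \<in> S}" by auto
  ultimately show "f -` S \<inter> space (borel_of X) \<in> sets (borel_of X)"
    by (simp add: sets_borel_of)
qed

lemma continuous_map_integral:
  fixes f :: "'a \<Rightarrow> real"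
  assumes "continuous_map X euclideanreal f" "bounded (f ` topspace X)"
  shows "continuous_map (weak_topology X) euclideanreal (\<lambda>\<mu>. \<integral>x. f x \<partial>\<mu>)"
  unfolding continuous_map_def
proof (intro conjI allI impI)
  fix U :: "real set" assume U: "openin euclideanreal U"
  have "openin (weak_topology X) {\<mu> \<in> prob_measures X. (\<integral>x. f x \<partial>\<mu>) \<in> U}"
    unfolding weak_topology_def using assms U
    by (intro topology_generated_by_Basis) auto
  thus "openin (weak_topology X) {\<mu> \<in> topspace (weak_topology X). (\<integral>x. f x \<partial>\<mu>) \<in> U}"
    by (simp add: topspace_weak_topology)
qed auto

lemma limitin_weak_topology_imp_integral:
  fixes f :: "'a \<Rightarrow> real"
  assumes "limitin (weak_topology X) S \<mu> F"
    and f: "continuous_map X euclideanreal f" "bounded (f ` topspace X)"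
  shows "((\<lambda>n. \<integral>x. f x \<partial>S n) \<longlongrightarrow> (\<integral>x. f x \<partial>\<mu>)) F"
  using continuous_map_limit[OF continuous_map_integral[OF f] assms(1)]
  by (simp add: o_def)

lemma integral_empirical:
  fixes f :: "'a \<Rightarrow> real"
  assumes "\<And>k. y k \<in> topspace X" "f \<in> borel_measurable (borel_of X)"
  shows "(\<integral>x. f x \<partial>empirical X y N) = (\<Sum>k<N. f (y k)) / N"
  unfolding empirical_def using assms
  by (subst integral_distr)
     (auto simp: measurable_def space_uniform_count_measure sets_uniform_count_measure
        integral_uniform_count_measure)

text \<open>
  The Borel sets of the weak topology make all evaluations \<open>\<nu> \<mapsto> \<nu>(U)\<close> measurable: for open \<open>U\<close>, the
  value \<open>\<nu>(U)\<close> is a limit of integrals of bounded continuous functions, and the open sets are closed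
  under intersection and generate.
\<close>

lemma measurable_identity_weak_topology:
  "(\<lambda>\<nu>. \<nu>) \<in> borel_of (weak_topology (euclidean :: 'a::metric_space topology)) \<rightarrow>\<^sub>M prob_algebra borel"
proof (rule measurable_prob_algebra_generated)
  let ?W = "weak_topology (euclidean :: 'a topology)"
  show "sets (borel :: 'a measure) = sigma_sets UNIV {U. open U}"
    unfolding borel_def by simp
  show "Int_stable {U :: 'a set. open U}" by (auto simp: Int_stable_def)
  show "{U :: 'a set. open U} \<subseteq> Pow UNIV" by simp
  fix U :: "'a set" assume "U \<in> {U. open U}"
  hence U: "open U" by simp
  define f where "f n x = min 1 (real n * infdist x (- U))" for n x
  show "(\<lambda>\<nu>. emeasure \<nu> U) \<in> borel_measurable (borel_of ?W)"
  proof (cases "U = UNIV")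
    case True
    have "emeasure \<nu> U = 1" if "\<nu> \<in> space (borel_of ?W)" for \<nu>
    proof -
      from that have "\<nu> \<in> prob_measures euclidean" by (simp add: topspace_weak_topology)
      hence "prob_space \<nu>" "space \<nu> = UNIV"
        using sets_eq_imp_space_eq[of \<nu> borel] by (auto simp: prob_measures_def borel_of_euclidean)
      thus ?thesis using prob_space.emeasure_space_1 True by metis
    qed
    thus ?thesis by (subst measurable_cong[where g = "\<lambda>_. 1"]) auto
  next
    case False
    have f: "continuous_on UNIV (f n)" for n unfolding f_def by (intro continuous_intros)
    have fb: "\<bar>f n x\<bar> \<le> 1" for n x unfolding f_def by (auto simp: infdist_nonneg)
    have [measurable]: "f n \<in> borel_measurable borel" for n
      using f by (rule borel_measurable_continuous_onI)
    have "(\<lambda>\<nu>. \<integral>x. f n x \<partial>\<nu>) \<in> borel_measurable (borel_of ?W)" for n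
    proof (intro continuous_map_imp_borel_measurable continuous_map_integral)
      show "bounded (f n ` topspace euclidean)" using fb by (auto intro!: boundedI[where B=1])
    qed (use f in simp)
    moreover have "(\<lambda>n. \<integral>x. f n x \<partial>\<nu>) \<longlonglongrightarrow> measure \<nu> U" if "\<nu> \<in> space (borel_of ?W)" for \<nu>
    proof -
      from that have "\<nu> \<in> prob_measures euclidean" by (simp add: topspace_weak_topology)
      hence "prob_space \<nu>" and sets [measurable_cong]: "sets \<nu> = sets borel" 
        by (auto simp: prob_measures_def borel_of_euclidean)
      interpret prob_space \<nu> by fact
      have "(\<lambda>n. \<integral>x. f n x \<partial>\<nu>) \<longlonglongrightarrow> (\<integral>x. indicator U x \<partial>\<nu>)"
      proof (rule integral_dominated_convergence[where w = "\<lambda>_. 1"])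
        show "(\<lambda>x. indicator U x :: real) \<in> borel_measurable \<nu>"
          using U by (intro borel_measurable_indicator) (simp add: sets)
        show "AE x in \<nu>. (\<lambda>n. f n x) \<longlonglongrightarrow> indicator U x"
        proof (rule AE_I2)
          fix x
          show "(\<lambda>n. f n x) \<longlonglongrightarrow> indicator U x"
          proof (cases "x \<in> U")
            case True
            have d: "infdist x (- U) > 0"
              using U True False in_closed_iff_infdist_zero[of "- U" x]
              by (auto simp: infdist_nonneg less_le)
            have "\<forall>\<^sub>F n in sequentially. f n x = 1"
              using eventually_ge_at_top[of "nat \<lceil>1 / infdist x (- U)\<rceil>"]
            proof eventually_elim
              case (elim n)
              hence "1 / infdist x (- U) \<le> n" by linarith
              thus ?case using d by (simp add: f_def field_simps)
            qed
            thus ?thesis using True by (simp add: tendsto_eventually)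
          qed (simp add: f_def)
        qed
        show "AE x in \<nu>. norm (f n x) \<le> 1" for n using fb by simp
      qed (auto simp: fb)
      thus ?thesis by (simp add: sets_eq_imp_space_eq[OF sets])
    qed
    ultimately have "(\<lambda>\<nu>. measure \<nu> U) \<in> borel_measurable (borel_of ?W)"
      by (rule borel_measurable_LIMSEQ_real[rotated])
    hence "(\<lambda>\<nu>. ennreal (measure \<nu> U)) \<in> borel_measurable (borel_of ?W)" by simp
    moreover have "emeasure \<nu> U = ennreal (measure \<nu> U)" if "\<nu> \<in> space (borel_of ?W)" for \<nu>
      using that by (intro finite_measure.emeasure_eq_measure prob_space.finite_measure)
        (auto simp: topspace_weak_topology prob_measures_def)
    ultimately show ?thesis by (rule measurable_cong[THEN iffD2, rotated])
  qed
qed (auto simp: topspace_weak_topology prob_measures_def borel_of_euclidean)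

lemma integral_measurable_subprob_algebra2:
  fixes f :: "'a \<Rightarrow> 'b \<Rightarrow> real"
  assumes f[measurable]: "(\<lambda>(x, y). f x y) \<in> borel_measurable (M \<Otimes>\<^sub>M N)"
  assumes N[measurable]: "L \<in> measurable M (subprob_algebra N)"
  shows "(\<lambda>x. integral\<^sup>L (L x) (f x)) \<in> borel_measurable M"
proof -
  note integral_measurable_subprob_algebra[measurable] measurable_distr2[measurable]
  have "(\<lambda>x. integral\<^sup>L (distr (L x) (M \<Otimes>\<^sub>M N) (\<lambda>y. (x, y))) (\<lambda>(x, y). f x y)) \<in> borel_measurable M"
    by measurable
  then show "(\<lambda>x. integral\<^sup>L (L x) (f x)) \<in> borel_measurable M"
    by (rule measurable_cong[THEN iffD1, rotated]) (simp add: integral_distr)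
qed

lemma measurable_measure_cball:
  fixes \<nu> :: "'a::{metric_space, second_countable_topology} measure"
  assumes "prob_space \<nu>" "sets \<nu> = sets borel"
  shows "(\<lambda>x. measure \<nu> (cball x r)) \<in> borel_measurable borel"
proof -
  interpret prob_space \<nu> by fact
  have K: "(\<lambda>_::'a. \<nu>) \<in> borel \<rightarrow>\<^sub>M subprob_algebra borel"
    by (intro measurable_const) (simp add: space_subprob_algebra subprob_space_axioms assms(2))
  show ?thesis
  proof (rule measure_measurable_subprob_algebra2[OF _ K])
    have "(SIGMA y:space borel. cball y r) = {p \<in> space (borel \<Otimes>\<^sub>M (borel :: 'a measure)). dist (fst p) (snd p) \<le> r}"
      by (auto simp: space_pair_measure)
    also have "\<dots> \<in> sets (borel \<Otimes>\<^sub>M borel)" by measurable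
    finally show "(SIGMA y:space borel. cball y r) \<in> sets (borel \<Otimes>\<^sub>M (borel :: 'a measure))" .
  qed
qed

text \<open>
  The Bochner integral of a function that is not measurable is 0 by convention, so \<open>E\<^sub>q\<close> carries
  information about \<open>H\<^sub>r\<close> only because of this measurability.
\<close>

lemma measurable_scale_entropy_projection:
  fixes \<pi> :: "'a::{metric_space,second_countable_topology} \<Rightarrow> 'b::{metric_space,second_countable_topology}"
  assumes [measurable]: "\<pi> \<in> borel \<rightarrow>\<^sub>M borel"
  shows "(\<lambda>\<nu>. scale_entropy r (distr \<nu> borel \<pi>)) \<in> borel_measurable (borel_of (weak_topology euclidean))"
proof -
  let ?M = "borel_of (weak_topology (euclidean :: 'a topology))"
  have L: "(\<lambda>\<nu>. \<nu>) \<in> ?M \<rightarrow>\<^sub>M subprob_algebra borel"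
    by (intro measurable_prob_algebraD measurable_identity_weak_topology)
  have fst: "(\<lambda>p. fst p) \<in> ?M \<Otimes>\<^sub>M (borel :: 'a measure) \<rightarrow>\<^sub>M subprob_algebra borel"
    by (rule measurable_compose[OF measurable_fst L])
  have "(\<lambda>p. measure (fst p) {z \<in> space borel. dist (\<pi> (snd p)) (\<pi> z) \<le> r})
        \<in> borel_measurable (?M \<Otimes>\<^sub>M (borel :: 'a measure))"
  proof (rule measure_measurable_subprob_algebra2[OF _ fst])
    have "(SIGMA p:space (?M \<Otimes>\<^sub>M borel). {z \<in> space borel. dist (\<pi> (snd p)) (\<pi> z) \<le> r})
      = {p \<in> space ((?M \<Otimes>\<^sub>M (borel::'a measure)) \<Otimes>\<^sub>M (borel::'a measure)). dist (\<pi> (snd (fst p))) (\<pi> (snd p)) \<le> r}"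
      by (auto simp: space_pair_measure)
    also have "\<dots> \<in> sets ((?M \<Otimes>\<^sub>M borel) \<Otimes>\<^sub>M borel)" by measurable
    finally show "(SIGMA p:space (?M \<Otimes>\<^sub>M borel). {z \<in> space borel. dist (\<pi> (snd p)) (\<pi> z) \<le> r})
        \<in> sets ((?M \<Otimes>\<^sub>M borel) \<Otimes>\<^sub>M (borel::'a measure))" .
  qed
  hence [measurable]: "(\<lambda>(\<nu>, x). measure \<nu> {z. dist (\<pi> x) (\<pi> z) \<le> r})
        \<in> borel_measurable (?M \<Otimes>\<^sub>M (borel :: 'a measure))"
    by (simp add: case_prod_unfold)
  have "(\<lambda>\<nu>. - (\<integral>x. ln (measure \<nu> {z. dist (\<pi> x) (\<pi> z) \<le> r}) \<partial>\<nu>)) \<in> borel_measurable ?M"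
    by (intro borel_measurable_uminus integral_measurable_subprob_algebra2[OF _ L]) measurable
  moreover have "scale_entropy r (distr \<nu> borel \<pi>) = - (\<integral>x. ln (measure \<nu> {z. dist (\<pi> x) (\<pi> z) \<le> r}) \<partial>\<nu>)"
    if "\<nu> \<in> space ?M" for \<nu>
  proof -
    have s: "sets \<nu> = sets borel" "space \<nu> = UNIV"
      using that sets_eq_imp_space_eq[of \<nu> borel]
      by (auto simp: topspace_weak_topology prob_measures_def borel_of_euclidean)
    note [measurable_cong] = s(1)
    have "prob_space \<nu>" using that by (auto simp: topspace_weak_topology prob_measures_def)
    then interpret prob_space \<nu> .
    have *: "measure (distr \<nu> borel \<pi>) (cball (\<pi> x) r) = measure \<nu> {z. dist (\<pi> x) (\<pi> z) \<le> r}" for x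
      by (subst measure_distr) (auto simp: s vimage_def)
    have "(\<lambda>y. measure (distr \<nu> borel \<pi>) (cball y r)) \<in> borel_measurable borel"
      by (intro measurable_measure_cball prob_space_distr) simp_all
    hence "(\<integral>y. ln (measure (distr \<nu> borel \<pi>) (cball y r)) \<partial>distr \<nu> borel \<pi>)
        = (\<integral>x. ln (measure \<nu> {z. dist (\<pi> x) (\<pi> z) \<le> r}) \<partial>\<nu>)"
      by (subst integral_distr) (simp_all add: *)
    thus ?thesis by (simp add: scale_entropy_def)
  qed
  ultimately show ?thesis by (rule measurable_cong[THEN iffD2, rotated])
qed

section \<open>Entropy of a partition of unity\<close>

lemma card_int_le:
  fixes S :: "int set"
  assumes "\<And>i j. i \<in> S \<Longrightarrow> j \<in> S \<Longrightarrow> \<bar>real_of_int i - real_of_int j\<bar> \<le> L" "0 \<le> L"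
  shows "finite S" "real (card S) \<le> L + 1"
proof -
  have *: "finite S \<and> real (card S) \<le> L + 1"
  proof (cases "S = {}")
    case False
    then obtain k where k: "k \<in> S" by blast
    have diff: "i - j \<le> \<lfloor>L\<rfloor>" if "i \<in> S" "j \<in> S" for i j
    proof -
      have "real_of_int i - real_of_int j \<le> L" using assms(1)[OF that] by (rule order_trans[OF abs_ge_self])
      thus ?thesis by (simp add: le_floor_iff)
    qed
    have "S \<subseteq> {k - \<lfloor>L\<rfloor> .. k + \<lfloor>L\<rfloor>}"
      using diff[OF _ k] diff[OF k] by (auto simp: algebra_simps)
    hence fin: "finite S" by (rule finite_subset) simp
    have "S \<subseteq> {Min S .. Min S + \<lfloor>L\<rfloor>}"
    proof
      fix i assume i: "i \<in> S"
      have "Min S \<in> S" using fin False by simp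
      hence "i - Min S \<le> \<lfloor>L\<rfloor>" by (rule diff[OF i])
      thus "i \<in> {Min S .. Min S + \<lfloor>L\<rfloor>}" using fin i by auto
    qed
    hence "card S \<le> card {Min S .. Min S + \<lfloor>L\<rfloor>}" by (intro card_mono) auto
    also have "\<dots> = nat (\<lfloor>L\<rfloor> + 1)" by simp
    finally have "int (card S) \<le> \<lfloor>L\<rfloor> + 1" using assms(2) by linarith
    hence "real_of_int (int (card S)) \<le> real_of_int (\<lfloor>L\<rfloor> + 1)" by (simp only: of_int_le_iff)
    hence "real (card S) \<le> real_of_int \<lfloor>L\<rfloor> + 1" by simp
    also have "\<dots> \<le> L + 1" using of_int_floor_le[of L] by (intro add_right_mono)
    finally have "real (card S) \<le> L + 1" .
    thus ?thesis using fin by simp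
  qed (use assms in auto)
  thus "finite S" "real (card S) \<le> L + 1" by auto
qed

text \<open>
  Unlike the indicators of the intervals of a grid, the hat functions are continuous, so that their
  integrals are weakly continuous in the measure; like the indicators, they are a partition of unity.
\<close>

definition hat :: "int \<Rightarrow> real \<Rightarrow> real" where
  "hat j s = max 0 (1 - \<bar>s - of_int j\<bar>)"

lemma hat_nonneg [simp]: "0 \<le> hat j s" and hat_le_1 [simp]: "hat j s \<le> 1"
  and hat_pos_iff: "0 < hat j s \<longleftrightarrow> \<bar>s - of_int j\<bar> < 1"
  by (auto simp: hat_def)

lemma continuous_hat [continuous_intros]: "continuous_on S f \<Longrightarrow> continuous_on S (\<lambda>x. hat j (f x))"
  unfolding hat_def by (intro continuous_intros)

lemma measurable_hat [measurable]: "hat j \<in> borel_measurable borel"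
  by (intro borel_measurable_continuous_onI continuous_intros)

lemma sum_hat:
  assumes "\<bar>s\<bar> \<le> real N"
  shows "(\<Sum>j\<in>{- int N..int N}. hat j s) = 1"
proof -
  define i where "i = \<lfloor>s\<rfloor>"
  have i: "of_int i \<le> s" "s < of_int i + 1" unfolding i_def by linarith+
  have z: "hat j s = 0" if "j \<notin> {i, i + 1}" for j
  proof (rule ccontr)
    assume "hat j s \<noteq> 0"
    hence "\<bar>s - of_int j\<bar> < 1" using hat_pos_iff[of j s] hat_nonneg[of j s] by linarith
    hence "j = i \<or> j = i + 1" using i by linarith
    thus False using that by simp
  qed
  have z': "hat j s = 0" if "j \<notin> {- int N..int N}" for j
  proof -
    have "real_of_int j \<le> - real N - 1 \<or> real_of_int j \<ge> real N + 1" using that by auto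
    thus ?thesis using assms unfolding hat_def by auto
  qed
  have "(\<Sum>j\<in>{- int N..int N}. hat j s) = (\<Sum>j\<in>{- int N..int N} \<union> {i, i + 1}. hat j s)"
    by (rule sum.mono_neutral_left) (auto simp del: Un_insert_right intro: z')
  also have "\<dots> = (\<Sum>j\<in>{i, i + 1}. hat j s)"
    by (rule sum.mono_neutral_right) (auto simp del: Un_insert_right intro: z)
  also have "\<dots> = 1" using i by (simp add: hat_def)
  finally show ?thesis .
qed

lemma sum_hat_le: "(\<Sum>j\<in>{- int N..int N}. hat j s) \<le> 1"
proof -
  define N' where "N' = max N (nat \<lceil>\<bar>s\<bar>\<rceil>)"
  have "\<bar>s\<bar> \<le> real N'" unfolding N'_def by linarith
  hence "(\<Sum>j\<in>{- int N'..int N'}. hat j s) = 1" by (rule sum_hat)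
  moreover have "(\<Sum>j\<in>{- int N..int N}. hat j s) \<le> (\<Sum>j\<in>{- int N'..int N'}. hat j s)"
    by (intro sum_mono2) (auto simp: N'_def)
  ultimately show ?thesis by simp
qed

text \<open>
  The entropy of the hat functions of \<open>t\<close> and the entropy of a partition into sets \<open>K i\<close> differ by a bounded
  amount if \<open>t\<close> varies boundedly on each \<open>K i\<close> and sets on which \<open>t\<close> takes close values have close
  indices. The coupling \<open>w i j\<close> is the mass of the \<open>j\<close>th hat function on \<open>K i\<close>, relative to \<open>A\<close>.
\<close>

lemma (in prob_space) entropy_hat_partition:
  fixes t :: "'a \<Rightarrow> real" and K :: "int \<Rightarrow> 'a set"
  assumes [measurable]: "t \<in> borel_measurable M" "A \<in> events" and A: "0 < prob A"
    and fin: "finite I" and K: "\<And>i. i \<in> I \<Longrightarrow> K i \<in> events" "\<And>i. i \<in> I \<Longrightarrow> K i \<subseteq> A"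
    and disj: "disjoint_family_on K I" and total: "(\<Sum>i\<in>I. prob (K i)) = prob A"
    and tN: "\<And>z. z \<in> A \<Longrightarrow> \<bar>t z\<bar> \<le> real N"
    and near: "\<And>i z z'. i \<in> I \<Longrightarrow> z \<in> K i \<Longrightarrow> z' \<in> K i \<Longrightarrow> \<bar>t z - t z'\<bar> \<le> L"
    and near': "\<And>i i' z z'. i \<in> I \<Longrightarrow> i' \<in> I \<Longrightarrow> z \<in> K i \<Longrightarrow> z' \<in> K i' \<Longrightarrow> \<bar>t z - t z'\<bar> \<le> 2
        \<Longrightarrow> \<bar>real_of_int i - real_of_int i'\<bar> \<le> L"
    and L: "0 \<le> L"
  shows "\<bar>(\<Sum>j\<in>{- int N..int N}. eta ((\<integral>z. indicator A z * hat j (t z) \<partial>M) / prob A))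
      - (\<Sum>i\<in>I. eta (prob (K i) / prob A))\<bar> \<le> L + 3"
proof -
  define w where "w i j = (\<integral>z. indicator (K i) z * hat j (t z) \<partial>M) / prob A" for i j
  note [measurable] = K(1)
  have int: "integrable M (\<lambda>z. indicator B z * hat j (t z))" if [measurable]: "B \<in> events" for B j
    by (rule integrable_const_bound[where B=1]) (auto simp: indicator_def)
  have w0: "0 \<le> w i j" for i j unfolding w_def using A by (intro divide_nonneg_pos integral_nonneg) auto
  have ex: "\<exists>z\<in>K i. \<bar>t z - of_int j\<bar> < 1" if "0 < w i j" for i j
  proof (rule ccontr)
    assume "\<not> ?thesis"
    hence "indicator (K i) z * hat j (t z) = 0" for z
      using hat_pos_iff[of j "t z"] hat_nonneg[of j "t z"] by (cases "z \<in> K i") (auto simp: less_le)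
    hence "(\<lambda>z. indicator (K i) z * hat j (t z)) = (\<lambda>_. 0)" by (intro ext)
    hence "w i j = 0" unfolding w_def by simp
    thus False using that by simp
  qed
  have cover: "AE z in M. z \<in> A \<longrightarrow> z \<in> (\<Union>i\<in>I. K i)"
  proof -
    have [measurable]: "(\<Union>i\<in>I. K i) \<in> events" using fin K by (intro sets.finite_UN) auto
    have "prob (\<Union>i\<in>I. K i) = prob A"
      using finite_measure_finite_Union[OF fin _ disj] K(1) total by (simp add: image_subset_iff)
    hence "prob (A - (\<Union>i\<in>I. K i)) = 0" using K by (subst finite_measure_Diff) auto
    hence "A - (\<Union>i\<in>I. K i) \<in> null_sets M" by (simp add: null_sets_def emeasure_eq_measure)
    from AE_not_in[OF this] show ?thesis by eventually_elim auto
  qed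
  have col: "(\<Sum>i\<in>I. w i j) = (\<integral>z. indicator A z * hat j (t z) \<partial>M) / prob A" for j
  proof -
    have "(\<Sum>i\<in>I. w i j) = (\<integral>z. (\<Sum>i\<in>I. indicator (K i) z * hat j (t z)) \<partial>M) / prob A"
      unfolding w_def using K int by (subst Bochner_Integration.integral_sum) (auto simp: sum_divide_distrib)
    also have "(\<integral>z. (\<Sum>i\<in>I. indicator (K i) z * hat j (t z)) \<partial>M) = (\<integral>z. indicator A z * hat j (t z) \<partial>M)"
    proof (rule integral_cong_AE)
      show "AE z in M. (\<Sum>i\<in>I. indicator (K i) z * hat j (t z)) = indicator A z * hat j (t z)"
        using cover
      proof eventually_elim
        case (elim z)
        show ?case
        proof (cases "z \<in> A")
          case True
          then obtain i where i: "i \<in> I" "z \<in> K i" using elim by auto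
          have "(\<Sum>i\<in>I. indicator (K i) z * hat j (t z)) = (\<Sum>i\<in>{i}. indicator (K i) z * hat j (t z))"
            using i fin disj by (intro sum.mono_neutral_right) (auto simp: disjoint_family_on_def indicator_def)
          thus ?thesis using i True by simp
        next
          case False
          hence "z \<notin> K i" if "i \<in> I" for i using K(2) that by blast
          thus ?thesis using False by simp
        qed
      qed
    qed measurable
    finally show ?thesis .
  qed
  have row: "(\<Sum>j\<in>{- int N..int N}. w i j) = prob (K i) / prob A" if i: "i \<in> I" for i
  proof -
    have "(\<Sum>j\<in>{- int N..int N}. w i j) = (\<integral>z. (\<Sum>j\<in>{- int N..int N}. indicator (K i) z * hat j (t z)) \<partial>M) / prob A"
      unfolding w_def using K int i by (subst Bochner_Integration.integral_sum) (auto simp: sum_divide_distrib)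
    also have "(\<integral>z. (\<Sum>j\<in>{- int N..int N}. indicator (K i) z * hat j (t z)) \<partial>M) = (\<integral>z. indicator (K i) z \<partial>M)"
      using K(2)[OF i] tN by (intro Bochner_Integration.integral_cong refl) 
        (auto simp: sum_distrib_left[symmetric] sum_hat indicator_def)
    also have "\<dots> = prob (K i)" using K(1)[OF i] by simp
    finally show ?thesis .
  qed
  have tot1: "(\<Sum>i\<in>I. \<Sum>j\<in>{- int N..int N}. w i j) \<le> 1"
    using total A by (simp add: row sum_divide_distrib[symmetric])
  have few1: "real (card {i\<in>I. 0 < w i j}) \<le> L + 3" for j
  proof -
    have "real (card {i\<in>I. 0 < w i j}) \<le> L + 1"
    proof (rule card_int_le(2)[OF _ L])
      fix i i' assume "i \<in> {i\<in>I. 0 < w i j}" "i' \<in> {i\<in>I. 0 < w i j}"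
      then obtain z z' where "i \<in> I" "i' \<in> I" "z \<in> K i" "z' \<in> K i'" "\<bar>t z - of_int j\<bar> < 1" "\<bar>t z' - of_int j\<bar> < 1"
        using ex by blast
      thus "\<bar>real_of_int i - real_of_int i'\<bar> \<le> L" by (intro near'[of i i' z z']) auto
    qed
    thus ?thesis by simp
  qed
  have few2: "real (card {j\<in>{- int N..int N}. 0 < w i j}) \<le> L + 3" if i: "i \<in> I" for i
  proof -
    have "real (card {j\<in>{- int N..int N}. 0 < w i j}) \<le> (L + 2) + 1"
    proof (rule card_int_le(2))
      fix j j' assume "j \<in> {j\<in>{- int N..int N}. 0 < w i j}" "j' \<in> {j\<in>{- int N..int N}. 0 < w i j}"
      then obtain z z' where z: "z \<in> K i" "z' \<in> K i" "\<bar>t z - of_int j\<bar> < 1" "\<bar>t z' - of_int j'\<bar> < 1"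
        using ex by blast
      show "\<bar>real_of_int j - real_of_int j'\<bar> \<le> L + 2" using near[OF i z(1,2)] z(3,4) by linarith
    qed (use L in auto)
    thus ?thesis by simp
  qed
  have "(\<Sum>i\<in>I. eta (\<Sum>j\<in>{- int N..int N}. w i j)) \<le> (\<Sum>j\<in>{- int N..int N}. eta (\<Sum>i\<in>I. w i j)) + (L + 3)"
    using tot1 by (intro sum_eta_le_coupling fin few1 w0) (auto simp: L sum.swap[of _ I])
  moreover have "(\<Sum>j\<in>{- int N..int N}. eta (\<Sum>i\<in>I. w i j)) \<le> (\<Sum>i\<in>I. eta (\<Sum>j\<in>{- int N..int N}. w i j)) + (L + 3)"
    using tot1 L by (intro sum_eta_le_coupling fin few2 w0) auto
  ultimately show ?thesis by (simp add: col row)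
qed

text \<open>
  On the interval \<open>K i\<close> of the grid of width \<open>r\<close>, the mass of a ball of radius \<open>r\<close> lies between that of
  \<open>K i\<close> and that of \<open>K i\<close> together with its two neighbours. The first bound gives \<open>H\<^sub>r\<close> at most the
  entropy of the grid, the second one, by Gibbs' inequality, at least this entropy minus 3.
\<close>

lemma scale_entropy_hat:
  fixes \<nu> :: "real measure"
  assumes "prob_space \<nu>" and sets [measurable_cong]: "sets \<nu> = sets borel" and r: "0 < r"
    and N: "AE x in \<nu>. \<bar>x\<bar> \<le> real N * r"
  shows "\<bar>scale_entropy r \<nu> - (\<Sum>j\<in>{- int N..int N}. eta (\<integral>x. hat j (x / r) \<partial>\<nu>))\<bar> \<le> 9"
proof -
  interpret prob_space \<nu> by fact
  have space [simp]: "space \<nu> = UNIV" using sets_eq_imp_space_eq[OF sets] by simp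
  let ?I = "{- int N..int N}"
  define K where "K i = {x. \<lfloor>x / r\<rfloor> = i}" for i
  define s where "s i = prob (K (i - 1)) + prob (K i) + prob (K (i + 1))" for i
  have Km [measurable]: "K i \<in> sets borel" for i unfolding K_def by measurable
  have Kdisj: "disjoint_family_on K J" for J by (auto simp: disjoint_family_on_def K_def)
  define A where "A = {x. \<bar>x\<bar> \<le> real N * r}"
  have [measurable]: "A \<in> sets borel" unfolding A_def by measurable
  have A: "prob A = 1"
  proof -
    have "emeasure \<nu> A = 1" using N by (subst emeasure_eq_1_AE) (auto simp: A_def sets)
    thus ?thesis by (simp add: emeasure_eq_measure)
  qed
  have K_A: "\<exists>i\<in>?I. x \<in> K i" if "x \<in> A" for x
  proof (intro bexI)
    have "\<bar>x / r\<bar> \<le> real N" using that r by (simp add: A_def field_simps abs_divide)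
    hence "- real N \<le> x / r" "x / r \<le> real N" by linarith+
    thus "\<lfloor>x / r\<rfloor> \<in> ?I" by (simp add: le_floor_iff floor_le_iff)
  qed (simp add: K_def)
  have "(\<Sum>i\<in>?I. prob (K i)) = 1"
  proof -
    have "prob A \<le> prob (\<Union>i\<in>?I. K i)" using K_A by (intro finite_measure_mono) auto
    hence "prob (\<Union>i\<in>?I. K i) = 1" using A prob_le_1 by (metis order_antisym)
    thus ?thesis using finite_measure_finite_Union[OF _ _ Kdisj, of ?I] by (simp add: sets image_subset_iff)
  qed
  note total = this
  have pK: "prob (K i \<inter> A) = prob (K i)" for i
  proof -
    have "prob (K i) = prob (K i \<inter> A)"
    proof (rule finite_measure_eq_AE)
      show "AE x in \<nu>. x \<in> K i \<longleftrightarrow> x \<in> K i \<inter> A" using N by eventually_elim (auto simp: A_def)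
    qed auto
    thus ?thesis ..
  qed
  have hats: "\<bar>(\<Sum>j\<in>?I. eta ((\<integral>x. indicator A x * hat j (x / r) \<partial>\<nu>) / prob A))
      - (\<Sum>i\<in>?I. eta (prob (K i \<inter> A) / prob A))\<bar> \<le> 3 + 3"
  proof (rule entropy_hat_partition)
    show "disjoint_family_on (\<lambda>i. K i \<inter> A) ?I" by (auto simp: disjoint_family_on_def K_def)
    show "(\<Sum>i\<in>?I. prob (K i \<inter> A)) = prob A" using total by (simp add: pK A)
    show "\<bar>z / r\<bar> \<le> real N" if "z \<in> A" for z
      using that r by (simp add: A_def field_simps abs_divide)
    show "\<bar>z / r - z' / r\<bar> \<le> 3" if "z \<in> K i \<inter> A" "z' \<in> K i \<inter> A" for i z z'
      using that unfolding K_def by (auto) linarith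
    show "\<bar>real_of_int i - real_of_int i'\<bar> \<le> 3" if "z \<in> K i \<inter> A" "z' \<in> K i' \<inter> A" "\<bar>z / r - z' / r\<bar> \<le> 2" for i i' z z'
      using that unfolding K_def by (auto) linarith
  qed (auto simp: A)
  have hatA: "(\<integral>x. indicator A x * hat j (x / r) \<partial>\<nu>) = (\<integral>x. hat j (x / r) \<partial>\<nu>)" for j
    using N by (intro integral_cong_AE) (auto simp: A_def indicator_def elim: eventually_mono)
  have G_ge: "prob (K i) \<le> prob (cball x r)" if "x \<in> K i" for x i
  proof (intro finite_measure_mono subsetI)
    fix y assume "y \<in> K i"
    hence "\<bar>x / r - y / r\<bar> \<le> 1" using that unfolding K_def by auto linarith
    thus "y \<in> cball x r" using r by (simp add: dist_real_def diff_divide_distrib[symmetric] abs_divide)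
  qed simp
  have G_le: "prob (cball x r) \<le> s i" if x: "x \<in> K i" for x i
  proof -
    have "cball x r \<subseteq> K (i - 1) \<union> K i \<union> K (i + 1)"
    proof
      fix y assume "y \<in> cball x r"
      hence "\<bar>x / r - y / r\<bar> \<le> 1" using r by (simp add: dist_real_def diff_divide_distrib[symmetric] abs_divide)
      hence "\<lfloor>y / r\<rfloor> \<in> {i - 1, i, i + 1}" using x unfolding K_def by auto linarith
      thus "y \<in> K (i - 1) \<union> K i \<union> K (i + 1)" by (auto simp: K_def)
    qed
    hence "prob (cball x r) \<le> prob (K (i - 1) \<union> K i \<union> K (i + 1))" by (intro finite_measure_mono) auto
    also have "\<dots> \<le> prob (K (i - 1) \<union> K i) + prob (K (i + 1))" by (intro measure_Un_le) auto
    also have "\<dots> \<le> s i" unfolding s_def by (intro add_right_mono measure_Un_le) auto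
    finally show ?thesis .
  qed
  define U where "U x = (\<Sum>i\<in>?I. - ln (prob (K i)) * indicator (K i) x)" for x
  define Lo where "Lo x = (\<Sum>i\<in>?I. - ln (s i) * indicator (K i) x)" for x
  have at: "U x = - ln (prob (K i))" "Lo x = - ln (s i)" if "i \<in> ?I" "x \<in> K i" for x i
  proof -
    have "(\<Sum>k\<in>?I. f k * indicator (K k) x) = f i" for f :: "int \<Rightarrow> real"
    proof -
      have "(\<Sum>k\<in>?I. f k * indicator (K k) x) = (\<Sum>k\<in>{i}. f k * indicator (K k) x)"
        using that by (intro sum.mono_neutral_right) (auto simp: K_def)
      thus ?thesis using that by simp
    qed
    from this[of "\<lambda>i. - ln (prob (K i))"] this[of "\<lambda>i. - ln (s i)"]
    show "U x = - ln (prob (K i))" "Lo x = - ln (s i)" unfolding U_def Lo_def by auto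
  qed
  have good: "AE x in \<nu>. \<exists>i\<in>?I. x \<in> K i \<and> 0 < prob (K i)"
  proof -
    have "AE x in \<nu>. \<forall>i\<in>?I. prob (K i) = 0 \<longrightarrow> x \<notin> K i"
    proof (subst AE_ball_countable)
      show "\<forall>i\<in>?I. AE x in \<nu>. prob (K i) = 0 \<longrightarrow> x \<notin> K i"
      proof
        fix i
        show "AE x in \<nu>. prob (K i) = 0 \<longrightarrow> x \<notin> K i"
        proof (cases "prob (K i) = 0")
          case True
          hence "K i \<in> null_sets \<nu>" by (simp add: null_sets_def emeasure_eq_measure sets)
          thus ?thesis using AE_not_in by fastforce
        qed simp
      qed
    qed simp
    with N show ?thesis
    proof eventually_elim
      case (elim x)
      then obtain i where "i \<in> ?I" "x \<in> K i" using K_A[of x] by (auto simp: A_def)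
      moreover from this have "prob (K i) \<noteq> 0" using elim by blast
      ultimately show ?case by (meson zero_less_measure_iff)
    qed
  qed
  have bnds: "AE x in \<nu>. Lo x \<le> - ln (prob (cball x r)) \<and> - ln (prob (cball x r)) \<le> U x"
    using good
  proof eventually_elim
    case (elim x)
    then obtain i where i: "i \<in> ?I" "x \<in> K i" "0 < prob (K i)" by blast
    show ?case unfolding at[OF i(1,2)] using G_ge[OF i(2)] G_le[OF i(2)] i(3) by auto
  qed
  have [measurable]: "(\<lambda>x. prob (cball x r)) \<in> borel_measurable borel"
    by (rule measurable_measure_cball[OF prob_space_axioms sets])
  have iU: "integrable \<nu> U" and iL: "integrable \<nu> Lo"
    unfolding U_def Lo_def by (auto simp: emeasure_eq_measure intro!: Bochner_Integration.integrable_sum integrable_mult_right)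
  have [measurable]: "U \<in> borel_measurable borel" "Lo \<in> borel_measurable borel"
    unfolding U_def Lo_def by measurable
  have iG: "integrable \<nu> (\<lambda>x. - ln (prob (cball x r)))"
  proof (rule Bochner_Integration.integrable_bound)
    show "integrable \<nu> (\<lambda>x. \<bar>U x\<bar> + \<bar>Lo x\<bar>)" using iU iL by auto
    show "AE x in \<nu>. norm (- ln (prob (cball x r))) \<le> norm (\<bar>U x\<bar> + \<bar>Lo x\<bar>)"
      using bnds by eventually_elim auto
  qed measurable
  have EU: "(\<integral>x. U x \<partial>\<nu>) = (\<Sum>i\<in>?I. eta (prob (K i)))"
    unfolding U_def
    by (subst Bochner_Integration.integral_sum)
       (auto simp: emeasure_eq_measure eta_def mult.commute intro!: integrable_mult_right sum.cong)
  have EL: "(\<integral>x. Lo x \<partial>\<nu>) = (\<Sum>i\<in>?I. - (prob (K i) * ln (s i)))"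
    unfolding Lo_def
    by (subst Bochner_Integration.integral_sum)
       (auto simp: emeasure_eq_measure mult.commute intro!: integrable_mult_right sum.cong)
  have ss: "(\<Sum>i\<in>?I. s i) \<le> 3"
  proof -
    have shift: "(\<Sum>i\<in>?I. prob (K (i + k))) \<le> 1" for k
    proof -
      have "(\<Sum>i\<in>?I. prob (K (i + k))) = prob (\<Union>i\<in>?I. K (i + k))"
        by (rule finite_measure_finite_Union[symmetric]) (auto simp: disjoint_family_on_def K_def sets)
      thus ?thesis by simp
    qed
    show ?thesis using shift[of "-1"] shift[of 0] shift[of 1] by (simp add: s_def sum.distrib)
  qed
  have "(\<Sum>i\<in>?I. eta (prob (K i)) - s i) \<le> (\<Sum>i\<in>?I. - (prob (K i) * ln (s i)))"
    by (intro sum_mono eta_ge) (auto simp: s_def add_nonneg_pos add_pos_nonneg)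
  hence lower: "(\<Sum>i\<in>?I. eta (prob (K i))) - 3 \<le> (\<integral>x. Lo x \<partial>\<nu>)"
    using ss by (simp add: EL sum_subtractf)
  have "(\<integral>x. Lo x \<partial>\<nu>) \<le> (\<integral>x. - ln (prob (cball x r)) \<partial>\<nu>)"
    using bnds by (intro integral_mono_AE iL iG) auto
  moreover have "(\<integral>x. - ln (prob (cball x r)) \<partial>\<nu>) \<le> (\<integral>x. U x \<partial>\<nu>)"
    using bnds by (intro integral_mono_AE iU iG) auto
  moreover have "scale_entropy r \<nu> = (\<integral>x. - ln (prob (cball x r)) \<partial>\<nu>)" by (simp add: scale_entropy_def)
  ultimately show ?thesis using lower hats EU by (simp add: hatA pK A)
qed

definition projected_entropy :: "'a::real_inner \<Rightarrow> real \<Rightarrow> nat \<Rightarrow> 'a measure \<Rightarrow> real" where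
  "projected_entropy e r N \<nu> = (\<Sum>j\<in>{- int N..int N}. eta (\<integral>z. hat j (z \<bullet> e / r) \<partial>\<nu>))"

lemma continuous_map_projected_entropy:
  fixes e :: "'a::real_inner"
  assumes "r \<noteq> 0"
  shows "continuous_map (weak_topology euclidean) euclideanreal (projected_entropy e r N)"
  unfolding projected_entropy_def
proof (rule continuous_map_sum)
  fix j
  have c: "continuous_map (weak_topology euclidean) euclideanreal (\<lambda>\<nu>. \<integral>z. hat j (z \<bullet> e / r) \<partial>\<nu>)"
  proof (rule continuous_map_integral)
    show "continuous_map euclidean euclideanreal (\<lambda>z. hat j (z \<bullet> e / r))"
      using assms by (auto intro!: continuous_intros)
    show "bounded ((\<lambda>z. hat j (z \<bullet> e / r)) ` topspace euclidean)" by (auto intro!: boundedI[where B=1])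
  qed
  hence c': "continuous_map (weak_topology euclidean) (top_of_set {0..}) (\<lambda>\<nu>. \<integral>z. hat j (z \<bullet> e / r) \<partial>\<nu>)"
    by (auto simp: continuous_map_in_subtopology intro!: integral_nonneg)
  have "continuous_map (top_of_set {0..}) euclideanreal eta" using continuous_on_eta by simp
  from continuous_map_compose[OF c' this]
  show "continuous_map (weak_topology euclidean) euclideanreal (\<lambda>\<nu>. eta (\<integral>z. hat j (z \<bullet> e / r) \<partial>\<nu>))"
    by (simp add: o_def)
qed simp

lemma projected_entropy_bounds:
  fixes e :: "'a::euclidean_space"
  assumes "\<nu> \<in> prob_measures euclidean"
  shows "0 \<le> projected_entropy e r N \<nu>" "projected_entropy e r N \<nu> \<le> ln (2 * real N + 1) + 1"
proof -
  have "prob_space \<nu>" and sets [measurable_cong]: "sets \<nu> = sets borel"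
    using assms by (auto simp: prob_measures_def borel_of_euclidean)
  interpret prob_space \<nu> by fact
  define p where "p j = (\<integral>z. hat j (z \<bullet> e / r) \<partial>\<nu>)" for j
  have int: "integrable \<nu> (\<lambda>z. hat j (z \<bullet> e / r))" for j
    by (rule integrable_const_bound[where B=1]) auto
  have p: "0 \<le> p j" "p j \<le> 1" for j
  proof -
    show "0 \<le> p j" unfolding p_def by simp
    have "p j \<le> (\<integral>z. 1 \<partial>\<nu>)" unfolding p_def using int by (intro integral_mono) auto
    thus "p j \<le> 1" by (simp add: prob_space)
  qed
  have sp: "(\<Sum>j\<in>{- int N..int N}. p j) \<le> 1"
  proof -
    have "(\<Sum>j\<in>{- int N..int N}. p j) = (\<integral>z. (\<Sum>j\<in>{- int N..int N}. hat j (z \<bullet> e / r)) \<partial>\<nu>)"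
      unfolding p_def using int by (subst Bochner_Integration.integral_sum) auto
    also have "\<dots> \<le> (\<integral>z. 1 \<partial>\<nu>)"
      using int sum_hat_le by (intro integral_mono Bochner_Integration.integrable_sum) auto
    finally show ?thesis by (simp add: prob_space)
  qed
  show "0 \<le> projected_entropy e r N \<nu>"
    unfolding projected_entropy_def p_def[symmetric] using p by (intro sum_nonneg eta_nonneg)
  define n where "n = 2 * real N + 1"
  have n: "1 \<le> n" "real (card {- int N..int N}) = n" by (auto simp: n_def)
  have "projected_entropy e r N \<nu> \<le> (\<Sum>j\<in>{- int N..int N}. p j * ln n + 1 / n)"
    unfolding projected_entropy_def p_def[symmetric]
  proof (rule sum_mono)
    fix j
    have "eta (p j) - 1 / n \<le> - (p j * ln (1 / n))" using p n by (intro eta_ge) auto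
    thus "eta (p j) \<le> p j * ln n + 1 / n" using n by (simp add: ln_div)
  qed
  also have "\<dots> = (\<Sum>j\<in>{- int N..int N}. p j) * ln n + 1"
    using n by (simp add: sum.distrib sum_distrib_right n_def)
  also have "\<dots> \<le> 1 * ln n + 1" using sp n by (intro add_right_mono mult_right_mono) auto
  finally show "projected_entropy e r N \<nu> \<le> ln (2 * real N + 1) + 1" unfolding n_def by (simp only: mult_1)
qed

section \<open>Measures on a tree of cells\<close>

locale cell_tree = prob_space \<mu>
  for \<mu> :: "'a::metric_space measure" +
  fixes P :: "nat \<Rightarrow> 'a set set" and X :: "'a set" and \<delta> c :: real
  assumes sets_eq [measurable_cong, simp]: "sets \<mu> = sets borel"
    and delta: "0 < \<delta>" "\<delta> < 1" and c0: "0 \<le> c"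
    and part: "partition_on X (P n)"
    and fin [simp, intro]: "finite (P n)"
    and refine: "A \<in> P (Suc n) \<Longrightarrow> \<exists>A'\<in>P n. A \<subseteq> A'"
    and meas_cell [intro]: "A \<in> P n \<Longrightarrow> A \<in> sets borel"
    and diam: "A \<in> P n \<Longrightarrow> x \<in> A \<Longrightarrow> y \<in> A \<Longrightarrow> dist x y \<le> c * \<delta> ^ n"
    and carried: "AE x in \<mu>. x \<in> X"
begin

lemma space_eq [simp]: "space \<mu> = UNIV"
  using sets_eq_imp_space_eq[OF sets_eq] by simp

definition cell_at :: "nat \<Rightarrow> 'a \<Rightarrow> 'a set" where
  "cell_at n x = (THE A. A \<in> P n \<and> x \<in> A)"

definition rep :: "'a set \<Rightarrow> 'a" where
  "rep A = (SOME x. x \<in> A)"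

text \<open>
  Subcells of measure zero are left out, so that conditional distributions exist on every subcell.
\<close>

definition subcells :: "nat \<Rightarrow> 'a set \<Rightarrow> 'a set set" where
  "subcells m A = {A' \<in> P m. A' \<subseteq> A \<and> 0 < prob A'}"

lemma rep_in: "A \<in> P n \<Longrightarrow> rep A \<in> A"
  using part[of n] unfolding rep_def partition_on_def by (metis some_in_eq)

lemma cell_sub: "A \<in> P n \<Longrightarrow> A \<subseteq> X"
  using part[of n] unfolding partition_on_def by auto

lemma cells_disjoint: "A \<in> P n \<Longrightarrow> A' \<in> P n \<Longrightarrow> x \<in> A \<Longrightarrow> x \<in> A' \<Longrightarrow> A = A'"
  using part[of n] unfolding partition_on_def disjoint_def by blast

lemma cell_subset_eq: "A \<in> P n \<Longrightarrow> B \<in> P n \<Longrightarrow> A \<subseteq> B \<Longrightarrow> A = B"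
  using rep_in[of A n] cells_disjoint[of A n B "rep A"] by blast

lemma subcells_disjoint:
  assumes "A \<in> P n" "B \<in> P n" "A \<noteq> B"
  shows "subcells m A \<inter> subcells m B = {}"
proof (rule ccontr)
  assume "subcells m A \<inter> subcells m B \<noteq> {}"
  then obtain C where "C \<in> P m" "C \<subseteq> A" "C \<subseteq> B" by (auto simp: subcells_def)
  thus False using rep_in[of C m] cells_disjoint[OF assms(1,2)] assms(3) by blast
qed

lemma cell_at_eq: "A \<in> P n \<Longrightarrow> x \<in> A \<Longrightarrow> cell_at n x = A"
  unfolding cell_at_def using cells_disjoint by (intro the_equality) blast+

lemma cell_at_in: assumes "x \<in> X" shows "cell_at n x \<in> P n" "x \<in> cell_at n x"
proof -
  obtain A where "A \<in> P n" "x \<in> A" using assms part[of n] unfolding partition_on_def by blast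
  with cell_at_eq[of A n x] show "cell_at n x \<in> P n" "x \<in> cell_at n x" by auto
qed

lemma ex_ancestor: "A \<in> P m \<Longrightarrow> n \<le> m \<Longrightarrow> \<exists>A'\<in>P n. A \<subseteq> A'"
proof (induction m arbitrary: A)
  case (Suc m)
  show ?case
  proof (cases "n = Suc m")
    case False
    obtain A1 where A1: "A1 \<in> P m" "A \<subseteq> A1" using refine Suc.prems by blast
    have "n \<le> m" using False Suc.prems(2) by simp
    then obtain A' where "A' \<in> P n" "A1 \<subseteq> A'" using Suc.IH[OF A1(1)] by blast
    with A1(2) show ?thesis by blast
  qed (use Suc.prems in auto)
qed auto

lemma sub_cell_iff:
  assumes "A \<in> P n" "A' \<in> P m" "n \<le> m" "x \<in> A'"
  shows "A' \<subseteq> A \<longleftrightarrow> x \<in> A"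
proof
  assume x: "x \<in> A"
  obtain A1 where "A1 \<in> P n" "A' \<subseteq> A1" using ex_ancestor assms by blast
  thus "A' \<subseteq> A" using cells_disjoint[of A1 n A x] assms x by auto
qed (use assms in auto)

lemma cell_at_mono: "x \<in> X \<Longrightarrow> n \<le> m \<Longrightarrow> cell_at m x \<subseteq> cell_at n x"
  using sub_cell_iff[of "cell_at n x" n "cell_at m x" m x] cell_at_in by blast

lemma cell_at_rep: "A \<in> P m \<Longrightarrow> n \<le> m \<Longrightarrow> cell_at n (rep A) \<in> P n \<and> A \<subseteq> cell_at n (rep A)"
  using cell_at_mono[of "rep A" n m] cell_at_eq[of A m "rep A"] rep_in[of A m] cell_sub[of A m] cell_at_in(1) by blast

lemma finite_subcells [simp, intro]: "finite (subcells m A)"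
  unfolding subcells_def by (rule finite_subset[OF _ fin[of m]]) auto

lemma subcellsD:
  "A' \<in> subcells m A \<Longrightarrow> A' \<in> P m" "A' \<in> subcells m A \<Longrightarrow> A' \<subseteq> A" "A' \<in> subcells m A \<Longrightarrow> 0 < prob A'"
  by (auto simp: subcells_def)

lemma AE_pos: "AE x in \<mu>. x \<in> X \<and> (\<forall>n. 0 < prob (cell_at n x))"
proof -
  have "AE x in \<mu>. \<forall>A\<in>{A\<in>P n. prob A = 0}. x \<notin> A" for n
  proof (subst AE_ball_countable)
    show "countable {A \<in> P n. prob A = 0}" by (intro countable_finite) auto
    show "\<forall>A\<in>{A \<in> P n. prob A = 0}. AE x in \<mu>. x \<notin> A"
    proof
      fix A assume A: "A \<in> {A \<in> P n. prob A = 0}"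
      hence "A \<in> sets \<mu>" using meas_cell[of A n] by simp
      hence "A \<in> null_sets \<mu>" using A by (simp add: null_sets_def emeasure_eq_measure)
      thus "AE x in \<mu>. x \<notin> A" by (rule AE_not_in)
    qed
  qed
  hence "AE x in \<mu>. \<forall>n. \<forall>A\<in>{A\<in>P n. prob A = 0}. x \<notin> A" by (subst AE_all_countable) auto
  with carried show ?thesis
  proof eventually_elim
    case (elim x)
    have "prob (cell_at n x) \<noteq> 0" for n using elim cell_at_in[of x n] by blast
    thus ?case using elim by (simp add: zero_less_measure_iff)
  qed
qed

lemma measurable_at: "(\<lambda>x. F (cell_at n x) :: real) \<in> borel_measurable \<mu>"
proof -
  have eq: "F (cell_at n x) = (\<Sum>A\<in>P n. F A * indicator A x) + F (THE A. False) * indicator (- \<Union>(P n)) x" for x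
  proof (cases "x \<in> X")
    case True
    have "(\<Sum>A\<in>P n. F A * indicator A x) = (\<Sum>A\<in>{cell_at n x}. F A * indicator A x)"
      using cell_at_in[OF True] cell_at_eq by (intro sum.mono_neutral_right) (auto simp: indicator_def)
    also have "\<dots> = F (cell_at n x)" using cell_at_in[OF True, of n] by simp
    finally show ?thesis using cell_at_in[OF True, of n] by (auto simp: indicator_def)
  next
    case False
    hence n: "\<And>A. A \<in> P n \<Longrightarrow> x \<notin> A" using cell_sub by auto
    hence "cell_at n x = (THE A. False)" unfolding cell_at_def by (metis (no_types, lifting))
    moreover have "(\<Sum>A\<in>P n. F A * indicator A x) = 0" using n by (intro sum.neutral) auto
    ultimately show ?thesis using n by auto
  qed
  have [measurable]: "A \<in> P n \<Longrightarrow> A \<in> sets borel" for A by auto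
  have [measurable]: "\<Union>(P n) \<in> sets borel" by (intro sets.finite_Union) auto
  show ?thesis unfolding eq by measurable
qed

lemma integral_at: "(\<integral>x. F (cell_at n x) \<partial>\<mu>) = (\<Sum>A\<in>P n. prob A * F A)" for F :: "'a set \<Rightarrow> real"
proof -
  have [measurable]: "A \<in> P n \<Longrightarrow> A \<in> sets borel" for A by auto
  have "(\<integral>x. F (cell_at n x) \<partial>\<mu>) = (\<integral>x. (\<Sum>A\<in>P n. F A * indicator A x) \<partial>\<mu>)"
  proof (rule integral_cong_AE)
    show "(\<lambda>x. \<Sum>A\<in>P n. F A * indicator A x) \<in> borel_measurable \<mu>" by measurable
    show "AE x in \<mu>. F (cell_at n x) = (\<Sum>A\<in>P n. F A * indicator A x)"
      using carried
    proof eventually_elim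
      case (elim x)
      have "(\<Sum>A\<in>P n. F A * indicator A x) = (\<Sum>A\<in>{cell_at n x}. F A * indicator A x)"
        using cell_at_in[OF elim] cell_at_eq by (intro sum.mono_neutral_right) (auto simp: indicator_def)
      thus ?case using cell_at_in[OF elim, of n] by auto
    qed
  qed (rule measurable_at)
  also have "\<dots> = (\<Sum>A\<in>P n. F A * prob A)"
    by (subst Bochner_Integration.integral_sum) (auto simp: emeasure_eq_measure intro!: integrable_mult_right)
  finally show ?thesis by (simp add: mult.commute)
qed

lemma sum_cells_eq_sum_subcells:
  fixes F :: "'a set \<Rightarrow> real"
  assumes "n \<le> m"
  shows "(\<Sum>A'\<in>P m. prob A' * F A') = (\<Sum>A\<in>P n. \<Sum>A'\<in>subcells m A. prob A' * F A')"
proof -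
  have "(\<Sum>A'\<in>P m. prob A' * F A') = (\<Sum>A'\<in>{A'\<in>P m. 0 < prob A'}. prob A' * F A')"
    by (intro sum.mono_neutral_right) (auto simp: zero_less_measure_iff)
  also have "{A'\<in>P m. 0 < prob A'} = (\<Union>A\<in>P n. subcells m A)"
    using ex_ancestor[OF _ assms] by (auto simp: subcells_def)
  also have "(\<Sum>A'\<in>\<dots>. prob A' * F A') = (\<Sum>A\<in>P n. \<Sum>A'\<in>subcells m A. prob A' * F A')"
    using subcells_disjoint by (intro sum.UNION_disjoint ballI impI) auto
  finally show ?thesis .
qed

lemma prob_eq_sum_subcells:
  assumes A: "A \<in> P n" and "n \<le> m"
  shows "(\<Sum>A'\<in>subcells m A. prob A') = prob A"
proof -
  let ?F = "\<lambda>B. if B \<subseteq> A then 1 else 0 :: real"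
  have "prob A = (\<Sum>B\<in>P n. prob B * ?F B)"
  proof -
    have "(\<Sum>B\<in>P n. prob B * ?F B) = (\<Sum>B\<in>{A}. prob B * ?F B)"
      using A cell_subset_eq[OF _ A] by (intro sum.mono_neutral_right) auto
    thus ?thesis by simp
  qed
  also have "\<dots> = (\<integral>x. ?F (cell_at n x) \<partial>\<mu>)" by (rule integral_at[of ?F n, symmetric])
  also have "\<dots> = (\<integral>x. ?F (cell_at m x) \<partial>\<mu>)"
  proof (rule integral_cong_AE)
    show "AE x in \<mu>. ?F (cell_at n x) = ?F (cell_at m x)"
      using carried
    proof eventually_elim
      case (elim x)
      have "cell_at n x \<subseteq> A \<longleftrightarrow> x \<in> A"
        using sub_cell_iff[OF A cell_at_in(1)[OF elim] order_refl cell_at_in(2)[OF elim]] .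
      moreover have "cell_at m x \<subseteq> A \<longleftrightarrow> x \<in> A"
        using sub_cell_iff[OF A cell_at_in(1)[OF elim] \<open>n \<le> m\<close> cell_at_in(2)[OF elim]] .
      ultimately show ?case by simp
    qed
  qed (rule measurable_at[of ?F])+
  also have "\<dots> = (\<Sum>B\<in>P m. prob B * ?F B)" by (rule integral_at[of ?F m])
  also have "\<dots> = (\<Sum>B\<in>subcells m A. prob B * ?F B)"
    by (intro sum.mono_neutral_right) (auto simp: subcells_def zero_less_measure_iff)
  also have "\<dots> = (\<Sum>B\<in>subcells m A. prob B)" by (intro sum.cong) (auto simp: subcells_def)
  finally show ?thesis ..
qed

definition label :: "('a \<Rightarrow> real) \<Rightarrow> nat \<Rightarrow> 'a set \<Rightarrow> int" where
  "label g m A = \<lfloor>g (rep A) / \<delta> ^ m\<rfloor>"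

text \<open>
  The entropy at scale \<open>\<delta>\<^sup>m\<close> of the image under \<open>g\<close> of the measure conditioned on \<open>A\<close>. The position \<open>g x\<close> is
  rounded twice: to the representative of the cell of \<open>x\<close> of level \<open>m\<close>, and to the grid of width \<open>\<delta>\<^sup>m\<close>.
  Because of the first rounding the label is a function of the cell, which makes averages over cells of
  level \<open>m\<close> finite sums and, later on, the differences of losses orthogonal.
\<close>

definition label_entropy :: "('a \<Rightarrow> real) \<Rightarrow> nat \<Rightarrow> 'a set \<Rightarrow> real" where
  "label_entropy g m A = (\<Sum>i\<in>label g m ` subcells m A.
      eta (\<Sum>A'\<in>{A'\<in>subcells m A. label g m A' = i}. prob A' / prob A))"

lemma label_bound: "\<bar>g (rep A) / \<delta> ^ m - of_int (label g m A)\<bar> \<le> 1"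
  unfolding label_def by linarith

lemma lipschitz_cell:
  assumes g: "1-lipschitz_on UNIV g" and "A \<in> P m" "x \<in> A" "y \<in> A"
  shows "\<bar>g x / \<delta> ^ m - g y / \<delta> ^ m\<bar> \<le> (c::real)"
proof -
  have "\<bar>g x - g y\<bar> \<le> dist x y" using lipschitz_onD[OF g, of x y] by (simp add: dist_real_def)
  also have "\<dots> \<le> c * \<delta> ^ m" using diam assms by auto
  finally show ?thesis using delta
    by (simp add: diff_divide_distrib[symmetric] abs_divide pos_divide_le_eq)
qed

lemma subcells_trans:
  assumes "A \<in> P n" "n \<le> k" "k \<le> m"
  shows "subcells m A = (\<Union>A'\<in>subcells k A. subcells m A')" (is "_ = ?R")
proof (intro equalityI subsetI)
  fix B assume B: "B \<in> subcells m A"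
  then obtain A' where A': "A' \<in> P k" "B \<subseteq> A'" using ex_ancestor[of B m k] assms subcellsD by blast
  have b: "rep B \<in> B" using B rep_in subcellsD by blast
  have "A' \<subseteq> A" using sub_cell_iff[OF assms(1) A'(1) assms(2), of "rep B"] b A' subcellsD[OF B] by blast
  moreover have "prob B \<le> prob A'" using A' meas_cell by (intro finite_measure_mono) auto
  hence "0 < prob A'" using subcellsD(3)[OF B] by simp
  ultimately show "B \<in> ?R" using A' B by (auto simp: subcells_def)
next
  fix B assume "B \<in> ?R" thus "B \<in> subcells m A" by (auto simp: subcells_def)
qed

text \<open>
  The chain rule with the cells of level \<open>k\<close> inside \<open>A\<close> as points and the labels of levels \<open>k\<close> and \<open>m\<close> as
  coarse and fine labels. Since \<open>g\<close> varies by at most \<open>c \<delta>\<^sup>k\<close> on a cell of level \<open>k\<close>, the fine label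
  determines the coarse one up to boundedly many possibilities.
\<close>

lemma label_entropy_superadditive:
  assumes g: "1-lipschitz_on UNIV g" and A: "A \<in> P n" "0 < prob A" and le: "n \<le> k" "k \<le> m"
  shows "label_entropy g k A + (\<Sum>A'\<in>subcells k A. prob A' / prob A * label_entropy g m A')
     \<le> label_entropy g m A + (2 * c + 5)"
proof -
  let ?S = "subcells k A" and ?I = "label g m ` subcells m A"
  let ?w = "\<lambda>a. prob a / prob A"
  let ?p = "\<lambda>a i. \<Sum>A'\<in>{A'\<in>subcells m a. label g m A' = i}. prob A' / prob a"
  have sub: "subcells m a \<subseteq> subcells m A" if "a \<in> ?S" for a
    using that subcells_trans[OF A(1) le] by auto
  have "(\<Sum>a\<in>?S. ?w a * (\<Sum>i\<in>?I. eta (?p a i))) + (\<Sum>i\<in>label g k ` ?S. eta (\<Sum>a\<in>{a\<in>?S. label g k a = i}. ?w a))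
    \<le> (\<Sum>i\<in>?I. eta (\<Sum>a\<in>?S. ?w a * ?p a i)) + (2 * c + 5)"
  proof (rule sum_eta_chain)
    show "(\<Sum>a\<in>?S. ?w a) = 1"
      using prob_eq_sum_subcells[OF A(1) le(1)] A(2) by (simp add: sum_divide_distrib[symmetric])
    fix a assume a: "a \<in> ?S"
    have "(\<Sum>i\<in>?I. ?p a i) = (\<Sum>i\<in>label g m ` subcells m a. ?p a i)"
    proof (intro sum.mono_neutral_right ballI)
      fix i assume "i \<in> ?I - label g m ` subcells m a"
      hence "{A' \<in> subcells m a. label g m A' = i} = {}" by blast
      thus "?p a i = 0" by (simp only: sum.empty)
    qed (use sub[OF a] in auto)
    also have "\<dots> = (\<Sum>A'\<in>subcells m a. prob A' / prob a)"
      by (rule sum.image_gen[symmetric]) simp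
    also have "\<dots> = 1"
      using prob_eq_sum_subcells[of a k m] a le by (simp add: sum_divide_distrib[symmetric] subcells_def)
    finally show "(\<Sum>i\<in>?I. ?p a i) = 1" .
  next
    fix i assume "i \<in> ?I"
    show "real (card (label g k ` {a\<in>?S. 0 < ?w a \<and> 0 < ?p a i})) \<le> 2 * c + 5"
    proof -
      have near: "\<bar>of_int (label g k a) - of_int i * \<delta> ^ m / \<delta> ^ k\<bar> \<le> c + 2"
        if a: "a \<in> ?S" "0 < ?p a i" for a
      proof -
        obtain A' where A': "A' \<in> subcells m a" "label g m A' = i"
          using a(2) by (metis (mono_tags, lifting) less_irrefl mem_Collect_eq sum.neutral)
        have "\<bar>g (rep A') / \<delta> ^ k - g (rep a) / \<delta> ^ k\<bar> \<le> c"
          using A' a rep_in subcellsD by (intro lipschitz_cell[OF g, of a]) blast+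
        moreover have "\<bar>g (rep A') / \<delta> ^ k - of_int i * \<delta> ^ m / \<delta> ^ k\<bar> \<le> 1"
        proof -
          have "\<bar>g (rep A') / \<delta> ^ m - of_int i\<bar> * (\<delta> ^ m / \<delta> ^ k) \<le> 1 * 1"
            using label_bound[of g A' m] A' delta le
            by (intro mult_mono) (auto simp: power_decreasing)
          also have "\<bar>g (rep A') / \<delta> ^ m - of_int i\<bar> * (\<delta> ^ m / \<delta> ^ k) = \<bar>(g (rep A') / \<delta> ^ m - of_int i) * (\<delta> ^ m / \<delta> ^ k)\<bar>"
            using delta by (simp add: abs_mult)
          also have "(g (rep A') / \<delta> ^ m - of_int i) * (\<delta> ^ m / \<delta> ^ k) = g (rep A') / \<delta> ^ k - of_int i * \<delta> ^ m / \<delta> ^ k"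
            using delta by (simp add: field_simps)
          finally show ?thesis by simp
        qed
        ultimately show ?thesis using label_bound[of g a k] by linarith
      qed
      have "real (card (label g k ` {a\<in>?S. 0 < ?w a \<and> 0 < ?p a i})) \<le> 2 * (c + 2) + 1"
      proof (rule card_int_le(2))
        fix u v assume "u \<in> label g k ` {a\<in>?S. 0 < ?w a \<and> 0 < ?p a i}" "v \<in> label g k ` {a\<in>?S. 0 < ?w a \<and> 0 < ?p a i}"
        then obtain a b where ab: "a \<in> ?S" "0 < ?p a i" "b \<in> ?S" "0 < ?p b i" and uv: "u = label g k a" "v = label g k b"
          by blast
        have triangle: "\<bar>x - y\<bar> \<le> 2 * r" if "\<bar>x - z\<bar> \<le> r" "\<bar>y - z\<bar> \<le> r" for x y z r :: real
          using that by linarith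
        show "\<bar>real_of_int u - real_of_int v\<bar> \<le> 2 * (c + 2)"
          unfolding uv by (rule triangle[OF near[OF ab(1,2)] near[OF ab(3,4)]])
      qed (use c0 in auto)
      thus ?thesis by simp
    qed
  qed (auto intro!: sum_nonneg)
  moreover have "(\<Sum>i\<in>?I. eta (?p a i)) = label_entropy g m a" if a: "a \<in> ?S" for a
    unfolding label_entropy_def
  proof (intro sum.mono_neutral_right ballI)
    fix i assume "i \<in> ?I - label g m ` subcells m a"
    hence "{A' \<in> subcells m a. label g m A' = i} = {}" by blast
    thus "eta (?p a i) = 0" by (simp only: sum.empty eta_0)
  qed (use sub[OF a] in auto)
  moreover have "(\<Sum>a\<in>?S. ?w a * ?p a i) = (\<Sum>A'\<in>{A'\<in>subcells m A. label g m A' = i}. prob A' / prob A)" for i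
  proof -
    have "(\<Sum>A'\<in>{A'\<in>subcells m A. label g m A' = i}. prob A' / prob A)
       = (\<Sum>A'\<in>(\<Union>a\<in>?S. {A'\<in>subcells m a. label g m A' = i}). prob A' / prob A)"
      unfolding subcells_trans[OF A(1) le] by (intro sum.cong) auto
    also have "\<dots> = (\<Sum>a\<in>?S. \<Sum>A'\<in>{A'\<in>subcells m a. label g m A' = i}. prob A' / prob A)"
    proof (intro sum.UNION_disjoint ballI impI)
      fix a b assume "a \<in> ?S" "b \<in> ?S" "a \<noteq> b"
      thus "{A'\<in>subcells m a. label g m A' = i} \<inter> {A'\<in>subcells m b. label g m A' = i} = {}"
        using subcells_disjoint[of a k b m] subcellsD(1) by blast
    qed auto
    also have "\<dots> = (\<Sum>a\<in>?S. ?w a * ?p a i)"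
      by (intro sum.cong refl) (auto simp: sum_distrib_left subcells_def intro!: sum.cong)
    finally show ?thesis ..
  qed
  ultimately show ?thesis by (simp add: label_entropy_def[of g k A] label_entropy_def[of g m A])
qed

text \<open>
  For a coordinate \<open>t\<close> that is quasi-isometric to \<open>g\<close> at scale \<open>\<delta>\<^sup>m\<close>, the rounding of positions and the hat
  functions of \<open>t\<close> give the same entropy up to a constant.
\<close>

lemma label_entropy_hat:
  assumes [measurable]: "t \<in> borel_measurable borel" and g: "1-lipschitz_on UNIV g"
    and A: "A \<in> P n" "0 < prob A" and "n \<le> m"
    and tN: "\<And>z. z \<in> A \<Longrightarrow> \<bar>t z\<bar> \<le> real N" and k: "0 \<le> \<kappa>"
    and q1: "\<And>z z'. z \<in> A \<Longrightarrow> z' \<in> A \<Longrightarrow> \<bar>t z - t z'\<bar> \<le> \<kappa> * (\<bar>g z / \<delta> ^ m - g z' / \<delta> ^ m\<bar> + 1)"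
    and q2: "\<And>z z'. z \<in> A \<Longrightarrow> z' \<in> A \<Longrightarrow> \<bar>g z / \<delta> ^ m - g z' / \<delta> ^ m\<bar> \<le> \<kappa> * (\<bar>t z - t z'\<bar> + 1)"
  shows "\<bar>(\<Sum>j\<in>{- int N..int N}. eta ((\<integral>z. indicator A z * hat j (t z) \<partial>\<mu>) / prob A))
      - label_entropy g m A\<bar> \<le> (2 * c + 3) * (\<kappa> + 1) + 3"
proof -
  let ?I = "label g m ` subcells m A"
  define K where "K i = \<Union>{A'\<in>subcells m A. label g m A' = i}" for i
  have sm [measurable]: "B \<in> subcells m A \<Longrightarrow> B \<in> sets borel" for B using subcellsD(1) meas_cell by blast
  have pK: "prob (K i) = (\<Sum>A'\<in>{A'\<in>subcells m A. label g m A' = i}. prob A')" for i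
    unfolding K_def
  proof (rule measure_Union')
    show "pairwise disjnt {A' \<in> subcells m A. label g m A' = i}"
      unfolding pairwise_def disjnt_def using subcellsD(1) cells_disjoint by blast
    show "S \<in> fmeasurable \<mu>" if "S \<in> {A' \<in> subcells m A. label g m A' = i}" for S
      using that sm by (auto simp: fmeasurable_def emeasure_eq_measure)
  qed auto
  have zK: "\<bar>g z / \<delta> ^ m - of_int i\<bar> \<le> c + 1" if z: "z \<in> K i" for z i
  proof -
    obtain A' where A': "A' \<in> subcells m A" "label g m A' = i" "z \<in> A'" using z by (auto simp: K_def)
    have "\<bar>g z / \<delta> ^ m - g (rep A') / \<delta> ^ m\<bar> \<le> c"
      using A' rep_in subcellsD(1) by (intro lipschitz_cell[OF g, of A']) blast+
    thus ?thesis using label_bound[of g A' m] A'(2) by linarith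
  qed
  have KA: "K i \<subseteq> A" for i using subcellsD(2) by (auto simp: K_def)
  have "\<bar>(\<Sum>j\<in>{- int N..int N}. eta ((\<integral>z. indicator A z * hat j (t z) \<partial>\<mu>) / prob A))
      - (\<Sum>i\<in>?I. eta (prob (K i) / prob A))\<bar> \<le> (2 * c + 3) * (\<kappa> + 1) + 3"
  proof (rule entropy_hat_partition)
    show "A \<in> events" using A by auto
    show "K i \<in> events" for i unfolding K_def by (intro sets.finite_Union) (auto simp: sm)
    show "disjoint_family_on K ?I"
      unfolding disjoint_family_on_def K_def using subcellsD(1) cells_disjoint by blast
    have "(\<Sum>i\<in>?I. prob (K i)) = (\<Sum>A'\<in>subcells m A. prob A')"
      unfolding pK by (rule sum.image_gen[symmetric]) simp
    thus "(\<Sum>i\<in>?I. prob (K i)) = prob A" using prob_eq_sum_subcells[OF A(1) \<open>n \<le> m\<close>] by simp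
    show "\<bar>t z - t z'\<bar> \<le> (2 * c + 3) * (\<kappa> + 1)" if "z \<in> K i" "z' \<in> K i" for i z z'
    proof -
      have "\<bar>t z - t z'\<bar> \<le> \<kappa> * (\<bar>g z / \<delta> ^ m - g z' / \<delta> ^ m\<bar> + 1)" using q1 that KA by blast
      also have "\<dots> \<le> \<kappa> * (2 * c + 3)"
        using zK[OF that(1)] zK[OF that(2)] k by (intro mult_left_mono) linarith+
      also have "\<dots> \<le> (2 * c + 3) * (\<kappa> + 1)" using k c0 by (simp add: algebra_simps)
      finally show ?thesis .
    qed
    show "\<bar>real_of_int i - real_of_int i'\<bar> \<le> (2 * c + 3) * (\<kappa> + 1)"
      if "z \<in> K i" "z' \<in> K i'" "\<bar>t z - t z'\<bar> \<le> 2" for i i' z z'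
    proof -
      have "\<bar>g z / \<delta> ^ m - g z' / \<delta> ^ m\<bar> \<le> \<kappa> * (\<bar>t z - t z'\<bar> + 1)" using q2 that KA by blast
      also have "\<dots> \<le> \<kappa> * 3" using that(3) k by (intro mult_left_mono) auto
      finally have "\<bar>real_of_int i - real_of_int i'\<bar> \<le> 2 * c + 2 + \<kappa> * 3"
        using zK[OF that(1)] zK[OF that(2)] by linarith
      also have "\<dots> \<le> (2 * c + 3) * (\<kappa> + 1)" using k c0 by (simp add: algebra_simps)
      finally show ?thesis .
    qed
  qed (use A tN KA k c0 in auto)
  thus ?thesis unfolding label_entropy_def pK sum_divide_distrib .
qed

section \<open>Loss of mass along the tree\<close>

text \<open>
  The solution of \<open>R = c + 2 + R \<delta>\<close>. It is so large that the window of any subcell stays inside the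
  window of the cell, even after rounding of the position.
\<close>

definition radius :: real where
  "radius = (c + 2) / (1 - \<delta>)"

definition near_mass :: "('a \<Rightarrow> real) \<Rightarrow> nat \<Rightarrow> 'a set \<Rightarrow> real" where
  "near_mass g m A = prob {z. \<bar>g z - g (rep A)\<bar> \<le> radius * \<delta> ^ m}"

text \<open>
  The logarithmic loss of mass between the windows of the cells of levels \<open>n\<close> and \<open>n + q\<close>. It is truncated at
  \<open>q ln (1 / \<delta>)\<close> in order to be bounded. The truncation is harmless: a cell of level \<open>n\<close> meets only
  \<open>O(\<delta>\<^sup>-\<^sup>q)\<close> labels of level \<open>n + q\<close>, and raising their relative masses to at least \<open>\<delta>\<^sup>q\<close> adds only a
  bounded amount to the total mass that enters Gibbs' inequality.
\<close>

definition mass_loss :: "('a \<Rightarrow> real) \<Rightarrow> nat \<Rightarrow> nat \<Rightarrow> 'a set \<Rightarrow> real" where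
  "mass_loss g n q A' = min (ln (near_mass g n (cell_at n (rep A'))) - ln (near_mass g (n + q) A')) (q * ln (1 / \<delta>))"

lemma radius_eq: "radius = c + 2 + radius * \<delta>"
  using delta by (simp add: radius_def field_simps)

lemma radius_nonneg: "0 \<le> radius" using c0 delta by (simp add: radius_def)

lemma radius_ge: "c + 1 \<le> radius"
  using radius_eq radius_nonneg delta mult_nonneg_nonneg[of radius \<delta>] by linarith

lemma lipschitz_dist: "1-lipschitz_on UNIV g \<Longrightarrow> \<bar>g x - g y\<bar> \<le> dist x y" for g :: "'a \<Rightarrow> real"
  using lipschitz_onD[of 1 UNIV g x y] by (simp add: dist_real_def)

lemma lipschitz_measurable: "1-lipschitz_on UNIV g \<Longrightarrow> g \<in> borel_measurable borel" for g :: "'a \<Rightarrow> real"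
  by (intro borel_measurable_continuous_onI lipschitz_on_continuous_on)

context
  fixes g :: "'a \<Rightarrow> real"
  assumes g: "1-lipschitz_on UNIV g"
begin

lemma g_measurable [measurable]: "g \<in> borel_measurable borel"
  using g by (rule lipschitz_measurable)

lemma window_events [measurable]: "{z. \<bar>g z - a\<bar> \<le> b} \<in> events"
  by measurable

lemma near_mass_pos:
  assumes "A \<in> P m" "0 < prob A" shows "0 < near_mass g m A"
proof -
  have "prob A \<le> near_mass g m A" unfolding near_mass_def
  proof (rule finite_measure_mono)
    show "A \<subseteq> {z. \<bar>g z - g (rep A)\<bar> \<le> radius * \<delta> ^ m}"
    proof
      fix z assume "z \<in> A"
      hence "\<bar>g z - g (rep A)\<bar> \<le> c * \<delta> ^ m"
        using lipschitz_dist[OF g, of z "rep A"] diam[OF assms(1) _ rep_in[OF assms(1)], of z] by linarith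
      also have "\<dots> \<le> radius * \<delta> ^ m" using radius_ge delta by (intro mult_right_mono) auto
      finally show "z \<in> {z. \<bar>g z - g (rep A)\<bar> \<le> radius * \<delta> ^ m}" by simp
    qed
  qed simp
  thus ?thesis using assms by simp
qed

lemma near_mass_le_1: "near_mass g m A \<le> 1" unfolding near_mass_def by simp

lemma window_subset:
  assumes A: "A \<in> P n" and z: "z \<in> A" and q: "1 \<le> q"
    and y: "\<bar>g y - g z\<bar> \<le> (radius + 2) * \<delta> ^ (n + q)"
  shows "\<bar>g y - g (rep A)\<bar> \<le> radius * \<delta> ^ n"
proof -
  have "\<bar>g z - g (rep A)\<bar> \<le> c * \<delta> ^ n"
    using lipschitz_dist[OF g, of z "rep A"] diam[OF A z rep_in[OF A]] by linarith
  moreover have "(radius + 2) * \<delta> ^ (n + q) \<le> (radius + 2) * (\<delta> ^ n * \<delta>)"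
    unfolding power_add using radius_nonneg delta q power_decreasing[of 1 q \<delta>]
    by (intro mult_left_mono) auto
  moreover have "c * \<delta> ^ n + (radius + 2) * (\<delta> ^ n * \<delta>) \<le> radius * \<delta> ^ n"
  proof -
    have "c * \<delta> ^ n + (radius + 2) * (\<delta> ^ n * \<delta>) = (c + 2 * \<delta> + radius * \<delta>) * \<delta> ^ n" by (simp add: algebra_simps)
    also have "\<dots> \<le> (c + 2 + radius * \<delta>) * \<delta> ^ n" using delta by (intro mult_right_mono) auto
    finally show ?thesis using radius_eq by simp
  qed
  ultimately show ?thesis using y by linarith
qed

lemma near_mass_mono:
  assumes "A \<in> P n" "A' \<in> P (n + q)" "A' \<subseteq> A" "1 \<le> q"
  shows "near_mass g (n + q) A' \<le> near_mass g n A"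
  unfolding near_mass_def
proof (rule finite_measure_mono)
  show "{z. \<bar>g z - g (rep A')\<bar> \<le> radius * \<delta> ^ (n + q)} \<subseteq> {z. \<bar>g z - g (rep A)\<bar> \<le> radius * \<delta> ^ n}"
  proof (intro Collect_mono impI)
    fix z assume "\<bar>g z - g (rep A')\<bar> \<le> radius * \<delta> ^ (n + q)"
    also have "\<dots> \<le> (radius + 2) * \<delta> ^ (n + q)" using delta by (intro mult_right_mono) auto
    finally show "\<bar>g z - g (rep A)\<bar> \<le> radius * \<delta> ^ n"
      using assms rep_in[of A' "n + q"] by (intro window_subset[where z = "rep A'" and q = q]) auto
  qed
qed simp

lemma cell_at_rep_subcell:
  assumes "A \<in> P n" "A' \<in> subcells m A" "n \<le> m"
  shows "cell_at n (rep A') = A"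
  using assms rep_in[of A' m] subcellsD[OF assms(2)] by (intro cell_at_eq) auto

lemma mass_loss_bounds:
  assumes "A \<in> P n" "A' \<in> subcells (n + q) A" "1 \<le> q"
  shows "0 \<le> mass_loss g n q A'" "mass_loss g n q A' \<le> q * ln (1 / \<delta>)"
    "mass_loss g n q A' \<le> ln (near_mass g n A) - ln (near_mass g (n + q) A')"
proof -
  have "ln (near_mass g (n + q) A') \<le> ln (near_mass g n A)"
    using near_mass_mono[OF assms(1), of A' q] near_mass_pos[of A' "n + q"] assms(3) subcellsD[OF assms(2)]
    by simp
  thus "0 \<le> mass_loss g n q A'" "mass_loss g n q A' \<le> q * ln (1 / \<delta>)"
    "mass_loss g n q A' \<le> ln (near_mass g n A) - ln (near_mass g (n + q) A')"
    unfolding mass_loss_def using cell_at_rep_subcell[OF assms(1,2)] delta by auto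
qed

text \<open>
  Gibbs' inequality: the distribution \<open>p\<close> of the labels is compared with the relative masses of the
  windows around the labels. Windows of different labels overlap only boundedly often and lie in
  the window of \<open>A\<close>, so their relative masses have bounded sum.
\<close>

lemma mass_loss_entropy:
  assumes A: "A \<in> P n" "0 < prob A" and q: "1 \<le> q"
  shows "label_entropy g (n + q) A - (2 * radius + 2 * c + 6)
    \<le> (\<Sum>A'\<in>subcells (n + q) A. prob A' / prob A * mass_loss g n q A')"
proof -
  let ?m = "n + q"
  let ?S = "subcells ?m A" and ?I = "label g ?m ` subcells ?m A"
  let ?r = "\<delta> ^ ?m"
  have r: "0 < ?r" using delta by simp
  define p where "p i = (\<Sum>A'\<in>{A'\<in>?S. label g ?m A' = i}. prob A' / prob A)" for i
  define J where "J i = {z. \<bar>g z / ?r - of_int i\<bar> \<le> radius + 1}" for i :: int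
  have [measurable]: "J i \<in> sets borel" for i unfolding J_def by measurable
  define V where "V = near_mass g n A"
  have V: "0 < V" unfolding V_def using A by (rule near_mass_pos)
  \<comment> \<open>The maximum with \<open>\<delta>\<^sup>q\<close> is the truncation of the loss; the bound
    \<open>cardI\<close> below is what makes its total contribution bounded.\<close>
  define t where "t i = max (prob (J i) / V) (\<delta> ^ q)" for i
  have tpos: "0 < t i" for i unfolding t_def using delta by (simp add: less_max_iff_disj)
  have loss: "- ln (t (label g ?m A')) \<le> mass_loss g n q A'" if A': "A' \<in> ?S" for A'
  proof -
    let ?i = "label g ?m A'"
    note sub = subcellsD[OF A']
    have "near_mass g ?m A' \<le> prob (J ?i)"
      unfolding near_mass_def
    proof (rule finite_measure_mono)
      show "{z. \<bar>g z - g (rep A')\<bar> \<le> radius * ?r} \<subseteq> J ?i"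
      proof
        fix z assume "z \<in> {z. \<bar>g z - g (rep A')\<bar> \<le> radius * ?r}"
        hence "\<bar>g z / ?r - g (rep A') / ?r\<bar> \<le> radius"
          using r by (simp add: diff_divide_distrib[symmetric] abs_divide pos_divide_le_eq)
        thus "z \<in> J ?i" unfolding J_def using label_bound[of g A' ?m] by simp
      qed
    qed simp
    hence le: "near_mass g ?m A' / V \<le> prob (J ?i) / V" using V by (intro divide_right_mono) auto
    have pos: "0 < near_mass g ?m A'" using near_mass_pos[OF sub(1,3)] .
    have "- ln (t ?i) \<le> ln V - ln (near_mass g ?m A')"
    proof -
      have "near_mass g ?m A' / V \<le> t ?i" unfolding t_def using le by linarith
      hence "ln (near_mass g ?m A' / V) \<le> ln (t ?i)" using pos V by (intro ln_mono) auto
      thus ?thesis using pos V by (simp add: ln_div)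
    qed
    moreover have "- ln (t ?i) \<le> q * ln (1 / \<delta>)"
    proof -
      have "ln (\<delta> ^ q) \<le> ln (t ?i)" unfolding t_def using delta by (intro ln_mono) auto
      thus ?thesis using delta by (simp add: ln_realpow ln_div)
    qed
    ultimately show ?thesis unfolding mass_loss_def V_def using cell_at_rep_subcell[OF A(1) A'] by simp
  qed
  have finI: "finite ?I" by simp
  have cardI: "real (card ?I) * \<delta> ^ q \<le> 2 * c + 3"
  proof -
    have near: "\<bar>of_int (label g ?m A') - g (rep A) / ?r\<bar> \<le> c / \<delta> ^ q + 1" if A': "A' \<in> ?S" for A'
    proof -
      have "\<bar>g (rep A') / \<delta> ^ n - g (rep A) / \<delta> ^ n\<bar> \<le> c"
        using A A' rep_in subcellsD[OF A'] by (intro lipschitz_cell[OF g A(1)]) blast+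
      hence "\<bar>g (rep A') / \<delta> ^ n - g (rep A) / \<delta> ^ n\<bar> / \<delta> ^ q \<le> c / \<delta> ^ q"
        using delta by (intro divide_right_mono) auto
      also have "\<bar>g (rep A') / \<delta> ^ n - g (rep A) / \<delta> ^ n\<bar> / \<delta> ^ q = \<bar>(g (rep A') / \<delta> ^ n - g (rep A) / \<delta> ^ n) / \<delta> ^ q\<bar>"
        using delta by (simp add: abs_divide)
      also have "(g (rep A') / \<delta> ^ n - g (rep A) / \<delta> ^ n) / \<delta> ^ q = g (rep A') / ?r - g (rep A) / ?r"
        by (simp add: power_add diff_divide_distrib)
      finally show ?thesis using label_bound[of g A' ?m] by linarith
    qed
    have triangle: "\<bar>x - y\<bar> \<le> 2 * r" if "\<bar>x - z\<bar> \<le> r" "\<bar>y - z\<bar> \<le> r" for x y z r :: real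
      using that by linarith
    have "real (card ?I) \<le> 2 * (c / \<delta> ^ q + 1) + 1"
    proof (rule card_int_le(2))
      fix i i' assume "i \<in> ?I" "i' \<in> ?I"
      then obtain B B' where B: "B \<in> ?S" "B' \<in> ?S" and ii: "i = label g ?m B" "i' = label g ?m B'" by blast
      show "\<bar>real_of_int i - real_of_int i'\<bar> \<le> 2 * (c / \<delta> ^ q + 1)"
        unfolding ii by (rule triangle[OF near[OF B(1)] near[OF B(2)]])
    qed (use c0 delta in auto)
    hence "real (card ?I) * \<delta> ^ q \<le> (2 * (c / \<delta> ^ q + 1) + 1) * \<delta> ^ q" using delta by (intro mult_right_mono) auto
    also have "\<dots> = 2 * c + 3 * \<delta> ^ q" using delta by (simp add: field_simps)
    also have "\<dots> \<le> 2 * c + 3" using delta by (simp add: power_le_one)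
    finally show ?thesis .
  qed
  have overlap: "(\<Sum>i\<in>?I. prob (J i)) \<le> (2 * radius + 3) * V"
  proof -
    let ?Z = "{z. \<bar>g z - g (rep A)\<bar> \<le> radius * \<delta> ^ n}"
    have JZ: "J i \<subseteq> ?Z" if i: "i \<in> ?I" for i
    proof
      fix y assume y: "y \<in> J i"
      obtain A' where A': "A' \<in> ?S" "i = label g ?m A'" using i by blast
      obtain z where z: "z = rep A'" by simp
      have lab: "\<bar>g z / ?r - of_int i\<bar> \<le> 1" unfolding A'(2) z by (rule label_bound)
      have "\<bar>g y / ?r - of_int i\<bar> \<le> radius + 1" using y by (simp add: J_def)
      with lab have "\<bar>g y / ?r - g z / ?r\<bar> \<le> radius + 2" by linarith
      hence "\<bar>g y - g z\<bar> \<le> (radius + 2) * ?r"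
        using r by (simp add: diff_divide_distrib[symmetric] abs_divide pos_divide_le_eq)
      moreover have "z \<in> A" using A' z rep_in subcellsD by blast
      ultimately show "y \<in> ?Z" using window_subset[OF A(1) _ q] by simp
    qed
    have "(\<Sum>i\<in>?I. prob (J i)) = (\<integral>z. (\<Sum>i\<in>?I. indicator (J i) z) \<partial>\<mu>)"
      by (subst Bochner_Integration.integral_sum) (auto simp: emeasure_eq_measure)
    also have "\<dots> \<le> (\<integral>z. (2 * radius + 3) * indicator ?Z z \<partial>\<mu>)"
    proof (rule integral_mono)
      fix z
      show "(\<Sum>i\<in>?I. indicator (J i) z) \<le> (2 * radius + 3) * indicator ?Z z"
      proof (cases "z \<in> ?Z")
        case True
        have "(\<Sum>i\<in>?I. indicator (J i) z :: real) = real (card {i\<in>?I. z \<in> J i})"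
          using finI by (simp add: indicator_def sum.If_cases Int_def)
        also have "\<dots> \<le> 2 * (radius + 1) + 1"
          using radius_nonneg by (intro card_int_le) (auto simp: J_def)
        finally show ?thesis using True by simp
      next
        case False
        thus ?thesis using JZ by (auto simp: indicator_def intro!: sum_nonpos)
      qed
    qed (auto simp: emeasure_eq_measure intro!: Bochner_Integration.integrable_sum integrable_mult_right)
    also have "\<dots> = (2 * radius + 3) * V" unfolding V_def near_mass_def by simp
    finally show ?thesis .
  qed
  have "(\<Sum>i\<in>?I. t i) \<le> (\<Sum>i\<in>?I. prob (J i) / V + \<delta> ^ q)"
    unfolding t_def using V delta by (intro sum_mono) (auto simp: max_def)
  also have "\<dots> = (\<Sum>i\<in>?I. prob (J i)) / V + real (card ?I) * \<delta> ^ q"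
    by (simp add: sum.distrib sum_divide_distrib)
  also have "\<dots> \<le> (2 * radius + 3) + (2 * c + 3)"
    using overlap V cardI by (intro add_mono) (auto simp: pos_divide_le_eq)
  finally have sum_t: "(\<Sum>i\<in>?I. t i) \<le> 2 * radius + 2 * c + 6" by simp
  have "label_entropy g ?m A - (\<Sum>i\<in>?I. t i) = (\<Sum>i\<in>?I. eta (p i) - t i)"
    by (simp add: label_entropy_def p_def sum_subtractf)
  also have "\<dots> \<le> (\<Sum>i\<in>?I. - (p i * ln (t i)))"
    using tpos A by (intro sum_mono eta_ge) (auto simp: p_def less_imp_le intro!: sum_nonneg)
  also have "\<dots> = (\<Sum>i\<in>?I. \<Sum>A'\<in>{A'\<in>?S. label g ?m A' = i}. prob A' / prob A * (- ln (t (label g ?m A'))))"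
    by (intro sum.cong refl) (simp add: p_def sum_distrib_right sum_negf)
  also have "\<dots> = (\<Sum>A'\<in>?S. prob A' / prob A * (- ln (t (label g ?m A'))))"
    by (rule sum.image_gen[symmetric]) simp
  also have "\<dots> \<le> (\<Sum>A'\<in>?S. prob A' / prob A * mass_loss g n q A')"
    by (intro sum_mono mult_left_mono loss) auto
  finally show ?thesis using sum_t by linarith
qed

lemma window_pos:
  assumes x: "x \<in> X" "\<And>n. 0 < prob (cell_at n x)" and e: "0 < e"
  shows "0 < prob {z. \<bar>g z - g x\<bar> \<le> e}"
proof -
  have "(\<lambda>m. c * \<delta> ^ m) \<longlonglongrightarrow> c * 0"
    using delta by (intro tendsto_mult_left LIMSEQ_power_zero) auto
  hence "\<forall>\<^sub>F m in sequentially. c * \<delta> ^ m < e" using e by (intro order_tendstoD) auto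
  then obtain m where m: "c * \<delta> ^ m < e" by (auto simp: eventually_sequentially)
  have "prob (cell_at m x) \<le> prob {z. \<bar>g z - g x\<bar> \<le> e}"
  proof (rule finite_measure_mono)
    show "cell_at m x \<subseteq> {z. \<bar>g z - g x\<bar> \<le> e}"
    proof
      fix z assume "z \<in> cell_at m x"
      hence "dist z x \<le> c * \<delta> ^ m" using diam cell_at_in[OF x(1)] by blast
      thus "z \<in> {z. \<bar>g z - g x\<bar> \<le> e}" using lipschitz_dist[OF g, of z x] m by simp
    qed
  qed simp
  thus ?thesis using x(2)[of m] by linarith
qed

text \<open>
  Within each residue class of \<open>n\<close> modulo \<open>q\<close>, the losses along \<open>x\<close> between the levels \<open>n\<close> and \<open>n + q\<close>
  telescope, so their sum over \<open>n < N\<close> is at most \<open>q\<close> times the total loss up to level \<open>N + q\<close>. By the law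
  of large numbers they may be replaced by their conditional means, which are bounded below by entropies.
\<close>

lemma AE_label_entropy_le_window:
  assumes q: "1 \<le> q" and e: "0 < e"
  shows "AE x in \<mu>. \<forall>\<^sub>F N in sequentially.
     (\<Sum>n<N. label_entropy g (n + q) (cell_at n x)) - (2 * radius + 2 * c + 6 + e) * N
       \<le> - (q * ln (prob {z. \<bar>g z - g x\<bar> \<le> \<delta> ^ (N + q)}))"
proof -
  define K where "K = q * ln (1 / \<delta>)"
  define C where "C = 2 * radius + 2 * c + 6"
  define E where "E n A = (\<Sum>A'\<in>subcells (n + q) A. prob A' / prob A * mass_loss g n q A')" for n A
  define D where "D n A' = (if A' \<in> P (n + q) \<and> 0 < prob A'
      then mass_loss g n q A' - E n (cell_at n (rep A')) else 0)" for n A'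
  \<comment> \<open>The loss minus its conditional mean given the cell of level \<open>n\<close>. It is constant on cells
    of level \<open>n + q\<close>, hence orthogonal to the differences of level at least \<open>n + q\<close>.\<close>
  define d where "d n x = D n (cell_at (n + q) x)" for n x
  have K0: "0 \<le> K" unfolding K_def using delta by simp
  have sub_pos: "0 < prob A" if "A' \<in> subcells m A" "A \<in> P n" for A A' m n
  proof -
    have "prob A' \<le> prob A" using subcellsD[OF that(1)] meas_cell[OF that(2)] by (intro finite_measure_mono) auto
    thus ?thesis using subcellsD(3)[OF that(1)] by linarith
  qed
  have weights: "(\<Sum>A'\<in>subcells (n + q) A. prob A' / prob A) = 1" if "A \<in> P n" "0 < prob A" for n A
    using prob_eq_sum_subcells[OF that(1), of "n + q"] that(2) by (simp add: sum_divide_distrib[symmetric])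
  have E_bounds: "0 \<le> E n A \<and> E n A \<le> K" if A: "A \<in> P n" "0 < prob A" for n A
  proof
    show "0 \<le> E n A" unfolding E_def
      using mass_loss_bounds(1)[OF A(1) _ q] by (intro sum_nonneg mult_nonneg_nonneg) auto
    have "E n A \<le> (\<Sum>A'\<in>subcells (n + q) A. prob A' / prob A * K)" unfolding E_def K_def
      using mass_loss_bounds(2)[OF A(1) _ q] by (intro sum_mono mult_left_mono) auto
    also have "\<dots> = K" unfolding sum_distrib_right[symmetric] using weights[OF A] by simp
    finally show "E n A \<le> K" .
  qed
  have D_sub: "D n A' = mass_loss g n q A' - E n A" if "A \<in> P n" "A' \<in> subcells (n + q) A" for n A A'
    unfolding D_def using that subcellsD[OF that(2)] cell_at_rep_subcell[OF that] by simp
  have D_bound: "\<bar>D n A'\<bar> \<le> K" for n A'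
  proof (cases "A' \<in> P (n + q) \<and> 0 < prob A'")
    case True
    then obtain A where A: "A \<in> P n" "A' \<subseteq> A" using ex_ancestor[of A' "n + q" n] by auto
    hence A': "A' \<in> subcells (n + q) A" using True by (simp add: subcells_def)
    show ?thesis unfolding D_sub[OF A(1) A']
      using mass_loss_bounds(1,2)[OF A(1) A' q] E_bounds[OF A(1) sub_pos[OF A' A(1)]] unfolding K_def by linarith
  next
    case False thus ?thesis using K0 unfolding D_def by auto
  qed
  have D_mean: "(\<Sum>A'\<in>subcells (m + q) A. prob A' * D m A') = 0" if A: "A \<in> P m" for m A
  proof (cases "0 < prob A")
    case True
    have "(\<Sum>A'\<in>subcells (m + q) A. prob A' * D m A')
       = (\<Sum>A'\<in>subcells (m + q) A. prob A * (prob A' / prob A * mass_loss g m q A') - prob A' * E m A)"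
      using True by (intro sum.cong refl) (simp add: D_sub[OF A] right_diff_distrib)
    also have "\<dots> = prob A * E m A - prob A * E m A"
      using prob_eq_sum_subcells[OF A, of "m + q"]
      by (simp only: sum_subtractf sum_distrib_left[symmetric] sum_distrib_right[symmetric] E_def[symmetric])
    finally show ?thesis by simp
  next
    case False
    hence "subcells (m + q) A = {}" using sub_pos[OF _ A] by blast
    thus ?thesis by simp
  qed
  have orth: "expectation (\<lambda>x. d n x * d m x) = 0" if nm: "n + q \<le> m" for n m
  proof -
    define G where "G A' = D n (cell_at (n + q) (rep A')) * D m A'" for A'
    have "expectation (\<lambda>x. d n x * d m x) = expectation (\<lambda>x. G (cell_at (m + q) x))"
    proof (rule integral_cong_AE)
      show "AE x in \<mu>. d n x * d m x = G (cell_at (m + q) x)"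
        using carried
      proof eventually_elim
        case (elim x)
        have "rep (cell_at (m + q) x) \<in> cell_at (n + q) x"
          using rep_in[OF cell_at_in(1)[OF elim]] cell_at_mono[OF elim, of "n + q" "m + q"] nm by auto
        hence "cell_at (n + q) (rep (cell_at (m + q) x)) = cell_at (n + q) x"
          using cell_at_in(1)[OF elim] by (intro cell_at_eq)
        thus ?case by (simp add: d_def G_def)
      qed
    qed (auto simp: d_def intro!: measurable_at borel_measurable_times)
    also have "\<dots> = (\<Sum>A'\<in>P (m + q). prob A' * G A')" by (rule integral_at)
    also have "\<dots> = (\<Sum>A\<in>P m. \<Sum>A'\<in>subcells (m + q) A. prob A' * G A')"
      by (rule sum_cells_eq_sum_subcells) simp
    also have "\<dots> = 0"
    proof (rule sum.neutral, rule ballI)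
      fix A assume A: "A \<in> P m"
      have "G A' = D n (cell_at (n + q) (rep A)) * D m A'" if A': "A' \<in> subcells (m + q) A" for A'
      proof -
        have "rep A' \<in> cell_at (n + q) (rep A)"
          using rep_in[OF subcellsD(1)[OF A']] subcellsD(2)[OF A'] cell_at_rep[OF A nm] by blast
        hence "cell_at (n + q) (rep A') = cell_at (n + q) (rep A)"
          using cell_at_rep[OF A nm] by (intro cell_at_eq) auto
        thus ?thesis by (simp add: G_def)
      qed
      hence "(\<Sum>A'\<in>subcells (m + q) A. prob A' * G A')
          = D n (cell_at (n + q) (rep A)) * (\<Sum>A'\<in>subcells (m + q) A. prob A' * D m A')"
        by (simp add: sum_distrib_left mult.left_commute)
      thus "(\<Sum>A'\<in>subcells (m + q) A. prob A' * G A') = 0" using D_mean[OF A] by simp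
    qed
    finally show ?thesis .
  qed
  have "AE x in \<mu>. (\<lambda>N. (\<Sum>n<N. d n x) / N) \<longlonglongrightarrow> 0"
  proof (rule averages_to_zero[of d K q])
    show "random_variable borel (d n)" for n unfolding d_def by (rule measurable_at)
    show "\<bar>d n x\<bar> \<le> K" for n x unfolding d_def by (rule D_bound)
  qed (rule orth)
  with AE_pos show ?thesis
  proof eventually_elim
    case (elim x)
    hence x: "x \<in> X" and pos: "\<And>n. 0 < prob (cell_at n x)" by auto
    note at = cell_at_in[OF x]
    have sub: "cell_at (n + k) x \<in> subcells (n + k) (cell_at n x)" for n k
      unfolding subcells_def using at pos cell_at_mono[OF x, of n "n + k"] by simp
    define Y where "Y n = - ln (near_mass g n (cell_at n x))" for n
    have Y0: "0 \<le> Y n" for n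
      unfolding Y_def using near_mass_pos[OF at(1) pos] near_mass_le_1[of n] by simp
    have Ymono: "Y n \<le> Y (n + k)" for n k
    proof (cases "k = 0")
      case False
      have "near_mass g (n + k) (cell_at (n + k) x) \<le> near_mass g n (cell_at n x)"
        using False cell_at_mono[OF x, of n "n + k"] by (intro near_mass_mono at) auto
      thus ?thesis unfolding Y_def using near_mass_pos[OF at(1) pos] by simp
    qed simp
    have telescope: "(\<Sum>n<N. Y (n + q) - Y n) = (\<Sum>k<q. Y (N + k)) - (\<Sum>k<q. Y k)" for N
    proof (induction N)
      case (Suc N)
      have "(\<Sum>k<q. Y (Suc N + k)) + Y N = (\<Sum>k<q. Y (N + k)) + Y (N + q)"
        using sum.lessThan_Suc_shift[of "\<lambda>k. Y (N + k)" q] by simp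
      thus ?case using Suc.IH by simp
    qed simp
    have loss_le: "(\<Sum>n<N. mass_loss g n q (cell_at (n + q) x)) \<le> q * Y (N + q)" for N
    proof -
      have "(\<Sum>n<N. mass_loss g n q (cell_at (n + q) x)) \<le> (\<Sum>n<N. Y (n + q) - Y n)"
        using mass_loss_bounds(3)[OF at(1) sub q] by (intro sum_mono) (auto simp: Y_def)
      also have "\<dots> \<le> (\<Sum>k<q. Y (N + k))" unfolding telescope using Y0 by (simp add: sum_nonneg)
      also have "\<dots> \<le> (\<Sum>k<q. Y (N + q))"
      proof (rule sum_mono)
        fix k assume "k \<in> {..<q}"
        thus "Y (N + k) \<le> Y (N + q)" using Ymono[of "N + k" "q - k"] by simp
      qed
      finally show ?thesis by simp
    qed
    have loss_ge: "label_entropy g (n + q) (cell_at n x) - C + d n x \<le> mass_loss g n q (cell_at (n + q) x)" for n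
      using mass_loss_entropy[OF at(1) pos q, of n] D_sub[OF at(1) sub, of n]
      unfolding E_def[symmetric] C_def d_def by simp
    have Y_le: "Y (N + q) \<le> - ln (prob {z. \<bar>g z - g x\<bar> \<le> \<delta> ^ (N + q)})" for N
    proof -
      have "prob {z. \<bar>g z - g x\<bar> \<le> \<delta> ^ (N + q)} \<le> near_mass g (N + q) (cell_at (N + q) x)"
        unfolding near_mass_def
      proof (rule finite_measure_mono)
        show "{z. \<bar>g z - g x\<bar> \<le> \<delta> ^ (N + q)}
            \<subseteq> {z. \<bar>g z - g (rep (cell_at (N + q) x))\<bar> \<le> radius * \<delta> ^ (N + q)}"
        proof (intro Collect_mono impI)
          fix z assume z: "\<bar>g z - g x\<bar> \<le> \<delta> ^ (N + q)"
          have "\<bar>g x - g (rep (cell_at (N + q) x))\<bar> \<le> c * \<delta> ^ (N + q)"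
            using lipschitz_dist[OF g] diam[OF at(1) at(2) rep_in[OF at(1)]] order_trans by blast
          moreover have "(c + 1) * \<delta> ^ (N + q) \<le> radius * \<delta> ^ (N + q)"
            using radius_ge delta by (intro mult_right_mono) auto
          ultimately show "\<bar>g z - g (rep (cell_at (N + q) x))\<bar> \<le> radius * \<delta> ^ (N + q)"
            using z by (simp add: algebra_simps)
        qed
      qed simp
      moreover have "0 < prob {z. \<bar>g z - g x\<bar> \<le> \<delta> ^ (N + q)}"
        using delta by (intro window_pos x pos) auto
      ultimately show ?thesis unfolding Y_def by simp
    qed
    have "\<forall>\<^sub>F N in sequentially. \<bar>(\<Sum>n<N. d n x) / N\<bar> < e"
    proof -
      have "(\<lambda>N. (\<Sum>n<N. d n x) / N) \<longlonglongrightarrow> 0" using elim by simp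
      from tendstoD[OF this e] show ?thesis by (simp only: dist_real_def diff_0_right)
    qed
    with eventually_gt_at_top[of 0] show ?case
    proof eventually_elim
      case (elim N)
      have "\<bar>\<Sum>n<N. d n x\<bar> \<le> e * N" using elim by (simp add: abs_divide pos_divide_less_eq)
      moreover have "(\<Sum>n<N. label_entropy g (n + q) (cell_at n x) - C + d n x) \<le> q * Y (N + q)"
        by (rule order_trans[OF sum_mono[OF loss_ge] loss_le])
      moreover have "q * Y (N + q) \<le> q * (- ln (prob {z. \<bar>g z - g x\<bar> \<le> \<delta> ^ (N + q)}))"
        by (rule mult_left_mono[OF Y_le]) simp
      ultimately show ?case
        unfolding C_def[symmetric] by (simp add: sum.distrib sum_subtractf algebra_simps)
    qed
  qed
qed

end

end

section \<open>Regular partitions into boxes\<close>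

lemma finite_of_disjoint_balls:
  fixes \<A> :: "'a::heine_borel set set"
  assumes disj: "disjoint \<A>" and balls: "\<And>A. A \<in> \<A> \<Longrightarrow> \<exists>x. ball x r \<subseteq> A" and r: "0 < r"
    and bounded: "bounded (\<Union>\<A>)"
  shows "finite \<A>"
proof -
  obtain z where z: "\<And>A. A \<in> \<A> \<Longrightarrow> ball (z A) r \<subseteq> A" using balls by metis
  have zA: "z A \<in> A" if "A \<in> \<A>" for A using z[OF that] r by auto
  have sep: "A = A'" if "A \<in> \<A>" "A' \<in> \<A>" "dist (z A) (z A') < r" for A A'
  proof -
    have "z A' \<in> A" using z[OF that(1)] that(3) by (auto simp: mem_ball)
    thus ?thesis using zA[OF that(2)] disj that(1,2) unfolding disjoint_def by blast
  qed
  have "uniform_discrete (z ` \<A>)" unfolding uniform_discrete_def using sep r by blast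
  moreover have "bounded (z ` \<A>)" using bounded by (rule bounded_subset) (use zA in blast)
  ultimately have "finite (z ` \<A>)" using uniform_discrete_finite_iff by blast
  moreover have "inj_on z \<A>" using sep r by (intro inj_onI) auto
  ultimately show ?thesis by (rule finite_imageD)
qed

lemma lexmin_in_compact:
  assumes "compact S" "S \<noteq> {}"
  shows "lexmin S \<in> S"
proof -
  have cont: "continuous_on T (\<lambda>x::real^2. x $ i)" for T i
    by (intro linear_continuous_on bounded_linear_vec_nth)
  obtain a where a: "a \<in> S" "\<And>x. x \<in> S \<Longrightarrow> a $ 1 \<le> x $ 1"
    using continuous_attains_inf[OF assms cont[of S 1]] by blast
  have "closed {x :: real^2. x $ 1 = a $ 1}" by (intro closed_Collect_eq cont continuous_on_const)
  hence "compact (S \<inter> {x. x $ 1 = a $ 1})" using assms by (intro compact_Int_closed)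
  then obtain p where p: "p \<in> S \<inter> {x. x $ 1 = a $ 1}" "\<And>x. x \<in> S \<inter> {x. x $ 1 = a $ 1} \<Longrightarrow> p $ 2 \<le> x $ 2"
    using continuous_attains_inf[OF _ _ cont[of "S \<inter> {x. x $ 1 = a $ 1}" 2]] a(1) by blast
  have min: "p \<in> S \<and> (\<forall>x\<in>S. p $ 1 < x $ 1 \<or> p $ 1 = x $ 1 \<and> p $ 2 \<le> x $ 2)"
  proof (intro conjI ballI)
    fix x assume x: "x \<in> S"
    show "p $ 1 < x $ 1 \<or> p $ 1 = x $ 1 \<and> p $ 2 \<le> x $ 2"
    proof (cases "x $ 1 = a $ 1")
      case True
      thus ?thesis using p x by auto
    next
      case False
      thus ?thesis using p(1) a(2)[OF x] by auto
    qed
  qed (use p in auto)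
  have "lexmin S = p"
    unfolding lexmin_def
  proof (rule the_equality)
    show "p \<in> S \<and> (\<forall>x\<in>S. p $ 1 < x $ 1 \<or> p $ 1 = x $ 1 \<and> p $ 2 \<le> x $ 2)" by (rule min)
    fix p' assume p': "p' \<in> S \<and> (\<forall>x\<in>S. p' $ 1 < x $ 1 \<or> p' $ 1 = x $ 1 \<and> p' $ 2 \<le> x $ 2)"
    have "p $ 1 < p' $ 1 \<or> p $ 1 = p' $ 1 \<and> p $ 2 \<le> p' $ 2"
      "p' $ 1 < p $ 1 \<or> p' $ 1 = p $ 1 \<and> p' $ 2 \<le> p $ 2" using min p' by blast+
    hence "p' $ 1 = p $ 1" "p' $ 2 = p $ 2" by linarith+
    thus "p' = p" by (simp add: vec_eq_iff forall_2)
  qed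
  thus ?thesis using min by simp
qed

lemma is_box_borel: assumes "is_box B" shows "B \<in> sets borel"
proof -
  obtain I :: "2 \<Rightarrow> real set" where *: "\<forall>i. is_interval (I i) \<and> bounded (I i) \<and> interior (I i) \<noteq> {}"
    and I2: "B = {x. \<forall>i. x $ i \<in> I i}"
    using assms unfolding is_box_def by (elim exE conjE) (rule that)
  have I: "is_interval (I i)" for i using * by simp
  have [measurable]: "I i \<in> sets borel" for i using I by (rule real_interval_borel_measurable)
  have "B = (\<Inter>i. (\<lambda>x. x $ i) -` I i \<inter> space borel)" using I2 by auto
  also have "\<dots> \<in> sets borel"
  proof (rule sets.finite_INT)
    show "(\<lambda>x::real^2. x $ i) -` I i \<inter> space borel \<in> sets borel" for i
      by (rule measurable_sets[of _ borel borel]) auto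
  qed auto
  finally show ?thesis .
qed

lemma is_box_nonempty: assumes "is_box B" shows "B \<noteq> {}"
proof -
  obtain I :: "2 \<Rightarrow> real set" where *: "\<forall>i. is_interval (I i) \<and> bounded (I i) \<and> interior (I i) \<noteq> {}"
    and I2: "B = {x. \<forall>i. x $ i \<in> I i}"
    using assms unfolding is_box_def by (elim exE conjE) (rule that)
  have "I i \<noteq> {}" for i using * interior_empty by metis
  hence "(SOME a. a \<in> I i) \<in> I i" for i by (simp add: some_in_eq)
  hence "(\<chi> i. SOME a. a \<in> I i) \<in> B" using I2 by simp
  thus ?thesis by blast
qed

lemma iterate_partition_properties:
  assumes "box_collection \<E>" "partition_operator \<E> \<Delta>" "B \<in> \<E>"
  shows "iterate_partition \<Delta> n B \<subseteq> \<E>" "partition_on B (iterate_partition \<Delta> n B)"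
proof -
  have *: "iterate_partition \<Delta> n B \<subseteq> \<E> \<and> partition_on B (iterate_partition \<Delta> n B)"
  proof (induction n)
    case 0
    have "B \<noteq> {}" using assms(1,3) is_box_nonempty unfolding box_collection_def by blast
    thus ?case using assms by (auto simp: partition_on_def disjoint_def)
  next
    case (Suc n)
    have D: "\<And>A. A \<in> iterate_partition \<Delta> n B \<Longrightarrow> \<Delta> A \<subseteq> \<E> \<and> partition_on A (\<Delta> A)"
      using assms(2) Suc unfolding partition_operator_def by blast
    have 1: "iterate_partition \<Delta> (Suc n) B \<subseteq> \<E>" using D by auto
    have "partition_on B (\<Union>A\<in>iterate_partition \<Delta> n B. \<Delta> A)"
    proof (rule partition_onI)
      show "\<Union>(\<Union>A\<in>iterate_partition \<Delta> n B. \<Delta> A) = B"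
      proof -
        have "\<Union>(\<Union>A\<in>iterate_partition \<Delta> n B. \<Delta> A) = (\<Union>A\<in>iterate_partition \<Delta> n B. \<Union>(\<Delta> A))" by blast
        also have "\<dots> = (\<Union>A\<in>iterate_partition \<Delta> n B. A)"
          by (intro SUP_cong refl partition_onD1[symmetric] D[THEN conjunct2])
        also have "\<dots> = B" using Suc partition_onD1[of B "iterate_partition \<Delta> n B"] by simp
        finally show ?thesis .
      qed
    next
      fix p q assume pq: "p \<in> (\<Union>A\<in>iterate_partition \<Delta> n B. \<Delta> A)" "q \<in> (\<Union>A\<in>iterate_partition \<Delta> n B. \<Delta> A)" "p \<noteq> q"
      then obtain A A' where A: "A \<in> iterate_partition \<Delta> n B" "p \<in> \<Delta> A" "A' \<in> iterate_partition \<Delta> n B" "q \<in> \<Delta> A'" by blast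
      have sub: "p \<subseteq> A" "q \<subseteq> A'"
        using partition_onD1[OF D[OF A(1), THEN conjunct2]] partition_onD1[OF D[OF A(3), THEN conjunct2]] A(2,4) by blast+
      show "disjnt p q"
      proof (cases "A = A'")
        case True
        thus ?thesis using partition_onD2[OF D[OF A(1), THEN conjunct2]] A(2,4) pq(3)
          unfolding disjoint_def disjnt_def by blast
      next
        case False
        hence "A \<inter> A' = {}" using partition_onD2[OF Suc[THEN conjunct2]] A(1,3) unfolding disjoint_def by blast
        thus ?thesis using sub unfolding disjnt_def by blast
      qed
    next
      show "{} \<notin> (\<Union>A\<in>iterate_partition \<Delta> n B. \<Delta> A)" using partition_onD3[OF D[THEN conjunct2]] by blast
    qed
    thus ?case using 1 by simp
  qed
  thus "iterate_partition \<Delta> n B \<subseteq> \<E>" "partition_on B (iterate_partition \<Delta> n B)" by auto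
qed

text \<open>
  The consequences of regularity and generation on which all later estimates rest. The bounds are
  uniform over the cells of all levels, because all of them descend from one box.
\<close>

locale generating_cells = cell_tree \<mu> P X \<delta> c
  for \<mu> :: "(real^2) measure" and P X \<delta> c +
  fixes \<sigma>\<^sub>1 \<sigma>\<^sub>2 \<rho> :: real and \<Theta> :: "(real^2) measure measure"
  assumes lam: "0 < \<sigma>\<^sub>1"
    and scale: "A \<in> P n \<Longrightarrow> \<sigma>\<^sub>1 / \<delta> ^ n \<le> measure lborel A powr (- 1 / 2) \<and> measure lborel A powr (- 1 / 2) \<le> \<sigma>\<^sub>2 / \<delta> ^ n"
    and normalized: "A \<in> P n \<Longrightarrow> z \<in> A \<Longrightarrow> norm (box_map A z) \<le> \<rho>"
    and generating: "AE x in \<mu>. limitin (weak_topology (weak_topology euclidean))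
        (empirical (weak_topology euclidean) (\<lambda>k. magnify \<mu> (cell_at k x))) \<Theta> sequentially"

text \<open>
  A cell of level \<open>k\<close> contains a ball of radius \<open>\<delta>\<^sup>k / c\<close> and is contained in one of radius \<open>c \<delta>\<^sup>k\<close>, with \<open>c\<close>
  depending only on the initial box. The two radii control volume and diameter, hence
  the magnifying factor, and the inner balls bound the number of cells of each level.
\<close>

lemma generates_imp_generating_cells:
  assumes "box_collection \<E>" "partition_operator \<E> \<Delta>" "regular_partition \<E> \<Delta> \<delta>" "generates \<E> \<Delta> B \<mu> Q"
  shows "\<exists>c \<sigma>\<^sub>1 \<sigma>\<^sub>2 \<rho>. generating_cells \<mu> (\<lambda>n. iterate_partition \<Delta> n (box_norm B)) (box_norm B) \<delta> c \<sigma>\<^sub>1 \<sigma>\<^sub>2 \<rho> (measure_component Q)"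
proof -
  define B0 where "B0 = box_norm B"
  define P where "P n = iterate_partition \<Delta> n B0" for n
  have d: "0 < \<delta>" "\<delta> < 1" using assms(3) by (auto simp: regular_partition_def)
  have B: "B \<in> \<E>" "\<mu> \<in> prob_on B0" using assms(4) by (auto simp: generates_def B0_def)
  define u where "u = measure lborel (ball (0 :: real^2) 1)"
  have u: "0 < u" unfolding u_def by (rule content_ball_pos) simp
  have vol: "u * r\<^sup>2 \<le> measure lborel A \<and> measure lborel A \<le> u * R\<^sup>2"
    if "ball x r \<subseteq> A" "A \<subseteq> ball y R" "0 < r" "0 < R" "A \<in> sets borel" for x y r R and A :: "(real^2) set"
  proof
    have b: "measure lborel (ball z s) = u * s\<^sup>2" if "0 < s" for z :: "real^2" and s
      using content_ball_conv_unit_ball[of s z] that by (simp add: u_def mult.commute)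
    have fb: "ball y R \<in> fmeasurable lborel"
      using emeasure_lborel_ball_finite[of y R] by (intro fmeasurableI) auto
    have f: "A \<in> fmeasurable lborel"
      using that by (intro fmeasurableI2[OF fb]) auto
    show "u * r\<^sup>2 \<le> measure lborel A" using measure_mono_fmeasurable[OF that(1) _ f] b[OF that(3)] by simp
    have "measure lborel A \<le> measure lborel (ball y R)"
      using that by (intro measure_mono_fmeasurable fb) auto
    thus "measure lborel A \<le> u * R\<^sup>2" using b[OF that(4)] by simp
  qed
  have borel: "A \<in> sets borel" if "A \<in> \<E>" for A
    using assms(1) that is_box_borel unfolding box_collection_def by blast
  have B0: "B0 \<in> \<E>"
  proof -
    obtain c where c: "1 < c" and "\<And>k A. A \<in> iterate_partition \<Delta> k B \<Longrightarrow>
        (\<exists>x. ball x (\<delta> ^ k / c) \<subseteq> A) \<and> (\<exists>y. A \<subseteq> ball y (c * \<delta> ^ k))"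
      using assms(3) B(1) unfolding regular_partition_def by meson
    from this(2)[of B 0] obtain x y where "ball x (1 / c) \<subseteq> B" "B \<subseteq> ball y c" by auto
    from vol[OF this _ _ borel[OF B(1)]] c have "u * (1 / c)\<^sup>2 \<le> measure lborel B" by simp
    moreover have "0 < u * (1 / c)\<^sup>2" using u c by simp
    ultimately have "0 < measure lborel B" by linarith
    hence s: "0 < measure lborel B powr (- 1 / 2)" by simp
    have "B0 = homothety (measure lborel B powr (- 1 / 2)) (- (measure lborel B powr (- 1 / 2) *\<^sub>R lexmin (closure B))) ` B"
      unfolding B0_def box_norm_def by (intro image_cong) (auto simp: box_map_def homothety_def scaleR_diff_right)
    thus ?thesis using assms(1) B(1) s unfolding box_collection_def by auto
  qed
  note PP = iterate_partition_properties[OF assms(1,2) B0, folded P_def]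
  obtain c where c: "1 < c" and reg: "\<And>k A. A \<in> P k \<Longrightarrow>
        (\<exists>x. ball x (\<delta> ^ k / c) \<subseteq> A) \<and> (\<exists>y. A \<subseteq> ball y (c * \<delta> ^ k))"
    using assms(3) B0 unfolding regular_partition_def P_def by meson
  have Pborel: "A \<in> sets borel" if "A \<in> P n" for A n using PP(1) that borel by blast
  have B0_eq: "P 0 = {B0}" by (simp add: P_def)
  have diam: "dist x y \<le> 2 * c * \<delta> ^ n" if A: "A \<in> P n" and xy: "x \<in> closure A" "y \<in> closure A" for A n x y
  proof -
    obtain z where z: "A \<subseteq> ball z (c * \<delta> ^ n)" using reg[OF A] by blast
    have "closure A \<subseteq> cball z (c * \<delta> ^ n)" using z by (intro closure_minimal) auto
    hence "dist z x \<le> c * \<delta> ^ n" "dist z y \<le> c * \<delta> ^ n" using xy by auto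
    thus ?thesis using dist_triangle2[of x y z] by (simp add: dist_commute)
  qed
  define \<sigma>\<^sub>1 where "\<sigma>\<^sub>1 = 1 / (sqrt u * c)"
  define \<sigma>\<^sub>2 where "\<sigma>\<^sub>2 = c / sqrt u"
  have lam: "0 < \<sigma>\<^sub>1" "0 < \<sigma>\<^sub>2" using u c by (auto simp: \<sigma>\<^sub>1_def \<sigma>\<^sub>2_def)
  have scale: "\<sigma>\<^sub>1 / \<delta> ^ n \<le> measure lborel A powr (- 1 / 2) \<and> measure lborel A powr (- 1 / 2) \<le> \<sigma>\<^sub>2 / \<delta> ^ n"
    if A: "A \<in> P n" for A n
  proof -
    define a where "a = measure lborel A"
    obtain x y where xy: "ball x (\<delta> ^ n / c) \<subseteq> A" "A \<subseteq> ball y (c * \<delta> ^ n)" using reg[OF A] by blast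
    have v: "u * (\<delta> ^ n / c)\<^sup>2 \<le> a" "a \<le> u * (c * \<delta> ^ n)\<^sup>2"
      using vol[OF xy _ _ Pborel[OF A]] d c unfolding a_def by auto
    have low: "0 < u * (\<delta> ^ n / c)\<^sup>2" using u d c by simp
    hence a: "0 < a" using v by linarith
    have "sqrt (u * (\<delta> ^ n / c)\<^sup>2) \<le> sqrt a" "sqrt a \<le> sqrt (u * (c * \<delta> ^ n)\<^sup>2)" using v by auto
    moreover have "sqrt (u * (\<delta> ^ n / c)\<^sup>2) = sqrt u * (\<delta> ^ n / c)" "sqrt (u * (c * \<delta> ^ n)\<^sup>2) = sqrt u * (c * \<delta> ^ n)"
      using d c by (simp_all add: real_sqrt_mult)
    ultimately have s: "sqrt u * (\<delta> ^ n / c) \<le> sqrt a" "sqrt a \<le> sqrt u * (c * \<delta> ^ n)" by auto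
    have e: "a powr (- 1 / 2) = 1 / sqrt a"
    proof -
      have "- 1 / 2 = - (1 / 2 :: real)" by simp
      hence "a powr (- 1 / 2) = inverse (a powr (1 / 2))" using powr_minus[of a "1 / 2"] by presburger
      also have "a powr (1 / 2) = sqrt a" using a by (intro powr_half_sqrt) simp
      finally show ?thesis by (simp only: inverse_eq_divide)
    qed
    have pos: "0 < sqrt u * (\<delta> ^ n / c)" "0 < sqrt a" using u d c a by auto
    have "1 / (sqrt u * (c * \<delta> ^ n)) \<le> 1 / sqrt a" using s pos by (intro divide_left_mono) auto
    moreover have "1 / sqrt a \<le> 1 / (sqrt u * (\<delta> ^ n / c))"
      using s(1) by (intro divide_left_mono mult_pos_pos[OF pos(2,1)]) auto
    moreover have "1 / (sqrt u * (c * \<delta> ^ n)) = \<sigma>\<^sub>1 / \<delta> ^ n" "1 / (sqrt u * (\<delta> ^ n / c)) = \<sigma>\<^sub>2 / \<delta> ^ n"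
      unfolding \<sigma>\<^sub>1_def \<sigma>\<^sub>2_def by simp_all
    ultimately show ?thesis unfolding a_def[symmetric] e by simp
  qed
  have norm: "norm (box_map A z) \<le> \<sigma>\<^sub>2 * (2 * c)" if A: "A \<in> P n" and z: "z \<in> A" for A n z
  proof -
    have "bounded A" using reg[OF A] bounded_ball bounded_subset by blast
    hence "lexmin (closure A) \<in> closure A"
      using z by (intro lexmin_in_compact) (auto simp: compact_closure)
    hence "norm (z - lexmin (closure A)) \<le> 2 * c * \<delta> ^ n"
      using diam[OF A, of z] z closure_subset[of A] by (auto simp: dist_norm)
    hence "measure lborel A powr (- 1 / 2) * norm (z - lexmin (closure A)) \<le> \<sigma>\<^sub>2 / \<delta> ^ n * (2 * c * \<delta> ^ n)"
      using scale[OF A] lam d by (intro mult_mono) auto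
    thus ?thesis using d by (simp add: box_map_def)
  qed
  have "prob_space \<mu>" "sets \<mu> = sets borel" "emeasure \<mu> B0 = 1"
    using B(2) by (auto simp: prob_on_def prob_measures_def borel_of_euclidean)
  then interpret prob_space \<mu> by simp
  interpret T: cell_tree \<mu> P B0 \<delta> "2 * c"
  proof
    show "sets \<mu> = sets borel" by fact
    show "finite (P n)" for n
    proof (rule finite_of_disjoint_balls)
      show "disjoint (P n)" using PP(2)[of n] by (simp add: partition_on_def)
      show "\<exists>x. ball x (\<delta> ^ n / c) \<subseteq> A" if "A \<in> P n" for A using reg[OF that] by blast
      have "\<Union>(P n) = B0" using PP(2)[of n] by (simp add: partition_on_def)
      thus "bounded (\<Union>(P n))" using reg[of B0 0] bounded_ball bounded_subset by (auto simp: B0_eq)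
    qed (use d c in auto)
    show "partition_on B0 (P n)" for n by (rule PP(2))
    show "\<exists>A'\<in>P n. A \<subseteq> A'" if A: "A \<in> P (Suc n)" for A n
    proof -
      obtain A' where "A' \<in> P n" "A \<in> \<Delta> A'" using A by (auto simp: P_def)
      moreover from this have "partition_on A' (\<Delta> A')"
        using assms(2) PP(1)[of n] unfolding partition_operator_def by blast
      ultimately show ?thesis by (auto simp: partition_on_def)
    qed
    show "A \<in> sets borel" if "A \<in> P n" for A n using Pborel[OF that] .
    show "dist x y \<le> 2 * c * \<delta> ^ n" if "A \<in> P n" "x \<in> A" "y \<in> A" for A n x y
      using diam[OF that(1)] that closure_subset by blast
    have "prob B0 = 1" using \<open>emeasure \<mu> B0 = 1\<close> by (simp add: measure_def)
    thus "AE x in \<mu>. x \<in> B0" using Pborel[of B0 0] \<open>sets \<mu> = sets borel\<close>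
      by (intro AE_prob_1) simp
  qed (use d c in auto)
  have cell: "cell \<Delta> k B0 x = T.cell_at k x" for k x
    by (simp add: cell_def T.cell_at_def P_def)
  have "generating_cells \<mu> P B0 \<delta> (2 * c) \<sigma>\<^sub>1 \<sigma>\<^sub>2 (\<sigma>\<^sub>2 * (2 * c)) (measure_component Q)"
  proof
    show "AE x in \<mu>. limitin (weak_topology (weak_topology euclidean))
        (empirical (weak_topology euclidean) (\<lambda>k. magnify \<mu> (T.cell_at k x))) (measure_component Q) sequentially"
      using assms(4) unfolding generates_def B0_def[symmetric] cell by blast
  qed (use lam scale norm in auto)
  thus ?thesis unfolding P_def B0_def by blast
qed

section \<open>Entropy of the generated distribution\<close>

context generating_cells
begin

definition grid :: "nat \<Rightarrow> nat" where
  "grid q = nat \<lceil>\<rho> / \<delta> ^ q\<rceil>"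

text \<open>
  The number of hat functions is such that they form a partition of unity on the projections of all
  magnified cells.
\<close>

definition grid_entropy :: "real^2 \<Rightarrow> nat \<Rightarrow> (real^2) measure \<Rightarrow> real" where
  "grid_entropy e q = projected_entropy e (\<delta> ^ q) (grid q)"

text \<open>
  Up to a bounded error this is \<open>q ln (1 / \<delta>) E\<^sub>q(\<pi>)\<close> for the projection \<open>\<pi>\<close> in direction \<open>e\<close>.
\<close>

definition limit_entropy :: "real^2 \<Rightarrow> nat \<Rightarrow> real" where
  "limit_entropy e q = (\<integral>\<nu>. grid_entropy e q \<nu> \<partial>\<Theta>)"

definition distortion :: real where
  "distortion = 2 * \<sigma>\<^sub>2 + 1 / \<sigma>\<^sub>1 + 2"

definition comparison_error :: real where
  "comparison_error = (2 * c + 3) * (distortion + 1) + 3"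

lemma grid_ge: "\<rho> \<le> grid q * \<delta> ^ q"
proof -
  have "\<rho> / \<delta> ^ q \<le> grid q" unfolding grid_def by (rule real_nat_ceiling_ge)
  thus ?thesis using delta by (simp add: pos_divide_le_eq)
qed

lemma measurable_box_map [measurable]: "box_map A \<in> borel \<rightarrow>\<^sub>M borel"
  unfolding box_map_def [abs_def] by measurable

lemma magnify_prob:
  assumes "0 < prob A"
  shows "magnify \<mu> A \<in> prob_measures euclidean"
proof -
  have "prob_space (uniform_measure \<mu> A)"
    using assms by (intro prob_space_uniform_measure) (auto simp: emeasure_eq_measure)
  moreover have "box_map A \<in> uniform_measure \<mu> A \<rightarrow>\<^sub>M borel"
    by (subst measurable_cong_sets[of _ borel]) auto
  ultimately show ?thesis
    unfolding prob_measures_def magnify_def borel_of_euclidean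
    by (auto intro: prob_space.prob_space_distr)
qed

lemma integral_magnify:
  fixes f :: "real^2 \<Rightarrow> real"
  assumes [measurable]: "A \<in> sets borel" "f \<in> borel_measurable borel" and A: "0 < prob A"
  shows "(\<integral>z. f z \<partial>magnify \<mu> A) = (\<integral>z. indicator A z * f (box_map A z) \<partial>\<mu>) / prob A"
proof -
  have "uniform_measure \<mu> A = density \<mu> (\<lambda>x. ennreal (indicator A x / prob A))"
    unfolding uniform_measure_def
  proof (rule density_cong)
    show "AE x in \<mu>. indicator A x / emeasure \<mu> A = ennreal (indicator A x / prob A)"
      using A by (auto simp: indicator_def emeasure_eq_measure divide_ennreal[symmetric] simp del: divide_ennreal)
  qed auto
  moreover have "box_map A \<in> uniform_measure \<mu> A \<rightarrow>\<^sub>M borel"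
    by (subst measurable_cong_sets[of _ borel]) auto
  ultimately have "(\<integral>z. f z \<partial>magnify \<mu> A)
      = (\<integral>z. f (box_map A z) \<partial>density \<mu> (\<lambda>x. ennreal (indicator A x / prob A)))"
    unfolding magnify_def by (subst integral_distr) auto
  also have "\<dots> = (\<integral>z. (indicator A z / prob A) *\<^sub>R f (box_map A z) \<partial>\<mu>)"
    by (rule integral_density) auto
  also have "\<dots> = (\<integral>z. indicator A z * f (box_map A z) \<partial>\<mu>) / prob A"
    by simp
  finally show ?thesis .
qed

text \<open>
  If \<open>g\<close> is affine on \<open>A\<close> with gradient \<open>e\<close>, up to an error of the size of the cells of level \<open>n + q\<close>, then the
  coordinate \<open>z \<mapsto> \<langle>z, e\<rangle> / \<delta>\<^sup>q\<close> of the magnified cell is quasi-isometric to \<open>g\<close> at scale \<open>\<delta>\<^sup>n\<^sup>+\<^sup>q\<close>.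
  The error does not depend on \<open>A\<close>, \<open>n\<close> and \<open>q\<close>, which is decisive later on.
\<close>

lemma grid_entropy_close_label_entropy:
  assumes A: "A \<in> P n" "0 < prob A" and e: "norm e = 1" and g: "1-lipschitz_on UNIV g"
    and lin: "\<And>z. z \<in> A \<Longrightarrow> \<bar>g z - z \<bullet> e - b\<bar> \<le> \<delta> ^ (n + q)"
  shows "\<bar>grid_entropy e q (magnify \<mu> A) - label_entropy g (n + q) A\<bar> \<le> comparison_error"
proof -
  define t where "t z = box_map A z \<bullet> e / \<delta> ^ q" for z
  define v where "v = measure lborel A powr (- 1 / 2)"
  let ?m = "n + q"
  have v: "\<sigma>\<^sub>1 / \<delta> ^ n \<le> v" "v \<le> \<sigma>\<^sub>2 / \<delta> ^ n" using scale[OF A(1)] by (auto simp: v_def)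
  have pw: "0 < \<delta> ^ n" "0 < \<delta> ^ q" "0 < \<delta> ^ ?m" using delta by auto
  have v0: "0 < v" using v(1) lam pw by (meson divide_pos_pos less_le_trans)
  hence s2: "0 < \<sigma>\<^sub>2" using v(2) pw by (meson less_le_trans zero_less_divide_iff not_less_iff_gr_or_eq)
  have tt: "\<bar>t z - t z'\<bar> = v / \<delta> ^ q * \<bar>(z - z') \<bullet> e\<bar>" for z z'
  proof -
    have "t z - t z' = v / \<delta> ^ q * ((z - z') \<bullet> e)"
      unfolding t_def box_map_def v_def[symmetric]
      by (simp add: inner_diff_left algebra_simps diff_divide_distrib add_divide_distrib)
    thus ?thesis using v0 pw by (simp add: abs_mult)
  qed
  have vq: "\<sigma>\<^sub>1 / \<delta> ^ ?m \<le> v / \<delta> ^ q" "v / \<delta> ^ q \<le> \<sigma>\<^sub>2 / \<delta> ^ ?m"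
    using divide_right_mono[OF v(1), of "\<delta> ^ q"] divide_right_mono[OF v(2), of "\<delta> ^ q"] pw
    by (auto simp: power_add)
  have gd: "\<bar>(g z - g z') - (z - z') \<bullet> e\<bar> \<le> 2 * \<delta> ^ ?m" if "z \<in> A" "z' \<in> A" for z z'
    using lin[OF that(1)] lin[OF that(2)] by (simp add: inner_diff_left abs_le_iff)
  have dist_ge: "0 \<le> distortion" "2 * \<sigma>\<^sub>2 \<le> distortion" "\<sigma>\<^sub>2 \<le> distortion" "1 / \<sigma>\<^sub>1 \<le> distortion" "2 \<le> distortion" 
    using s2 lam by (auto simp: distortion_def)
  have "\<bar>(\<Sum>j\<in>{- int (grid q)..int (grid q)}. eta ((\<integral>z. indicator A z * hat j (t z) \<partial>\<mu>) / prob A))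
      - label_entropy g ?m A\<bar> \<le> (2 * c + 3) * (distortion + 1) + 3"
  proof (rule label_entropy_hat[OF _ g A])
    show "t \<in> borel_measurable borel" unfolding t_def by measurable
    show "\<bar>t z\<bar> \<le> real (grid q)" if "z \<in> A" for z
    proof -
      have "\<bar>box_map A z \<bullet> e\<bar> \<le> norm (box_map A z) * norm e" by (rule Cauchy_Schwarz_ineq2)
      also have "\<dots> \<le> grid q * \<delta> ^ q" using normalized[OF A(1) that] grid_ge[of q] e by simp
      finally show ?thesis unfolding t_def using pw by (simp add: pos_divide_le_eq)
    qed
    fix z z' assume z: "z \<in> A" "z' \<in> A"
    let ?D = "\<bar>g z / \<delta> ^ ?m - g z' / \<delta> ^ ?m\<bar>"
    have D: "\<bar>g z - g z'\<bar> = ?D * \<delta> ^ ?m" "0 \<le> ?D"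
    proof -
      have "g z - g z' = (g z / \<delta> ^ ?m - g z' / \<delta> ^ ?m) * \<delta> ^ ?m" using delta by (simp add: left_diff_distrib)
      hence "\<bar>g z - g z'\<bar> = ?D * \<bar>\<delta> ^ ?m\<bar>" by (simp only: abs_mult)
      thus "\<bar>g z - g z'\<bar> = ?D * \<delta> ^ ?m" using pw(3) by simp
    qed simp
    show "\<bar>t z - t z'\<bar> \<le> distortion * (?D + 1)"
    proof -
      have "\<bar>t z - t z'\<bar> \<le> \<sigma>\<^sub>2 / \<delta> ^ ?m * ((?D + 2) * \<delta> ^ ?m)"
        unfolding tt
      proof (intro mult_mono vq)
        have "\<bar>(z - z') \<bullet> e\<bar> \<le> \<bar>g z - g z'\<bar> + 2 * \<delta> ^ ?m" using gd[OF z] by linarith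
        thus "\<bar>(z - z') \<bullet> e\<bar> \<le> (?D + 2) * \<delta> ^ ?m" unfolding D(1) by (simp only: distrib_right)
      qed (use s2 pw in auto)
      also have "\<dots> = \<sigma>\<^sub>2 * ?D + 2 * \<sigma>\<^sub>2" using delta by (simp add: algebra_simps)
      also have "\<dots> \<le> distortion * ?D + distortion" using dist_ge D(2) by (intro add_mono mult_right_mono) auto
      finally show ?thesis by (simp add: algebra_simps)
    qed
    show "?D \<le> distortion * (\<bar>t z - t z'\<bar> + 1)"
    proof -
      have "\<bar>(z - z') \<bullet> e\<bar> * (\<sigma>\<^sub>1 / \<delta> ^ ?m) \<le> \<bar>t z - t z'\<bar>"
        unfolding tt using vq(1) by (subst mult.commute) (intro mult_right_mono, auto)
      hence "\<bar>(z - z') \<bullet> e\<bar> / \<delta> ^ ?m \<le> 1 / \<sigma>\<^sub>1 * \<bar>t z - t z'\<bar>"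
        using lam by (simp add: field_simps)
      moreover have "?D * \<delta> ^ ?m \<le> \<bar>(z - z') \<bullet> e\<bar> + 2 * \<delta> ^ ?m" using gd[OF z] D(1) by linarith
      hence "?D \<le> (\<bar>(z - z') \<bullet> e\<bar> + 2 * \<delta> ^ ?m) / \<delta> ^ ?m" using pw by (simp add: pos_le_divide_eq)
      hence "?D \<le> \<bar>(z - z') \<bullet> e\<bar> / \<delta> ^ ?m + 2" using delta by (simp add: add_divide_distrib)
      moreover have "1 / \<sigma>\<^sub>1 * \<bar>t z - t z'\<bar> \<le> distortion * \<bar>t z - t z'\<bar>" using dist_ge by (intro mult_right_mono) auto
      ultimately show ?thesis using dist_ge by (simp add: algebra_simps)
    qed
  qed (use dist_ge in auto)
  moreover have "(\<integral>z. hat j (z \<bullet> e / \<delta> ^ q) \<partial>magnify \<mu> A) = (\<integral>z. indicator A z * hat j (t z) \<partial>\<mu>) / prob A" for j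
    unfolding t_def using A by (intro integral_magnify) auto
  ultimately show ?thesis unfolding grid_entropy_def projected_entropy_def comparison_error_def by simp
qed

lemma limit_is_distribution: "\<Theta> \<in> prob_measures (weak_topology euclidean)"
proof -
  have "\<exists>x. limitin (weak_topology (weak_topology euclidean))
        (empirical (weak_topology euclidean) (\<lambda>k. magnify \<mu> (cell_at k x))) \<Theta> sequentially"
    using generating ae_filter_bot eventually_happens' by blast
  thus ?thesis by (auto simp: limitin_def topspace_weak_topology)
qed

lemma AE_average:
  "AE x in \<mu>. \<forall>F. continuous_map (weak_topology euclidean) euclideanreal F \<longrightarrow> bounded (F ` prob_measures euclidean) \<longrightarrow>
      (\<lambda>N. (\<Sum>k<N. F (magnify \<mu> (cell_at k x))) / N) \<longlonglongrightarrow> (\<integral>\<nu>. F \<nu> \<partial>\<Theta>)"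
  using generating AE_pos
proof eventually_elim
  case (elim x)
  show ?case
  proof (intro allI impI)
    fix F :: "(real^2) measure \<Rightarrow> real"
    assume F: "continuous_map (weak_topology euclidean) euclideanreal F" "bounded (F ` prob_measures euclidean)"
    have "(\<integral>\<nu>. F \<nu> \<partial>empirical (weak_topology euclidean) (\<lambda>k. magnify \<mu> (cell_at k x)) N)
       = (\<Sum>k<N. F (magnify \<mu> (cell_at k x))) / N" for N
      using elim(2) F(1) by (intro integral_empirical continuous_map_imp_borel_measurable)
        (auto simp: topspace_weak_topology intro: magnify_prob)
    thus "(\<lambda>N. (\<Sum>k<N. F (magnify \<mu> (cell_at k x))) / N) \<longlonglongrightarrow> (\<integral>\<nu>. F \<nu> \<partial>\<Theta>)"
      using limitin_weak_topology_imp_integral[OF elim(1) F(1)] F(2) by (simp add: topspace_weak_topology)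
  qed
qed

text \<open>
  The almost sure averages, integrated over the starting point. This form is used to transfer
  inequalities between averages over cells to \<open>\<Theta>\<close>.
\<close>

lemma AE_average_integral:
  assumes F: "continuous_map (weak_topology euclidean) euclideanreal F"
    and K: "\<And>\<nu>. \<nu> \<in> prob_measures euclidean \<Longrightarrow> \<bar>F \<nu>\<bar> \<le> K"
  shows "(\<lambda>N. (\<Sum>k<N. \<Sum>A\<in>P k. prob A * F (magnify \<mu> A)) / N) \<longlonglongrightarrow> (\<integral>\<nu>. F \<nu> \<partial>\<Theta>)"
proof -
  have meas: "(\<lambda>x. F (magnify \<mu> (cell_at k x))) \<in> borel_measurable \<mu>" for k
    by (rule measurable_at[of "\<lambda>A. F (magnify \<mu> A)"])
  have AEK: "AE x in \<mu>. \<forall>k. \<bar>F (magnify \<mu> (cell_at k x))\<bar> \<le> K"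
    using AE_pos by eventually_elim (auto intro: K magnify_prob)
  have int: "integrable \<mu> (\<lambda>x. F (magnify \<mu> (cell_at k x)))" for k
    using AEK by (intro integrable_const_bound[where B=K] meas) auto
  have "(\<lambda>N. \<integral>x. (\<Sum>k<N. F (magnify \<mu> (cell_at k x))) / N \<partial>\<mu>) \<longlonglongrightarrow> (\<integral>x. (\<integral>\<nu>. F \<nu> \<partial>\<Theta>) \<partial>\<mu>)"
  proof (rule integral_dominated_convergence[where w = "\<lambda>_. \<bar>K\<bar>"])
    show "(\<lambda>x. (\<Sum>k<N. F (magnify \<mu> (cell_at k x))) / N) \<in> borel_measurable \<mu>" for N
      by (intro borel_measurable_divide borel_measurable_sum meas) auto
    have "bounded (F ` prob_measures euclidean)" using K by (auto intro!: boundedI[where B=K])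
    thus "AE x in \<mu>. (\<lambda>N. (\<Sum>k<N. F (magnify \<mu> (cell_at k x))) / N) \<longlonglongrightarrow> (\<integral>\<nu>. F \<nu> \<partial>\<Theta>)"
      using AE_average F by auto
    show "AE x in \<mu>. norm ((\<Sum>k<N. F (magnify \<mu> (cell_at k x))) / N) \<le> \<bar>K\<bar>" for N
      using AEK
    proof eventually_elim
      case (elim x)
      have "\<bar>\<Sum>k<N. F (magnify \<mu> (cell_at k x))\<bar> \<le> (\<Sum>k<N. \<bar>K\<bar>)"
        using elim by (intro order_trans[OF sum_abs sum_mono]) (metis abs_ge_self order_trans)
      thus ?case by (cases "N = 0") (auto simp: abs_divide pos_divide_le_eq mult.commute)
    qed
  qed auto
  moreover have "(\<integral>x. (\<Sum>k<N. F (magnify \<mu> (cell_at k x))) / N \<partial>\<mu>)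
      = (\<Sum>k<N. \<Sum>A\<in>P k. prob A * F (magnify \<mu> A)) / N" for N
  proof -
    have "(\<integral>x. (\<Sum>k<N. F (magnify \<mu> (cell_at k x))) / N \<partial>\<mu>) = (\<integral>x. (\<Sum>k<N. F (magnify \<mu> (cell_at k x))) \<partial>\<mu>) / N"
      by (rule integral_divide_zero)
    also have "(\<integral>x. (\<Sum>k<N. F (magnify \<mu> (cell_at k x))) \<partial>\<mu>) = (\<Sum>k<N. \<integral>x. F (magnify \<mu> (cell_at k x)) \<partial>\<mu>)"
      using int by (intro Bochner_Integration.integral_sum)
    also have "\<dots> = (\<Sum>k<N. \<Sum>A\<in>P k. prob A * F (magnify \<mu> A))"
      by (intro sum.cong refl integral_at[of "\<lambda>A. F (magnify \<mu> A)"])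
    finally show ?thesis .
  qed
  moreover have "(\<integral>x. (\<integral>\<nu>. F \<nu> \<partial>\<Theta>) \<partial>\<mu>) = (\<integral>\<nu>. F \<nu> \<partial>\<Theta>)" using prob_space by simp
  ultimately show ?thesis by (simp only:)
qed

lemma continuous_grid_entropy: "continuous_map (weak_topology euclidean) euclideanreal (grid_entropy e q)"
  unfolding grid_entropy_def using delta by (intro continuous_map_projected_entropy) auto

lemma grid_entropy_bounds:
  assumes "\<nu> \<in> prob_measures euclidean"
  shows "0 \<le> grid_entropy e q \<nu>" "grid_entropy e q \<nu> \<le> ln (2 * real (grid q) + 1) + 1" "\<bar>grid_entropy e q \<nu>\<bar> \<le> ln (2 * real (grid q) + 1) + 1"
proof -
  show 1: "0 \<le> grid_entropy e q \<nu>" and 2: "grid_entropy e q \<nu> \<le> ln (2 * real (grid q) + 1) + 1"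
    unfolding grid_entropy_def by (rule projected_entropy_bounds[OF assms])+
  show "\<bar>grid_entropy e q \<nu>\<bar> \<le> ln (2 * real (grid q) + 1) + 1" using 1 2 by linarith
qed

text \<open>
  The entropies of the images of all cells of level \<open>k\<close> under \<open>z \<mapsto> \<langle>z, e\<rangle>\<close> satisfy this inequality with
  the cells of level \<open>k + q\<close> in the second term; averaging over \<open>k\<close> makes the shift by \<open>q\<close> invisible.
\<close>

lemma limit_entropy_superadditive:
  assumes e: "norm e = 1"
  shows "limit_entropy e q + limit_entropy e p - (3 * comparison_error + 2 * c + 5) \<le> limit_entropy e (q + p)"
proof -
  define a where "a k q = (\<Sum>A\<in>P k. prob A * grid_entropy e q (magnify \<mu> A))" for k q
  define g where "g z = z \<bullet> e" for z
  have g: "1-lipschitz_on UNIV g"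
  proof (rule lipschitz_onI)
    fix x y :: "real^2"
    have "\<bar>(x - y) \<bullet> e\<bar> \<le> norm (x - y) * norm e" by (rule Cauchy_Schwarz_ineq2)
    thus "dist (g x) (g y) \<le> 1 * dist x y" using e by (simp add: g_def dist_real_def dist_norm inner_diff_left)
  qed simp
  have grid_entropy: "\<bar>grid_entropy e q (magnify \<mu> A) - label_entropy g (n + q) A\<bar> \<le> comparison_error" if "A \<in> P n" "0 < prob A" for A n q
    using delta by (intro grid_entropy_close_label_entropy[OF that e g, of 0]) (auto simp: g_def)
  have lim: "(\<lambda>N. (\<Sum>k<N. a k q) / N) \<longlonglongrightarrow> limit_entropy e q" for q
    unfolding a_def limit_entropy_def by (rule AE_average_integral[OF continuous_grid_entropy grid_entropy_bounds(3)])
  have step: "a k q + a (k + q) p - (3 * comparison_error + 2 * c + 5) \<le> a k (q + p)" for k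
  proof -
    have "a (k + q) p = (\<Sum>A\<in>P k. \<Sum>A'\<in>subcells (k + q) A. prob A' * grid_entropy e p (magnify \<mu> A'))"
      unfolding a_def by (rule sum_cells_eq_sum_subcells) simp
    hence "a k q + a (k + q) p = (\<Sum>A\<in>P k. prob A * grid_entropy e q (magnify \<mu> A)
        + (\<Sum>A'\<in>subcells (k + q) A. prob A' * grid_entropy e p (magnify \<mu> A')))"
      by (simp add: a_def sum.distrib)
    also have "\<dots> \<le> (\<Sum>A\<in>P k. prob A * grid_entropy e (q + p) (magnify \<mu> A) + prob A * (3 * comparison_error + 2 * c + 5))"
    proof (rule sum_mono)
      fix A assume A: "A \<in> P k"
      show "prob A * grid_entropy e q (magnify \<mu> A) + (\<Sum>A'\<in>subcells (k + q) A. prob A' * grid_entropy e p (magnify \<mu> A'))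
        \<le> prob A * grid_entropy e (q + p) (magnify \<mu> A) + prob A * (3 * comparison_error + 2 * c + 5)"
      proof (cases "0 < prob A")
        case True
        have sub1: "(\<Sum>A'\<in>subcells (k + q) A. prob A' / prob A) = 1"
          using prob_eq_sum_subcells[OF A, of "k + q"] True by (simp add: sum_divide_distrib[symmetric])
        have "(\<Sum>A'\<in>subcells (k + q) A. prob A' / prob A * grid_entropy e p (magnify \<mu> A'))
            \<le> (\<Sum>A'\<in>subcells (k + q) A. prob A' / prob A * (label_entropy g (k + q + p) A' + comparison_error))"
        proof (intro sum_mono mult_left_mono)
          fix A' assume "A' \<in> subcells (k + q) A"
          thus "grid_entropy e p (magnify \<mu> A') \<le> label_entropy g (k + q + p) A' + comparison_error"
            using grid_entropy[of A' "k + q" p] subcellsD by (simp add: abs_le_iff)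
        qed auto
        also have "\<dots> = (\<Sum>A'\<in>subcells (k + q) A. prob A' / prob A * label_entropy g (k + q + p) A') + comparison_error"
          unfolding distrib_left sum.distrib sum_distrib_right[symmetric] sub1 by simp
        finally have "grid_entropy e q (magnify \<mu> A) + (\<Sum>A'\<in>subcells (k + q) A. prob A' / prob A * grid_entropy e p (magnify \<mu> A'))
            \<le> grid_entropy e (q + p) (magnify \<mu> A) + (3 * comparison_error + 2 * c + 5)"
          using label_entropy_superadditive[OF g A True, of "k + q" "k + q + p"]
            grid_entropy[OF A True, of q] grid_entropy[OF A True, of "q + p"] by (simp add: abs_le_iff add.assoc)
        from mult_left_mono[OF this, of "prob A"] show ?thesis
          using True by (simp add: distrib_left sum_distrib_left)
      next
        case False
        have "subcells (k + q) A = {}"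
        proof (rule ccontr)
          assume "subcells (k + q) A \<noteq> {}"
          then obtain A' where A': "A' \<in> subcells (k + q) A" by blast
          have "prob A' \<le> prob A" using subcellsD(2)[OF A'] meas_cell[OF A] by (intro finite_measure_mono) auto
          thus False using subcellsD(3)[OF A'] False by linarith
        qed
        thus ?thesis using False by (simp add: zero_less_measure_iff)
      qed
    qed
    also have "\<dots> = a k (q + p) + (\<Sum>A\<in>P k. prob A * (3 * comparison_error + 2 * c + 5))" by (simp add: a_def sum.distrib)
    also have "(\<Sum>A\<in>P k. prob A * (3 * comparison_error + 2 * c + 5)) = 3 * comparison_error + 2 * c + 5"
      using integral_at[of "\<lambda>_. 3 * comparison_error + 2 * c + 5" k] prob_space by simp
    finally show ?thesis by simp
  qed
  have "(\<lambda>N. (\<Sum>k<N. a k q) / N + (\<Sum>k<N. a (k + q) p) / N - (3 * comparison_error + 2 * c + 5)) \<longlonglongrightarrow> limit_entropy e q + limit_entropy e p - (3 * comparison_error + 2 * c + 5)"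
    using lim[of q] cesaro_shift[OF lim[of p], of q] by (intro tendsto_intros)
  moreover have "\<forall>\<^sub>F N in sequentially. (\<Sum>k<N. a k q) / N + (\<Sum>k<N. a (k + q) p) / N - (3 * comparison_error + 2 * c + 5)
      \<le> (\<Sum>k<N. a k (q + p)) / N"
    using eventually_gt_at_top[of 0]
  proof eventually_elim
    case (elim N)
    have "(\<Sum>k<N. a k q) + (\<Sum>k<N. a (k + q) p) - N * (3 * comparison_error + 2 * c + 5) = (\<Sum>k<N. a k q + a (k + q) p - (3 * comparison_error + 2 * c + 5))"
      by (simp add: sum.distrib sum_subtractf)
    also have "\<dots> \<le> (\<Sum>k<N. a k (q + p))" by (intro sum_mono step)
    finally have "((\<Sum>k<N. a k q) + (\<Sum>k<N. a (k + q) p) - N * (3 * comparison_error + 2 * c + 5)) / N \<le> (\<Sum>k<N. a k (q + p)) / N"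
      by (intro divide_right_mono) auto
    thus ?case using elim by (simp add: add_divide_distrib diff_divide_distrib)
  qed
  ultimately show ?thesis by (intro tendsto_le[OF sequentially_bot lim[of "q + p"]])
qed

lemma limit_prob_space: "prob_space \<Theta>"
  using limit_is_distribution by (simp add: prob_measures_def)

lemma limit_sets: "sets \<Theta> = sets (borel_of (weak_topology euclidean))"
  using limit_is_distribution by (simp add: prob_measures_def)

lemma limit_space: "space \<Theta> = prob_measures euclidean"
  using sets_eq_imp_space_eq[OF limit_sets] by (simp add: topspace_weak_topology)

lemma limit_measurable:
  "F \<in> borel_measurable (borel_of (weak_topology euclidean)) \<Longrightarrow> F \<in> borel_measurable \<Theta>"
  using measurable_cong_sets[OF limit_sets refl] by blast

lemma integrable_grid_entropy: "integrable \<Theta> (grid_entropy e q)"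
proof -
  interpret Q: prob_space \<Theta> by (rule limit_prob_space)
  show ?thesis
  proof (rule Q.integrable_const_bound)
    show "AE \<nu> in \<Theta>. norm (grid_entropy e q \<nu>) \<le> ln (2 * real (grid q) + 1) + 1"
      using grid_entropy_bounds(3) by (intro AE_I2) (simp add: limit_space)
  qed (intro limit_measurable continuous_map_imp_borel_measurable continuous_grid_entropy)
qed

lemma convergent_limit_entropy:
  assumes e: "norm e = 1"
  shows "convergent (\<lambda>q. limit_entropy e q / q)"
proof (rule convergent_almost_superadditive[OF limit_entropy_superadditive[OF e]])
  define K where "K = ln (2 * \<bar>\<rho>\<bar> + 3) + 1 + ln (1 / \<delta>)"
  fix q :: nat
  have ld: "0 \<le> ln (1 / \<delta>)" using delta by simp
  interpret Q: prob_space \<Theta> by (rule limit_prob_space)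
  have "limit_entropy e q \<le> (\<integral>\<nu>. ln (2 * real (grid q) + 1) + 1 \<partial>\<Theta>)"
    unfolding limit_entropy_def
  proof (rule integral_mono)
    show "grid_entropy e q \<nu> \<le> ln (2 * real (grid q) + 1) + 1" if "\<nu> \<in> space \<Theta>" for \<nu>
      using grid_entropy_bounds(2) that by (simp add: limit_space)
  qed (auto intro: integrable_grid_entropy)
  also have "\<dots> = ln (2 * real (grid q) + 1) + 1" using Q.prob_space by simp
  also have "2 * real (grid q) + 1 \<le> (2 * \<bar>\<rho>\<bar> + 3) / \<delta> ^ q"
  proof -
    have "real (grid q) \<le> \<bar>\<rho>\<bar> / \<delta> ^ q + 1"
    proof -
      have "\<rho> / \<delta> ^ q \<le> \<bar>\<rho>\<bar> / \<delta> ^ q" using delta by (intro divide_right_mono) auto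
      moreover have "0 \<le> \<bar>\<rho>\<bar> / \<delta> ^ q" using delta by simp
      ultimately show ?thesis unfolding grid_def by linarith
    qed
    moreover have "1 \<le> 1 / \<delta> ^ q" using delta by (simp add: power_le_one)
    ultimately have "2 * real (grid q) + 1 \<le> 2 * (\<bar>\<rho>\<bar> / \<delta> ^ q) + 3 * (1 / \<delta> ^ q)" by linarith
    thus ?thesis by (simp add: add_divide_distrib)
  qed
  hence "ln (2 * real (grid q) + 1) + 1 \<le> ln ((2 * \<bar>\<rho>\<bar> + 3) / \<delta> ^ q) + 1" by simp
  also have "\<dots> = ln (2 * \<bar>\<rho>\<bar> + 3) + q * ln (1 / \<delta>) + 1"
  proof -
    have "0 < 2 * \<bar>\<rho>\<bar> + 3" using abs_ge_zero[of \<rho>] by linarith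
    thus ?thesis using delta by (subst ln_div) (auto simp: ln_realpow ln_div)
  qed
  also have "\<dots> \<le> K * q + K"
  proof -
    have "0 \<le> ln (2 * \<bar>\<rho>\<bar> + 3)" by simp
    hence "q * ln (1 / \<delta>) \<le> K * q" unfolding K_def by (simp add: algebra_simps)
    thus ?thesis using ld by (simp add: K_def)
  qed
  finally show "limit_entropy e q \<le> K * q + K" by simp
qed

lemma AE_supported: "AE \<nu> in \<Theta>. AE z in \<nu>. norm z \<le> \<rho>"
proof -
  \<comment> \<open>A bounded continuous function that vanishes exactly on the ball; its integral is zero for all
    magnified measures, hence on average for the limit.\<close>
  define f where "f z = min 1 (max 0 (norm z - \<rho>))" for z :: "real^2"
  define F where "F \<nu> = (\<integral>z. f z \<partial>\<nu>)" for \<nu>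
  have f: "0 \<le> f z" "f z \<le> 1" for z by (auto simp: f_def)
  have cf: "continuous_on UNIV f" unfolding f_def by (intro continuous_intros)
  hence [measurable]: "f \<in> borel_measurable borel" by (rule borel_measurable_continuous_onI)
  interpret Q: prob_space \<Theta> by (rule limit_prob_space)
  have F: "continuous_map (weak_topology euclidean) euclideanreal F"
    unfolding F_def using f cf by (intro continuous_map_integral) (auto intro!: boundedI[where B=1])
  have meas: "F \<in> borel_measurable \<Theta>"
    by (intro limit_measurable continuous_map_imp_borel_measurable F)
  have nu: "prob_space \<nu> \<and> sets \<nu> = sets borel \<and> integrable \<nu> f" if "\<nu> \<in> prob_measures euclidean" for \<nu>
  proof -
    have n: "prob_space \<nu>" "sets \<nu> = sets borel" using that by (auto simp: prob_measures_def borel_of_euclidean)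
    have "f \<in> borel_measurable \<nu>" using n(2) by (subst measurable_cong_sets[of _ borel]) auto
    moreover have "finite_measure \<nu>" using n(1) by (rule prob_space.finite_measure)
    ultimately show ?thesis using n f by (auto intro!: finite_measure.integrable_const_bound[where B=1])
  qed
  have FK: "0 \<le> F \<nu>" "\<bar>F \<nu>\<bar> \<le> 1" if \<nu>: "\<nu> \<in> prob_measures euclidean" for \<nu>
  proof -
    interpret N: prob_space \<nu> using nu[OF \<nu>] by simp
    show 0: "0 \<le> F \<nu>" unfolding F_def using f by simp
    have "F \<nu> \<le> (\<integral>z. 1 \<partial>\<nu>)" unfolding F_def using nu[OF \<nu>] f by (intro integral_mono) auto
    thus "\<bar>F \<nu>\<bar> \<le> 1" using 0 N.prob_space by simp
  qed
  have "prob A * F (magnify \<mu> A) = 0" if A: "A \<in> P k" for A k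
  proof (cases "0 < prob A")
    case True
    have "F (magnify \<mu> A) = (\<integral>z. indicator A z * f (box_map A z) \<partial>\<mu>) / prob A"
      unfolding F_def using A True by (intro integral_magnify) auto
    also have "(\<lambda>z. indicator A z * f (box_map A z)) = (\<lambda>_. 0)"
      using normalized[OF A] by (auto simp: fun_eq_iff indicator_def f_def)
    finally show ?thesis by simp
  qed (simp add: zero_less_measure_iff)
  hence "(\<Sum>k<N. \<Sum>A\<in>P k. prob A * F (magnify \<mu> A)) = 0" for N by (intro sum.neutral ballI) auto
  hence "(\<lambda>N. (\<Sum>k<N. \<Sum>A\<in>P k. prob A * F (magnify \<mu> A)) / real N) = (\<lambda>_. 0)" by simp
  with AE_average_integral[OF F FK(2)] have "(\<lambda>_. 0) \<longlonglongrightarrow> (\<integral>\<nu>. F \<nu> \<partial>\<Theta>)" by (simp only:)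
  hence "(\<integral>\<nu>. F \<nu> \<partial>\<Theta>) = 0" using LIMSEQ_unique tendsto_const by blast
  moreover have "integrable \<Theta> F" using FK by (intro Q.integrable_const_bound[OF _ meas, of 1]) (auto simp: limit_space)
  ultimately have "AE \<nu> in \<Theta>. F \<nu> = 0"
    using FK(1) by (subst (asm) integral_nonneg_eq_0_iff_AE) (auto simp: limit_space)
  moreover have "AE \<nu> in \<Theta>. \<nu> \<in> prob_measures euclidean" using AE_space[of \<Theta>] by (simp add: limit_space)
  ultimately show ?thesis
  proof eventually_elim
    case (elim \<nu>)
    hence "AE z in \<nu>. f z = 0" unfolding F_def using nu f by (subst (asm) integral_nonneg_eq_0_iff_AE) auto
    thus ?case by eventually_elim (auto simp: f_def min_def max_def split: if_splits)
  qed
qed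

text \<open>
  As the \<open>\<Theta>\<close>-typical measures live on a fixed ball, their ball entropy is within 9 of the entropy of hat
  functions. So \<open>E\<^sub>q\<close> converges, and its limit is expressed by the limit entropies.
\<close>

lemma mean_entropy_limit:
  assumes e: "norm e = 1" and Q: "measure_component Q = \<Theta>"
  shows "(\<lambda>q. limit_entropy e q / q) \<longlonglongrightarrow> mean_entropy \<delta> Q (\<lambda>z. z \<bullet> e) * ln (1 / \<delta>)"
proof -
  let ?\<pi> = "\<lambda>z::real^2. z \<bullet> e" and ?l = "ln (1 / \<delta>)"
  have l: "0 < ?l" using delta by simp
  interpret Q: prob_space \<Theta> by (rule limit_prob_space)
  have close: "\<bar>entropy_at \<delta> Q q ?\<pi> - limit_entropy e q / (q * ?l)\<bar> \<le> 9 / (q * ?l)" for q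
  proof -
    define H where "H \<nu> = scale_entropy (\<delta> ^ q) (distr \<nu> borel ?\<pi>)" for \<nu>
    have "H \<in> borel_measurable (borel_of (weak_topology euclidean))"
      unfolding H_def by (rule measurable_scale_entropy_projection) measurable
    hence mH: "H \<in> borel_measurable \<Theta>" by (rule limit_measurable)
    note int_grid = integrable_grid_entropy[of e q]
    have "AE \<nu> in \<Theta>. \<nu> \<in> prob_measures euclidean" using AE_space[of \<Theta>] by (simp add: limit_space)
    with AE_supported have near: "AE \<nu> in \<Theta>. \<bar>H \<nu> - grid_entropy e q \<nu>\<bar> \<le> 9"
    proof eventually_elim
      case (elim \<nu>)
      have ps: "prob_space \<nu>" and s [measurable_cong]: "sets \<nu> = sets borel"
        using elim by (auto simp: prob_measures_def borel_of_euclidean)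
      have "\<bar>scale_entropy (\<delta> ^ q) (distr \<nu> borel ?\<pi>)
          - (\<Sum>j\<in>{- int (grid q)..int (grid q)}. eta (\<integral>x. hat j (x / \<delta> ^ q) \<partial>distr \<nu> borel ?\<pi>))\<bar> \<le> 9"
      proof (rule scale_entropy_hat)
        show "prob_space (distr \<nu> borel ?\<pi>)" using ps by (rule prob_space.prob_space_distr) measurable
        have "AE z in \<nu>. \<bar>?\<pi> z\<bar> \<le> real (grid q) * \<delta> ^ q" using elim(1)
        proof eventually_elim
          case (elim z)
          have "\<bar>z \<bullet> e\<bar> \<le> norm z * norm e" by (rule Cauchy_Schwarz_ineq2)
          thus ?case using elim e grid_ge[of q] by simp
        qed
        thus "AE x in distr \<nu> borel ?\<pi>. \<bar>x\<bar> \<le> real (grid q) * \<delta> ^ q"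
          by (subst AE_distr_iff) auto
      qed (use delta in auto)
      moreover have "(\<integral>x. hat j (x / \<delta> ^ q) \<partial>distr \<nu> borel ?\<pi>) = (\<integral>z. hat j (z \<bullet> e / \<delta> ^ q) \<partial>\<nu>)" for j
        by (rule integral_distr) measurable
      ultimately show ?case unfolding H_def grid_entropy_def projected_entropy_def by simp
    qed
    have iH: "integrable \<Theta> H"
    proof (rule Bochner_Integration.integrable_bound)
      show "integrable \<Theta> (\<lambda>\<nu>. \<bar>grid_entropy e q \<nu>\<bar> + 9)" using int_grid by auto
      show "AE \<nu> in \<Theta>. norm (H \<nu>) \<le> norm (\<bar>grid_entropy e q \<nu>\<bar> + 9)" using near by eventually_elim auto
    qed (rule mH)
    have "\<bar>(\<integral>\<nu>. H \<nu> \<partial>\<Theta>) - limit_entropy e q\<bar> = \<bar>\<integral>\<nu>. H \<nu> - grid_entropy e q \<nu> \<partial>\<Theta>\<bar>" unfolding limit_entropy_def using iH int_grid by simp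
    also have "\<dots> \<le> (\<integral>\<nu>. \<bar>H \<nu> - grid_entropy e q \<nu>\<bar> \<partial>\<Theta>)" by (rule integral_abs_bound)
    also have "\<dots> \<le> (\<integral>\<nu>. 9 \<partial>\<Theta>)" using near iH int_grid by (intro integral_mono_AE) auto
    also have "\<dots> = 9" using Q.prob_space by simp
    finally have *: "\<bar>(\<integral>\<nu>. H \<nu> \<partial>\<Theta>) - limit_entropy e q\<bar> \<le> 9" .
    have "entropy_at \<delta> Q q ?\<pi> - limit_entropy e q / (q * ?l) = ((\<integral>\<nu>. H \<nu> \<partial>\<Theta>) - limit_entropy e q) / (q * ?l)"
      unfolding entropy_at_def Q H_def by (simp add: diff_divide_distrib)
    also have "\<bar>\<dots>\<bar> = \<bar>(\<integral>\<nu>. H \<nu> \<partial>\<Theta>) - limit_entropy e q\<bar> / (q * ?l)" using l by (simp add: abs_divide)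
    also have "\<dots> \<le> 9 / (q * ?l)" using * l by (intro divide_right_mono) auto
    finally show ?thesis .
  qed
  obtain L where L: "(\<lambda>q. limit_entropy e q / q) \<longlonglongrightarrow> L" using convergent_limit_entropy[OF e] by (auto simp: convergent_def)
  have "(\<lambda>q. entropy_at \<delta> Q q ?\<pi> - limit_entropy e q / (q * ?l)) \<longlonglongrightarrow> 0"
  proof (rule Lim_null_comparison)
    show "\<forall>\<^sub>F q in sequentially. norm (entropy_at \<delta> Q q ?\<pi> - limit_entropy e q / (q * ?l)) \<le> 9 / (q * ?l)"
      using close by simp
    have "(\<lambda>q. (9 / ?l) / real q) \<longlonglongrightarrow> 0" by (rule lim_const_over_n)
    thus "(\<lambda>q. 9 / (q * ?l)) \<longlonglongrightarrow> 0" by (simp add: mult.commute)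
  qed
  moreover have "(\<lambda>q. limit_entropy e q / q / ?l) \<longlonglongrightarrow> L / ?l" using L l by (intro tendsto_divide tendsto_const) auto
  ultimately have "(\<lambda>q. (entropy_at \<delta> Q q ?\<pi> - limit_entropy e q / (q * ?l)) + limit_entropy e q / q / ?l) \<longlonglongrightarrow> 0 + L / ?l"
    by (rule tendsto_add)
  hence "(\<lambda>q. entropy_at \<delta> Q q ?\<pi>) \<longlonglongrightarrow> L / ?l" by simp
  hence "mean_entropy \<delta> Q ?\<pi> = L / ?l" unfolding mean_entropy_def by (rule limI)
  hence "mean_entropy \<delta> Q ?\<pi> * ?l = L" using l by simp
  thus ?thesis using L by simp
qed

end

section \<open>Local dimension of the distances from a point\<close>

text \<open>
  The first-order expansion of the distance from \<open>y\<close> at \<open>x\<close>, with a quadratic error. With \<open>a = x - y\<close>,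
  \<open>h = z - x\<close> and \<open>p\<close> the component of \<open>h\<close> in direction \<open>a\<close>, it follows from
  \<open>|a + h|\<^sup>2 - (|a| + p)\<^sup>2 = |h|\<^sup>2 - p\<^sup>2\<close>.
\<close>

lemma dist_linearization:
  fixes x y z :: "'a::real_inner"
  assumes "x \<noteq> y" and close: "2 * dist z x \<le> dist x y"
  shows "\<bar>dist z y - z \<bullet> sgn (x - y) - (dist x y - x \<bullet> sgn (x - y))\<bar> \<le> (dist z x)\<^sup>2 / dist x y"
proof -
  define a where "a = x - y"
  define h where "h = z - x"
  define b where "b = norm a"
  define p where "p = h \<bullet> sgn a"
  have b: "0 < b" using assms(1) by (simp add: b_def a_def)
  have hb: "2 * norm h \<le> b" using close by (simp add: h_def b_def a_def dist_norm)
  have ap: "a \<bullet> h = b * p" using b by (simp add: p_def sgn_div_norm b_def inner_commute)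
  have pn: "\<bar>p\<bar> \<le> norm h"
    using Cauchy_Schwarz_ineq2[of h "sgn a"] b by (simp add: p_def norm_sgn b_def split: if_splits)
  have n2: "(norm (a + h))\<^sup>2 = b\<^sup>2 + 2 * (b * p) + (norm h)\<^sup>2"
    using ap by (simp add: b_def power2_norm_eq_inner inner_add_left inner_add_right inner_commute)
  have prod: "(norm (a + h) - (b + p)) * (norm (a + h) + (b + p)) = (norm h)\<^sup>2 - p\<^sup>2"
    using n2 by (simp add: algebra_simps power2_eq_square)
  have p2: "p\<^sup>2 \<le> (norm h)\<^sup>2" using pn by (simp add: abs_le_square_iff[symmetric])
  have "b \<le> norm (a + h) + (b + p)"
  proof -
    have "b - norm h \<le> norm (a + h)" unfolding b_def using norm_diff_ineq[of a h] by simp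
    thus ?thesis using pn hb by linarith
  qed
  note sum = this
  have "0 \<le> norm (a + h) - (b + p)"
    using prod p2 sum b by (metis diff_ge_0_iff_ge less_le_trans mult_neg_pos not_le)
  moreover from this have "(norm (a + h) - (b + p)) * b \<le> (norm h)\<^sup>2"
    using prod p2 mult_left_mono[OF sum, of "norm (a + h) - (b + p)"] by (smt (verit) zero_le_power2)
  hence "norm (a + h) - (b + p) \<le> (norm h)\<^sup>2 / b" using b by (simp add: pos_le_divide_eq)
  moreover have "dist z y - z \<bullet> sgn (x - y) - (dist x y - x \<bullet> sgn (x - y)) = norm (a + h) - (b + p)"
    by (simp add: a_def h_def b_def p_def dist_norm inner_diff_left)
  ultimately show ?thesis by (simp add: h_def b_def a_def dist_norm)
qed

context generating_cells
begin

text \<open>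
  For each fixed \<open>q\<close>, the mass of windows decays at least with the exponent
  \<open>limit_entropy e q / (q ln (1 / \<delta>))\<close> up to an error \<open>O(1 / q)\<close>; as \<open>q \<rightarrow> \<infinity>\<close> this exponent tends to \<open>E(\<pi>\<^sub>e)\<close>.
  The scale \<open>q\<close> is chosen after \<open>x\<close>, because the convergence of \<open>E\<^sub>q(\<pi>\<^sub>e)\<close> need not be uniform in \<open>e\<close>.
\<close>

lemma AE_distance_local_dimension:
  assumes Q: "measure_component Q = \<Theta>" and t: "0 \<le> t" "t < s"
  shows "AE x in \<mu>. x \<noteq> y \<longrightarrow> mean_entropy \<delta> Q (\<lambda>z. z \<bullet> sgn (x - y)) = s \<longrightarrow>
    (\<exists>N0. \<forall>N\<ge>N0. prob {z. dist (dist z y) (dist x y) \<le> \<delta> ^ N} \<le> (\<delta> ^ N) powr t)"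
proof -
  define g where "g z = dist z y" for z
  define W where "W N x = prob {z. \<bar>g z - g x\<bar> \<le> \<delta> ^ N}" for N x
  define C where "C = 2 * radius + 2 * c + 6 + 1"
  define l where "l = ln (1 / \<delta>)"
  have l: "0 < l" unfolding l_def using delta by simp
  have g: "1-lipschitz_on UNIV g"
  proof (rule lipschitz_onI)
    fix a b
    show "dist (g a) (g b) \<le> 1 * dist a b"
      using abs_dist_diff_le[of a y b] by (simp add: g_def dist_real_def dist_commute)
  qed simp
  have "AE x in \<mu>. \<forall>q. 1 \<le> q \<longrightarrow> (\<forall>\<^sub>F N in sequentially.
     (\<Sum>n<N. label_entropy g (n + q) (cell_at n x)) - C * N \<le> - (q * ln (W (N + q) x)))"
    using AE_label_entropy_le_window[OF g _ zero_less_one] unfolding C_def W_def by (subst AE_all_countable) auto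
  with AE_average AE_pos show ?thesis
  proof eventually_elim
    case (elim x)
    hence x: "x \<in> X" and pos: "\<And>n. 0 < prob (cell_at n x)" by auto
    note at = cell_at_in[OF x]
    show ?case
    proof (intro impI)
      assume xy: "x \<noteq> y" and me: "mean_entropy \<delta> Q (\<lambda>z. z \<bullet> sgn (x - y)) = s"
      define e where "e = sgn (x - y)"
      have e: "norm e = 1" using xy by (simp add: e_def norm_sgn)
      have ul: "(\<lambda>q. limit_entropy e q / q) \<longlonglongrightarrow> s * l"
        using mean_entropy_limit[OF e Q] me by (simp add: e_def l_def)
      have average: "(\<lambda>N. (\<Sum>k<N. grid_entropy e q (magnify \<mu> (cell_at k x))) / N) \<longlonglongrightarrow> limit_entropy e q" for q
      proof -
        have "bounded (grid_entropy e q ` prob_measures euclidean)"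
          using grid_entropy_bounds(3) by (auto intro!: boundedI)
        thus ?thesis using elim(1) continuous_grid_entropy unfolding limit_entropy_def by blast
      qed
      have flat: "\<exists>n0. \<forall>n\<ge>n0. grid_entropy e q (magnify \<mu> (cell_at n x)) \<le> label_entropy g (n + q) (cell_at n x) + comparison_error" for q
      proof -
        \<comment> \<open>Below this size of cells the quadratic error of the linearization is at most
          \<open>\<delta>\<^sup>n\<^sup>+\<^sup>q\<close>.\<close>
        define r where "r = min (dist x y / (2 * (c + 1))) (dist x y * \<delta> ^ q / (c + 1)\<^sup>2)"
        have r: "0 < r" unfolding r_def using xy c0 delta by simp
        have "\<forall>\<^sub>F n in sequentially. \<delta> ^ n < r"
          using delta r by (intro order_tendstoD(2)[OF LIMSEQ_power_zero]) auto
        then obtain n0 where n0: "\<And>n. n0 \<le> n \<Longrightarrow> \<delta> ^ n < r" unfolding eventually_sequentially by blast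
        show ?thesis
        proof (intro exI allI impI)
          fix n assume "n0 \<le> n"
          hence n: "\<delta> ^ n < dist x y / (2 * (c + 1))" "\<delta> ^ n < dist x y * \<delta> ^ q / (c + 1)\<^sup>2"
            using n0[of n] by (auto simp: r_def)
          have d: "0 < dist x y" using xy by simp
          have c1: "0 < c + 1" using c0 by simp
          have near: "\<bar>g z - z \<bullet> e - (dist x y - x \<bullet> e)\<bar> \<le> \<delta> ^ (n + q)" if "z \<in> cell_at n x" for z
          proof -
            have zx: "dist z x \<le> (c + 1) * \<delta> ^ n"
              using diam[OF at(1) that at(2)] delta by (simp add: algebra_simps) (smt (verit) zero_le_power)
            have "2 * ((c + 1) * \<delta> ^ n) \<le> dist x y" using n(1) c1 by (simp add: pos_less_divide_eq algebra_simps)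
            with zx have "2 * dist z x \<le> dist x y" by linarith
            hence "\<bar>g z - z \<bullet> e - (dist x y - x \<bullet> e)\<bar> \<le> (dist z x)\<^sup>2 / dist x y"
              unfolding e_def g_def by (rule dist_linearization[OF xy])
            also have "(dist z x)\<^sup>2 / dist x y \<le> ((c + 1) * \<delta> ^ n)\<^sup>2 / dist x y"
              using zx by (intro divide_right_mono power_mono) auto
            also have "\<dots> = \<delta> ^ n * ((c + 1)\<^sup>2 * \<delta> ^ n) / dist x y" by (simp add: power2_eq_square algebra_simps)
            also have "\<dots> \<le> \<delta> ^ n * (dist x y * \<delta> ^ q) / dist x y"
              using n(2) c1 delta by (intro divide_right_mono mult_left_mono) (auto simp: pos_less_divide_eq mult_ac)
            also have "\<dots> = \<delta> ^ (n + q)" using d by (simp add: power_add)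
            finally show ?thesis .
          qed
          show "grid_entropy e q (magnify \<mu> (cell_at n x)) \<le> label_entropy g (n + q) (cell_at n x) + comparison_error"
            using grid_entropy_close_label_entropy[OF at(1) pos e g near] by (simp add: abs_le_iff)
        qed
      qed
      have lower: "\<forall>\<^sub>F N in sequentially. (limit_entropy e q - (comparison_error + C + 2)) * N \<le> - (q * ln (W (N + q) x))" if q: "1 \<le> q" for q
      proof -
        define dif where "dif n = grid_entropy e q (magnify \<mu> (cell_at n x)) - label_entropy g (n + q) (cell_at n x) - comparison_error" for n
        obtain n0 where n0: "\<And>n. n0 \<le> n \<Longrightarrow> dif n \<le> 0" using flat[of q] unfolding dif_def by force
        define K where "K = (\<Sum>n<n0. \<bar>dif n\<bar>)"
        have K: "(\<Sum>n<N. dif n) \<le> K" for N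
        proof -
          have "(\<Sum>n<N. dif n) \<le> (\<Sum>n<N. if n < n0 then \<bar>dif n\<bar> else 0)"
            using n0 by (intro sum_mono) (auto simp: not_less)
          also have "\<dots> = (\<Sum>n\<in>{..<N} \<inter> {..<n0}. \<bar>dif n\<bar>)"
            by (subst sum.inter_restrict) (auto intro: sum.cong)
          also have "\<dots> \<le> K" unfolding K_def by (intro sum_mono2) auto
          finally show ?thesis .
        qed
        have "\<forall>\<^sub>F N in sequentially. limit_entropy e q - 1 < (\<Sum>k<N. grid_entropy e q (magnify \<mu> (cell_at k x))) / N"
          using order_tendstoD(1)[OF average[of q], of "limit_entropy e q - 1"] by simp
        moreover have "\<forall>\<^sub>F N in sequentially. max 1 K \<le> real N"
          using filterlim_real_sequentially unfolding filterlim_at_top by blast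
        moreover have "\<forall>\<^sub>F N in sequentially.
            (\<Sum>n<N. label_entropy g (n + q) (cell_at n x)) - C * N \<le> - (q * ln (W (N + q) x))"
          using elim(3) q by blast
        ultimately show ?thesis
        proof eventually_elim
          case (elim N)
          have "(limit_entropy e q - 1) * N \<le> (\<Sum>k<N. grid_entropy e q (magnify \<mu> (cell_at k x)))"
            using elim(1,2) by (simp add: pos_less_divide_eq less_imp_le)
          also have "\<dots> = (\<Sum>n<N. dif n) + (\<Sum>n<N. label_entropy g (n + q) (cell_at n x)) + comparison_error * N"
            by (simp add: dif_def sum.distrib sum_subtractf)
          also have "\<dots> \<le> N + (\<Sum>n<N. label_entropy g (n + q) (cell_at n x)) + comparison_error * N"
            using K[of N] elim(2) by simp
          finally show ?case using elim(3) by (simp add: algebra_simps)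
        qed
      qed
      define t' where "t' = (t + s) / 2"
      have t': "t < t'" "t' < s" using t by (auto simp: t'_def)
      have "(\<lambda>q. limit_entropy e q / q - (comparison_error + C + 2) / q) \<longlonglongrightarrow> s * l - 0"
        by (intro tendsto_diff ul lim_const_over_n)
      hence "\<forall>\<^sub>F q in sequentially. t' * l < limit_entropy e q / q - (comparison_error + C + 2) / q"
        using t' l by (intro order_tendstoD) auto
      hence "\<forall>\<^sub>F q in sequentially. 1 \<le> q \<and> t' * l < limit_entropy e q / q - (comparison_error + C + 2) / q"
        using eventually_ge_at_top[of 1] by eventually_elim auto
      then obtain q where q: "1 \<le> q" "t' * l < limit_entropy e q / q - (comparison_error + C + 2) / q"
        unfolding eventually_sequentially by blast
      have q': "q * (t' * l) \<le> limit_entropy e q - (comparison_error + C + 2)"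
        using q by (simp add: diff_divide_distrib[symmetric] pos_less_divide_eq mult.commute less_imp_le)
      have "\<forall>\<^sub>F N in sequentially. t * q / (t' - t) \<le> real N"
        using filterlim_real_sequentially unfolding filterlim_at_top by blast
      with lower[OF q(1)] have "\<forall>\<^sub>F N in sequentially. W (N + q) x \<le> (\<delta> ^ (N + q)) powr t"
      proof eventually_elim
        case (elim N)
        have "q * ((t' * N) * l) \<le> q * (- ln (W (N + q) x))"
          using elim(1) mult_right_mono[OF q', of "real N"] by (simp add: algebra_simps)
        hence 1: "(t' * N) * l \<le> - ln (W (N + q) x)" using q(1) by (simp only: mult_le_cancel_left_pos[of "real q"] of_nat_0_less_iff)
        have "t * (N + q) \<le> t' * N" using elim(2) t' by (simp add: pos_divide_le_eq algebra_simps)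
        hence "(t * (N + q)) * l \<le> (t' * N) * l" using l by (intro mult_right_mono) auto
        with 1 have 2: "ln (W (N + q) x) \<le> - ((t * (N + q)) * l)" by linarith
        have dq: "0 < \<delta> ^ (N + q)" using delta by simp
        have "(\<delta> ^ (N + q)) powr t = exp (- ((t * (N + q)) * l))"
          using delta by (simp add: powr_def ln_realpow l_def ln_div)
        moreover have "W (N + q) x \<le> exp (ln (W (N + q) x))"
        proof (cases "W (N + q) x = 0")
          case False
          hence "0 < W (N + q) x" unfolding W_def by (simp add: zero_less_measure_iff)
          thus ?thesis by simp
        qed simp
        moreover have "exp (ln (W (N + q) x)) \<le> exp (- ((t * (N + q)) * l))" using 2 by (simp only: exp_le_cancel_iff)
        ultimately show ?case by linarith
      qed
      then obtain N0 where N0: "\<And>N. N0 \<le> N \<Longrightarrow> W (N + q) x \<le> (\<delta> ^ (N + q)) powr t"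
        unfolding eventually_sequentially by blast
      hence "W N x \<le> (\<delta> ^ N) powr t" if "N0 + q \<le> N" for N
        using N0[of "N - q"] that by simp
      thus "\<exists>N0. \<forall>N\<ge>N0. prob {z. dist (dist z y) (dist x y) \<le> \<delta> ^ N} \<le> (\<delta> ^ N) powr t"
        unfolding W_def g_def dist_real_def by blast
    qed
  qed
qed

end

section \<open>Hausdorff dimension and measure\<close>

lemma hausdorff_zero_cover:
  assumes "hausdorff_measure t D = 0" "0 < \<epsilon>" "0 < \<eta>"
  shows "\<exists>U :: nat \<Rightarrow> 'a::metric_space set. D \<subseteq> (\<Union>i. U i) \<and> (\<forall>i. bounded (U i) \<and> diameter (U i) \<le> \<epsilon>)
     \<and> (\<Sum>i. ennreal (diameter (U i) powr t)) < ennreal \<eta>"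
proof -
  have "hausdorff_premeasure t \<epsilon> D \<le> hausdorff_measure t D"
    unfolding hausdorff_measure_def using assms(2) by (intro SUP_upper) auto
  hence "hausdorff_premeasure t \<epsilon> D < ennreal \<eta>" using assms by simp
  thus ?thesis unfolding hausdorff_premeasure_def INF_less_iff by blast
qed

lemma hausdorff_measure_zeroI:
  assumes "\<And>\<epsilon>. 0 < \<epsilon> \<Longrightarrow> hausdorff_premeasure t \<epsilon> S \<le> 0"
  shows "hausdorff_measure t S = 0"
proof -
  have "hausdorff_measure t S \<le> 0" unfolding hausdorff_measure_def using assms by (intro SUP_least) auto
  thus ?thesis by simp
qed

lemma diameter_nonneg: "0 \<le> diameter (U :: 'a::metric_space set)" if "bounded U"
proof (cases "U = {}")
  case False
  then obtain x where "x \<in> U" by blast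
  thus ?thesis using diameter_bounded_bound[OF that, of x x] by simp
qed (simp add: diameter_def)

lemma hausdorff_zero_distance_preserving:
  fixes \<phi> :: "'a::metric_space \<Rightarrow> 'b::metric_space"
  assumes D: "hausdorff_measure t D = 0" and t: "0 < t"
    and \<phi>: "\<And>x. x \<in> S \<Longrightarrow> \<phi> x \<in> D" "\<And>x x'. x \<in> S \<Longrightarrow> x' \<in> S \<Longrightarrow> dist (\<phi> x) (\<phi> x') = dist x x'"
  shows "hausdorff_measure t S = 0"
proof -
  have "hausdorff_premeasure t \<epsilon> S = 0" if e: "0 < \<epsilon>" for \<epsilon>
  proof -
    have "hausdorff_premeasure t \<epsilon> S \<le> 0 + ennreal \<eta>" if \<eta>: "0 < \<eta>" for \<eta>
    proof -
    obtain U where U: "D \<subseteq> (\<Union>i. U i)" "\<And>i. bounded (U i)" "\<And>i. diameter (U i) \<le> \<epsilon>"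
        "(\<Sum>i. ennreal (diameter (U i) powr t)) < ennreal \<eta>"
      using hausdorff_zero_cover[OF D e \<eta>] by blast
    define V where "V i = {x \<in> S. \<phi> x \<in> U i}" for i :: nat
    have dV: "dist x x' \<le> diameter (U i)" if "x \<in> V i" "x' \<in> V i" for x x' i
      using diameter_bounded_bound[OF U(2), of "\<phi> x" i "\<phi> x'"] \<phi>(2)[of x x'] that by (simp add: V_def)
    have bV: "bounded (V i)" for i
      unfolding bounded_two_points using dV[of _ i] by blast
    have diam: "diameter (V i) \<le> diameter (U i)" for i
    proof (cases "V i = {}")
      case True thus ?thesis using diameter_nonneg[OF U(2)] by (simp add: diameter_def)
    next
      case False
      thus ?thesis unfolding diameter_def[of "V i"] using dV[of _ i] by (auto intro!: cSUP_least)
    qed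
    have "hausdorff_premeasure t \<epsilon> S \<le> (\<Sum>i. ennreal (diameter (V i) powr t))"
      unfolding hausdorff_premeasure_def
    proof (rule INF_lower, intro CollectI conjI allI)
      show "S \<subseteq> (\<Union>i. V i)" using \<phi>(1) U(1) unfolding V_def by blast
      show "diameter (V i) \<le> \<epsilon>" for i using diam U(3) order_trans by blast
    qed (rule bV)
    also have "\<dots> \<le> (\<Sum>i. ennreal (diameter (U i) powr t))"
      using diam diameter_nonneg[OF bV] t by (intro suminf_le ennreal_leI powr_mono2) auto
    finally show ?thesis using U(4) by simp
    qed
    hence "hausdorff_premeasure t \<epsilon> S \<le> 0" by (rule ennreal_le_epsilon)
    thus ?thesis by simp
  qed
  thus ?thesis by (intro hausdorff_measure_zeroI) simp
qed

text \<open>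
  Boundedness of \<open>D\<close> is used for the infimum in the definition of the dimension to range over a nonempty
  set: covering by \<open>n\<close> intervals of equal length shows that the 2-dimensional measure vanishes.
\<close>

lemma hausdorff_dim_ge:
  assumes bounded: "bounded (D :: real set)" and s: "\<And>t. 0 < t \<Longrightarrow> hausdorff_measure t D = 0 \<Longrightarrow> s \<le> t"
  shows "s \<le> hausdorff_dim D"
proof -
  obtain b where b: "0 < b" "\<And>x. x \<in> D \<Longrightarrow> \<bar>x\<bar> < b"
    using bounded by (auto simp: bounded_pos_less)
  have "hausdorff_premeasure 2 \<epsilon> D \<le> 0" if e: "0 < \<epsilon>" for \<epsilon> :: real
  proof (rule ennreal_le_epsilon)
    fix \<eta> :: real assume \<eta>: "0 < \<eta>"
    obtain n :: nat where n: "max (2 * b / \<epsilon>) (4 * b\<^sup>2 / \<eta>) < real n" using reals_Archimedean2 by blast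
    have n0: "0 < n" using n b e by (smt (verit) divide_pos_pos of_nat_0_less_iff)
    define w where "w = 2 * b / n"
    have w: "0 < w" "w * n = 2 * b" using b n0 by (auto simp: w_def)
    define U where "U i = (if i < n then {w * i - b .. w * i - b + w} else {})" for i :: nat
    have diam: "diameter (U i) = (if i < n then w else 0)" for i
      unfolding U_def using w by (simp add: diameter_closed_interval)
    have "hausdorff_premeasure 2 \<epsilon> D \<le> (\<Sum>i. ennreal (diameter (U i) powr 2))"
      unfolding hausdorff_premeasure_def
    proof (rule INF_lower, intro CollectI conjI allI)
      show "D \<subseteq> (\<Union>i. U i)"
      proof
        fix x assume "x \<in> D"
        hence x: "- b < x" "x < b" using b(2)[of x] by auto
        define i where "i = nat \<lfloor>(x + b) / w\<rfloor>"
        have "0 \<le> (x + b) / w" using x w by simp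
        hence "real i \<le> (x + b) / w" "(x + b) / w < real i + 1" unfolding i_def by linarith+
        hence i: "w * i \<le> x + b" "x + b < w * i + w" using w by (simp_all add: field_simps)
        have "w * i < w * n" using i(1) x w(2) by linarith
        hence "i < n" using w(1) by simp
        with i have "x \<in> U i" unfolding U_def by auto
        thus "x \<in> (\<Union>i. U i)" by blast
      qed
      show "bounded (U i)" for i unfolding U_def by simp
      show "diameter (U i) \<le> \<epsilon>" for i
      proof -
        have "w \<le> \<epsilon>" using n n0 b e by (simp add: w_def field_simps)
        thus ?thesis using e by (simp add: diam)
      qed
    qed
    also have "\<dots> = (\<Sum>i<n. ennreal (diameter (U i) powr 2))"
      by (rule suminf_finite) (auto simp: diam)
    also have "\<dots> = (\<Sum>i<n. ennreal (w\<^sup>2))"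
      using w by (intro sum.cong refl) (auto simp: diam powr_numeral)
    also have "\<dots> = ennreal (n * w\<^sup>2)" by (simp add: ennreal_of_nat_eq_real_of_nat ennreal_mult')
    also have "n * w\<^sup>2 = 4 * b\<^sup>2 / n" using n0 by (simp add: w_def power2_eq_square)
    also have "ennreal (4 * b\<^sup>2 / n) \<le> 0 + ennreal \<eta>"
      using n n0 \<eta> by (simp add: field_simps ennreal_leI)
    finally show "hausdorff_premeasure 2 \<epsilon> D \<le> 0 + ennreal \<eta>" .
  qed
  hence "hausdorff_measure 2 D = 0" by (rule hausdorff_measure_zeroI)
  hence "{t. 0 < t \<and> hausdorff_measure t D = 0} \<noteq> {}" by (auto intro!: exI[of _ 2])
  thus ?thesis unfolding hausdorff_dim_def using s by (intro cInf_greatest) auto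
qed

text \<open>
  The mass distribution principle for the image of a measure under \<open>g\<close>. In an efficient cover of \<open>D\<close>, each
  set that meets \<open>g ` G\<close> lies in a ball around a point of \<open>g ` G\<close> whose mass is controlled by the
  diameter, so the masses of the covering sets could not add up to that of \<open>G\<close>.
\<close>

lemma mass_distribution:
 fixes g :: "'a \<Rightarrow> 'b::{metric_space, second_countable_topology}"
  assumes "prob_space M" and g [measurable]: "g \<in> M \<rightarrow>\<^sub>M borel"
    and [measurable]: "G \<in> sets M" and pos: "0 < measure M G" and GD: "g ` G \<subseteq> D"
    and t: "0 < t" and d: "0 < \<delta>" "\<delta> < 1"
    and decay: "\<And>x N. x \<in> G \<Longrightarrow> N0 \<le> N \<Longrightarrow> measure M {z \<in> space M. dist (g z) (g x) \<le> \<delta> ^ N} \<le> (\<delta> ^ N) powr t"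
  shows "hausdorff_measure t D \<noteq> 0"
proof
  assume zero: "hausdorff_measure t D = 0"
  interpret prob_space M by fact
  define \<eta> where "\<eta> = prob G * \<delta> powr t"
  have \<eta>: "0 < \<eta>" unfolding \<eta>_def using pos d by simp
  obtain U where U: "D \<subseteq> (\<Union>i. U i)" "\<And>i. bounded (U i)" "\<And>i. diameter (U i) \<le> \<delta> ^ N0"
      "(\<Sum>i. ennreal (diameter (U i) powr t)) < ennreal \<eta>"
    using hausdorff_zero_cover[OF zero zero_less_power[OF d(1), of N0] \<eta>] by blast
  define W where "W i = {z \<in> space M. g z \<in> U i \<and> z \<in> G}" for i :: nat
  have "\<exists>V \<in> sets M. W i \<subseteq> V \<and> prob V \<le> diameter (U i) powr t / \<delta> powr t" for i
  proof (cases "W i = {}")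
    case True
    thus ?thesis using d by (intro bexI[of _ "{}"]) auto
  next
    case False
    then obtain x where x: "x \<in> G" "g x \<in> U i" by (auto simp: W_def)
    let ?V = "{z \<in> space M. dist (g z) (g x) \<le> diameter (U i)}"
    have V: "?V \<in> sets M" by measurable
    have WV: "W i \<subseteq> ?V" using diameter_bounded_bound[OF U(2) _ x(2)] by (auto simp: W_def)
    have "prob ?V \<le> diameter (U i) powr t / \<delta> powr t"
    proof (cases "diameter (U i) = 0")
      case True
      have "prob ?V \<le> (\<delta> ^ N) powr t" if "N0 \<le> N" for N
      proof -
        have "prob ?V \<le> prob {z \<in> space M. dist (g z) (g x) \<le> \<delta> ^ N}"
          using d by (intro finite_measure_mono Collect_mono) (auto simp: True)
        thus ?thesis using decay[OF x(1) that] by linarith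
      qed
      moreover have "(\<lambda>N. (\<delta> ^ N) powr t) \<longlonglongrightarrow> 0 powr t"
        using d t by (intro tendsto_powr2 LIMSEQ_power_zero tendsto_const) auto
      ultimately have "prob ?V \<le> 0 powr t"
        by (intro LIMSEQ_le_const) auto
      thus ?thesis using True by simp
    next
      case False
      hence dpos: "0 < diameter (U i)" using diameter_nonneg[OF U(2)[of i]] by simp
      have ex: "\<exists>n. \<delta> ^ n < diameter (U i)" using real_arch_pow_inv[OF dpos d(2)] .
      \<comment> \<open>The scale with \<open>\<delta>\<^sup>N\<^sup>+\<^sup>1 < diam (U\<^sub>i) \<le> \<delta>\<^sup>N\<close>.\<close>
      define n where "n = (LEAST n. \<delta> ^ n < diameter (U i))"
      have n: "\<delta> ^ n < diameter (U i)" unfolding n_def using ex by (rule LeastI_ex)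
      have "N0 < n"
      proof (rule ccontr)
        assume "\<not> N0 < n"
        hence "\<delta> ^ N0 \<le> \<delta> ^ n" using d by (intro power_decreasing) auto
        thus False using n U(3)[of i] by linarith
      qed
      then obtain N where N: "n = Suc N" "N0 \<le> N" by (cases n) auto
      have "\<not> \<delta> ^ N < diameter (U i)" using not_less_Least[of N "\<lambda>n. \<delta> ^ n < diameter (U i)"] N(1) by (simp add: n_def)
      hence "prob ?V \<le> prob {z \<in> space M. dist (g z) (g x) \<le> \<delta> ^ N}"
        by (intro finite_measure_mono Collect_mono) auto
      also have "\<dots> \<le> (\<delta> ^ N) powr t" using decay[OF x(1) N(2)] .
      also have "\<dots> \<le> (diameter (U i) / \<delta>) powr t"
        using n N(1) d t by (intro powr_mono2) (auto simp: field_simps)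
      also have "\<dots> = diameter (U i) powr t / \<delta> powr t" using dpos d by (simp add: powr_divide)
      finally show ?thesis .
    qed
    with V WV show ?thesis by blast
  qed
  then obtain V where V: "\<And>i. V i \<in> sets M" "\<And>i. W i \<subseteq> V i" "\<And>i. prob (V i) \<le> diameter (U i) powr t / \<delta> powr t"
    by metis
  have "G \<subseteq> (\<Union>i. V i)"
  proof
    fix z assume z: "z \<in> G"
    hence "z \<in> space M" using sets.sets_into_space[OF \<open>G \<in> sets M\<close>] by blast
    then obtain i where "z \<in> W i" using z GD U(1) by (auto simp: W_def)
    thus "z \<in> (\<Union>i. V i)" using V(2) by blast
  qed
  hence "emeasure M G \<le> emeasure M (\<Union>i. V i)" using V(1) by (intro emeasure_mono) auto
  also have "\<dots> \<le> (\<Sum>i. emeasure M (V i))" using V(1) by (intro emeasure_subadditive_countably) auto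
  also have "\<dots> \<le> (\<Sum>i. ennreal (diameter (U i) powr t) * ennreal (1 / \<delta> powr t))"
  proof (intro suminf_le)
    fix i
    have "emeasure M (V i) \<le> ennreal (diameter (U i) powr t / \<delta> powr t)"
      unfolding emeasure_eq_measure using V(3) by (rule ennreal_leI)
    thus "emeasure M (V i) \<le> ennreal (diameter (U i) powr t) * ennreal (1 / \<delta> powr t)"
      by (simp add: ennreal_mult'[symmetric])
  qed auto
  also have "\<dots> = (\<Sum>i. ennreal (diameter (U i) powr t)) * ennreal (1 / \<delta> powr t)"
    by (rule ennreal_suminf_multc)
  also have "\<dots> < ennreal \<eta> * ennreal (1 / \<delta> powr t)"
    using U(4) d by (intro ennreal_mult_strict_right_mono) auto
  also have "\<dots> = ennreal (prob G)" using d by (simp add: \<eta>_def ennreal_mult'[symmetric])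
  finally show False by (simp add: emeasure_eq_measure)
qed

lemma closed_spt: "closed (spt \<mu>)"
proof -
  have "- spt \<mu> = \<Union>{U. open U \<and> emeasure \<mu> U = 0}"
    by (auto simp: spt_def)
  thus ?thesis by (simp add: closed_def open_Union)
qed

lemma AE_spt:
  fixes \<mu> :: "'a::second_countable_topology measure"
  assumes "sets \<mu> = sets borel"
  shows "AE x in \<mu>. x \<in> spt \<mu>"
proof -
  obtain \<U> where \<U>: "\<U> \<subseteq> {U. open U \<and> emeasure \<mu> U = 0}" "countable \<U>" "\<Union>\<U> = \<Union>{U. open U \<and> emeasure \<mu> U = 0}"
    using Lindelof[of "{U. open U \<and> emeasure \<mu> U = 0}"] by auto
  have "(\<Union>U\<in>\<U>. U) \<in> null_sets \<mu>"
    using \<U>(1,2) assms by (intro null_sets_UN') (auto simp: null_sets_def)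
  hence "\<Union>\<U> \<in> null_sets \<mu>" by simp
  moreover have "- spt \<mu> = \<Union>\<U>" unfolding \<U>(3) by (auto simp: spt_def)
  ultimately have "- spt \<mu> \<in> null_sets \<mu>" by simp
  from AE_not_in[OF this] show ?thesis by simp
qed

lemma bounded_distance_set: "bounded K \<Longrightarrow> bounded (distance_set K)"
proof -
  assume "bounded K"
  then obtain b where "\<And>x y. x \<in> K \<Longrightarrow> y \<in> K \<Longrightarrow> dist x y \<le> b" unfolding bounded_two_points by blast
  thus ?thesis unfolding distance_set_def bounded_iff by (intro exI[of _ b]) auto
qed

text \<open>
  The infimum that defines \<^const>\<open>measure_dim\<close> is a lower bound only if the dimensions are bounded below.
  They are: each is either nonnegative or the infimum of the empty set, which is a fixed number.
\<close>

lemma measure_dim_le: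
  fixes \<mu> :: "'a::metric_space measure"
  assumes "S \<in> sets \<mu>" "0 < emeasure \<mu> S" "0 < t" "hausdorff_measure t S = 0"
  shows "measure_dim \<mu> \<le> t"
proof -
  have ge: "min 0 (Inf {}) \<le> hausdorff_dim A" for A :: "'a set"
  proof (cases "{s. s > 0 \<and> hausdorff_measure s A = 0} = {}")
    case False
    hence "0 \<le> hausdorff_dim A" unfolding hausdorff_dim_def by (intro cInf_greatest) auto
    thus ?thesis by simp
  next
    case True
    hence "hausdorff_dim A = Inf {}" unfolding hausdorff_dim_def by (simp only:)
    thus ?thesis by simp
  qed
  have "measure_dim \<mu> \<le> hausdorff_dim S"
    unfolding measure_dim_def
  proof (rule cInf_lower)
    show "bdd_below {hausdorff_dim A |A. A \<in> sets \<mu> \<and> 0 < emeasure \<mu> A}"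
      using ge by (intro bdd_belowI[of _ "min 0 (Inf {})"]) auto
  qed (use assms in auto)
  also have "\<dots> \<le> t" unfolding hausdorff_dim_def
    using assms(3,4) by (intro cInf_lower bdd_belowI[of _ 0]) auto
  finally show ?thesis .
qed

section \<open>The dimension of distance sets\<close>

theorem proposition6p4:
  fixes \<E> :: "(real^2) set set" and \<Delta> :: partition_op and \<delta> :: real
    and Q :: "(nat \<Rightarrow> cp_state) measure"
    and B :: "(real^2) set" and \<mu> :: "(real^2) measure"
  assumes "ergodic_cp_chain \<E> \<Delta> \<delta> Q"
    and "generates \<E> \<Delta> B \<mu> Q"
    and "countable {\<pi> \<in> projections21. mean_entropy \<delta> Q \<pi> \<noteq> min 1 (measure_dim \<mu>)}"
  shows "hausdorff_dim (distance_set (spt \<mu>)) \<ge> min 1 (measure_dim \<mu>)"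
proof -
  define s where "s = min 1 (measure_dim \<mu>)"
  have chain: "box_collection \<E>" "partition_operator \<E> \<Delta>" "regular_partition \<E> \<Delta> \<delta>"
    using assms(1) by (auto simp: ergodic_cp_chain_def cp_chain_def)
  obtain P X c \<sigma>\<^sub>1 \<sigma>\<^sub>2 \<rho> where "generating_cells \<mu> P X \<delta> c \<sigma>\<^sub>1 \<sigma>\<^sub>2 \<rho> (measure_component Q)"
    using generates_imp_generating_cells[OF chain assms(2)] by blast
  then interpret generating_cells \<mu> P X \<delta> c \<sigma>\<^sub>1 \<sigma>\<^sub>2 \<rho> "measure_component Q" .
  have spt: "AE x in \<mu>. x \<in> spt \<mu>" using AE_spt[OF sets_eq] .
  have spt_borel: "spt \<mu> \<in> sets borel" by (intro borel_closed closed_spt)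
  have "\<exists>y. y \<in> spt \<mu>" using eventually_happens'[OF ae_filter_bot spt] .
  then obtain y where y: "y \<in> spt \<mu>" ..
  have bounded: "bounded (spt \<mu>)"
  proof -
    have bX: "bounded X"
    proof -
      have "bounded A" if "A \<in> P 0" for A using diam[OF that] unfolding bounded_two_points by blast
      hence "bounded (\<Union>(P 0))" by (intro bounded_Union) auto
      thus ?thesis by (rule bounded_subset) (use cell_at_in in blast)
    qed
    have "spt \<mu> \<subseteq> closure X"
    proof
      fix x assume x: "x \<in> spt \<mu>"
      show "x \<in> closure X"
      proof (rule ccontr)
        assume "x \<notin> closure X"
        hence "x \<in> - closure X" "open (- closure X)" by auto
        hence "0 < emeasure \<mu> (- closure X)" using x unfolding spt_def by blast
        moreover have "AE z in \<mu>. z \<notin> - closure X" using carried closure_subset[of X] by (auto elim: eventually_mono)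
        hence "- closure X \<in> null_sets \<mu>" by (subst AE_iff_null_sets) auto
        hence "emeasure \<mu> (- closure X) = 0" by (simp add: null_sets_def)
        ultimately show False by simp
      qed
    qed
    thus ?thesis using bX bounded_closure bounded_subset by blast
  qed
  have "s \<le> t" if t: "0 < t" and zero: "hausdorff_measure t (distance_set (spt \<mu>)) = 0" for t
  proof (rule ccontr)
    assume "\<not> s \<le> t"
    hence ts: "t < s" by simp
    \<comment> \<open>An arbitrary direction is added so that the union of the rays contains \<open>y\<close> itself.\<close>
    define Ex where "Ex = insert (axis 1 1) {e :: real^2. norm e = 1 \<and> mean_entropy \<delta> Q (\<lambda>z. z \<bullet> e) \<noteq> s}"
    have "countable {e :: real^2. norm e = 1 \<and> mean_entropy \<delta> Q (\<lambda>z. z \<bullet> e) \<noteq> s}"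
    proof (rule countable_image_inj_on)
      show "countable ((\<lambda>e z. z \<bullet> e) ` {e :: real^2. norm e = 1 \<and> mean_entropy \<delta> Q (\<lambda>z. z \<bullet> e) \<noteq> s})"
        by (rule countable_subset[OF _ assms(3)]) (auto simp: projections21_def s_def)
      show "inj_on (\<lambda>e z. z \<bullet> e) {e :: real^2. norm e = 1 \<and> mean_entropy \<delta> Q (\<lambda>z. z \<bullet> e) \<noteq> s}"
        by (rule inj_onI) (metis vector_eq_ldot)
    qed
    hence cEx: "countable Ex" by (simp add: Ex_def)
    define ray where "ray e = {x. x - y = dist x y *\<^sub>R e}" for e
    have ray_closed: "closed (ray e)" for e
      unfolding ray_def by (intro closed_Collect_eq continuous_intros)
    have ray_null: "AE x in \<mu>. x \<notin> ray e" if "e \<in> Ex" for e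
    proof -
      have ne: "norm e = 1" using that by (auto simp: Ex_def)
      have "emeasure \<mu> (ray e) = 0"
      proof (rule ccontr)
        assume "emeasure \<mu> (ray e) \<noteq> 0"
        moreover have "emeasure \<mu> (ray e) = emeasure \<mu> (ray e \<inter> spt \<mu>)"
          using spt spt_borel ray_closed by (intro emeasure_eq_AE) (auto elim: eventually_mono intro: borel_closed)
        ultimately have "0 < emeasure \<mu> (ray e \<inter> spt \<mu>)" by (simp add: zero_less_iff_neq_zero)
        moreover have "hausdorff_measure t (ray e \<inter> spt \<mu>) = 0"
        proof (rule hausdorff_zero_distance_preserving[OF zero t, of _ "\<lambda>x. dist x y"])
          show "dist x y \<in> distance_set (spt \<mu>)" if "x \<in> ray e \<inter> spt \<mu>" for x
            using that y unfolding distance_set_def by blast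
          fix x x' assume "x \<in> ray e \<inter> spt \<mu>" "x' \<in> ray e \<inter> spt \<mu>"
          hence r: "x - y = dist x y *\<^sub>R e" "x' - y = dist x' y *\<^sub>R e" by (auto simp: ray_def)
          have "x - x' = (x - y) - (x' - y)" by simp
          also have "\<dots> = (dist x y - dist x' y) *\<^sub>R e" unfolding r by (rule scaleR_diff_left[symmetric])
          finally have "x - x' = (dist x y - dist x' y) *\<^sub>R e" .
          hence "norm (x - x') = \<bar>dist x y - dist x' y\<bar>" using ne by simp
          thus "dist (dist x y) (dist x' y) = dist x x'" by (simp add: dist_real_def dist_norm)
        qed
        ultimately have "measure_dim \<mu> \<le> t"
          using t spt_borel ray_closed by (intro measure_dim_le) (auto intro: borel_closed)
        thus False using ts by (simp add: s_def)
      qed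
      hence "ray e \<in> null_sets \<mu>" using borel_closed[OF ray_closed] by (simp add: null_sets_def)
      thus ?thesis by (rule AE_not_in)
    qed
    have "AE x in \<mu>. \<forall>e\<in>Ex. x \<notin> ray e" using ray_null cEx by (subst AE_ball_countable) auto
    hence dir: "AE x in \<mu>. x \<noteq> y \<and> mean_entropy \<delta> Q (\<lambda>z. z \<bullet> sgn (x - y)) = s"
    proof eventually_elim
      case (elim x)
      have "y \<in> ray (axis 1 1)" by (simp add: ray_def)
      hence xy: "x \<noteq> y" using elim by (auto simp: Ex_def)
      have "x \<in> ray (sgn (x - y))" using xy by (simp add: ray_def sgn_div_norm dist_norm)
      hence "sgn (x - y) \<notin> Ex" using elim by blast
      thus ?case using xy by (simp add: Ex_def norm_sgn)
    qed
    define W where "W N x = prob {z. dist (dist z y) (dist x y) \<le> \<delta> ^ N}" for N x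
    define G where "G N0 = {x. \<forall>N\<ge>N0. W N x \<le> (\<delta> ^ N) powr t} \<inter> spt \<mu>" for N0
    have Wm [measurable]: "W N \<in> borel_measurable borel" for N
    proof -
      let ?\<nu> = "distr \<mu> borel (\<lambda>z. dist z y)"
      have "prob_space ?\<nu>" by (rule prob_space_distr) simp
      hence "(\<lambda>r. measure ?\<nu> (cball r (\<delta> ^ N))) \<in> borel_measurable borel"
        by (intro measurable_measure_cball) auto
      hence "(\<lambda>x. measure ?\<nu> (cball (dist x y) (\<delta> ^ N))) \<in> borel_measurable borel"
        by (rule measurable_compose[rotated]) simp
      moreover have "measure ?\<nu> (cball (dist x y) (\<delta> ^ N)) = W N x" for x
        unfolding W_def by (subst measure_distr) (auto simp: vimage_def dist_commute)
      ultimately show ?thesis by simp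
    qed
    have Gm: "G N0 \<in> events" for N0
    proof -
      have "{x \<in> space borel. \<forall>N\<ge>N0. W N x \<le> (\<delta> ^ N) powr t} \<in> sets borel" by measurable
      thus ?thesis using spt_borel unfolding G_def by simp
    qed
    have some: "AE x in \<mu>. \<exists>N0. x \<in> G N0"
      using AE_distance_local_dimension[OF refl less_imp_le[OF t] ts, of y] dir spt
      by eventually_elim (auto simp: G_def W_def)
    have "\<exists>N0. 0 < prob (G N0)"
    proof (rule ccontr)
      assume "\<nexists>N0. 0 < prob (G N0)"
      hence "prob (G N0) = 0" for N0 by (simp add: zero_less_measure_iff)
      hence "AE x in \<mu>. x \<notin> G N0" for N0
        using Gm by (intro AE_not_in) (simp add: null_sets_def emeasure_eq_measure)
      hence "AE x in \<mu>. \<forall>N0. x \<notin> G N0" by (simp add: AE_all_countable)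
      with some have "AE x in \<mu>. False" by eventually_elim auto
      thus False using eventually_happens'[OF ae_filter_bot] by blast
    qed
    then obtain N0 where "0 < prob (G N0)" ..
    have "hausdorff_measure t (distance_set (spt \<mu>)) \<noteq> 0"
    proof (rule mass_distribution[OF prob_space_axioms _ Gm \<open>0 < prob (G N0)\<close> _ t delta])
      show "(\<lambda>z. dist z y) ` G N0 \<subseteq> distance_set (spt \<mu>)"
        using y unfolding G_def distance_set_def by blast
    qed (auto simp: G_def W_def)
    thus False using zero by simp
  qed
  thus ?thesis unfolding s_def[symmetric] by (intro hausdorff_dim_ge bounded_distance_set bounded)
qed

end
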